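(* Let $j$ be a positive integer. Then, as an identity of polynomials in complex variables $d,e$, \[ \operatorname{Ch}_{2j-1}\big( (e-d) \times (e+d) \big) = (-1)^{j-1} \operatorname{Cat}(j-1) \sum_{k=0}^j f_k(j) \left[ \prod_{r=0}^{k-1} \big(d^2-(r+\tfrac{1}{2})^2 \big) \right] \left[ \prod_{r=k}^{j-1} \big(e^2-(r+\tfrac{1}{2})^2 \big) \right], \] where $\operatorname{Cat}(j-1)=\frac{(2j-2)!}{(j-1)!\,j!}$, $f_0(j)=1$ and $f_k(j)= (-1)^k \frac{j^{\downarrow k} \, (2j-1)^{\uparrow \uparrow k}}{k! \, (2k-1)!!}$ for $1\le k\le j$.
   Context: For a partition $\pi$ of $k$ and a partition $\lambda$ of $n$, $\operatorname{Ch}_\pi(\lambda)= n^{\downarrow k}\, \chi^\lambda_{\pi\cup(1^{n-k})}/f^\lambda$ if $n\ge k$ and $0$ otherwise ($\chi^\lambda_\mu$ the irreducible character of $\mathfrak{S}_n$ at cycle type $\mu$, $f^\lambda$ its dimension, $n^{\downarrow k}=n(n-1)\cdots(n-k+1)$); $\operatorname{Ch}_k:=\operatorname{Ch}_{(k)}$. $p\times q$ is the rectangular Young diagram with $p$ rows of length $q$. For fixed $\pi$ there is a unique polynomial in $\mathbb{Q}[p,q]$ agreeing with $\operatorname{Ch}_\pi(p\times q)$ at all positive integers $p,q$ (namely $(-1)^k\sum_{\sigma_1\sigma_2=w_\pi}(-q)^{\kappa(\sigma_1)}p^{\kappa(\sigma_2)}$ over $\sigma_1,\sigma_2\in\mathfrak{S}_k$,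 $w_\pi$ of cycle type $\pi$, $\kappa$ = number of cycles); for complex $p,q$, $\operatorname{Ch}_\pi(p\times q)$ means this polynomial's value. $a^{\uparrow\uparrow k}=\prod_{r=0}^{k-1}(a+2r)$, $a^{\uparrow\uparrow0}=1$. *)

theory Defs
  imports
    Complex_Main
    "HOL-Library.Function_Algebras"
    "HOL-Library.Multiset"
    "HOL-Computational_Algebra.Polynomial"
    "HOL-Combinatorics.Permutations"
    "HOL-Combinatorics.Orbits"
begin

text \<open>
  Complex-valued functions on an arbitrary type as a complex vector space (pointwise operations),
  which makes the library's dimension, independence and coordinates available.
\<close>

global_interpretation cfun: vector_space "\<lambda>(c::complex) (f :: 'a \<Rightarrow> complex) x. c * f x"
  defines cfun_subspace = cfun.subspace
    and cfun_span = cfun.span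
    and cfun_dependent = cfun.dependent
    and cfun_representation = cfun.representation
    and cfun_dim = cfun.dim
  by unfold_locales (auto simp: fun_eq_iff algebra_simps)

text \<open>
  Trace of a linear operator on an invariant subspace \<open>V\<close>, computed in a basis of \<open>V\<close>.
  For finite-dimensional \<open>V\<close> the value does not depend on the basis.
\<close>

definition trace_on :: "('a \<Rightarrow> complex) set \<Rightarrow> (('a \<Rightarrow> complex) \<Rightarrow> ('a \<Rightarrow> complex)) \<Rightarrow> complex" where
  "trace_on V T =
     (let B = (SOME B. B \<subseteq> V \<and> \<not> cfun_dependent B \<and> V \<subseteq> cfun_span B)
      in \<Sum>b\<in>B. cfun_representation B (T b) b)"


text \<open>
  A partition is a weakly decreasing list of positive integers. \<open>row_of \<lambda> m\<close> and \<open>col_of \<lambda> m\<close> are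
  the row and the column of the entry \<open>m\<close> in the tableau of shape \<open>\<lambda>\<close> that contains
  \<open>0, \<dots>, |\<lambda>| - 1\<close> in reading order, row by row.
\<close>

fun row_of :: "nat list \<Rightarrow> nat \<Rightarrow> nat" where
  "row_of [] m = 0"
| "row_of (a # la) m = (if m < a then 0 else Suc (row_of la (m - a)))"

fun col_of :: "nat list \<Rightarrow> nat \<Rightarrow> nat" where
  "col_of [] m = 0"
| "col_of (a # la) m = (if m < a then m else col_of la (m - a))"

definition sym_group :: "nat \<Rightarrow> (nat \<Rightarrow> nat) set" where
  "sym_group n = {w. w permutes {..<n}}"

definition row_stabilizer :: "nat list \<Rightarrow> (nat \<Rightarrow> nat) set" where
  "row_stabilizer la =
     {s \<in> sym_group (sum_list la). \<forall>m < sum_list la. row_of la (s m) = row_of la m}"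

definition col_stabilizer :: "nat list \<Rightarrow> (nat \<Rightarrow> nat) set" where
  "col_stabilizer la =
     {t \<in> sym_group (sum_list la). \<forall>m < sum_list la. col_of la (t m) = col_of la m}"

text \<open>
  An element \<open>\<Sum> f(w) w\<close> of the group algebra of the symmetric group is encoded by its coefficient
  function \<open>f\<close>, which vanishes outside the group.
\<close>

definition group_algebra :: "nat \<Rightarrow> ((nat \<Rightarrow> nat) \<Rightarrow> complex) set" where
  "group_algebra n = {f. \<forall>w. w \<notin> sym_group n \<longrightarrow> f w = 0}"

definition ga_mult ::
  "nat \<Rightarrow> ((nat \<Rightarrow> nat) \<Rightarrow> complex) \<Rightarrow> ((nat \<Rightarrow> nat) \<Rightarrow> complex) \<Rightarrow> ((nat \<Rightarrow> nat) \<Rightarrow> complex)" where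
  "ga_mult n f g = (\<lambda>w. \<Sum>u\<in>sym_group n. f u * g (inv u \<circ> w))"

definition ga_act :: "(nat \<Rightarrow> nat) \<Rightarrow> ((nat \<Rightarrow> nat) \<Rightarrow> complex) \<Rightarrow> ((nat \<Rightarrow> nat) \<Rightarrow> complex)" where
  "ga_act w f = (\<lambda>u. f (inv w \<circ> u))"

definition young_symmetrizer :: "nat list \<Rightarrow> (nat \<Rightarrow> nat) \<Rightarrow> complex" where
  "young_symmetrizer la =
     (\<lambda>g. \<Sum>(s, t) | s \<in> row_stabilizer la \<and> t \<in> col_stabilizer la \<and> s \<circ> t = g. of_int (sign t))"

text \<open>
  The irreducible representation indexed by \<open>\<lambda>\<close>: the left ideal generated by the Young symmetrizer
  (Specht module), on which the symmetric group acts by left multiplication.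
\<close>

definition specht_module :: "nat list \<Rightarrow> ((nat \<Rightarrow> nat) \<Rightarrow> complex) set" where
  "specht_module la =
     (\<lambda>f. ga_mult (sum_list la) f (young_symmetrizer la)) ` group_algebra (sum_list la)"

definition specht_character :: "nat list \<Rightarrow> (nat \<Rightarrow> nat) \<Rightarrow> complex" where
  "specht_character la w = trace_on (specht_module la) (ga_act w)"

definition specht_dim :: "nat list \<Rightarrow> nat" where
  "specht_dim la = cfun_dim (specht_module la)"

definition cycle_type :: "nat \<Rightarrow> (nat \<Rightarrow> nat) \<Rightarrow> nat multiset" where
  "cycle_type n w = image_mset card (mset_set (orbit w ` {..<n}))"

text \<open>Characters are class functions, so the choice of \<open>w\<close> is immaterial.\<close>

definition character_at :: "nat list \<Rightarrow> nat multiset \<Rightarrow> complex" where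
  "character_at la mu =
     specht_character la
       (SOME w. w \<in> sym_group (sum_list la) \<and> cycle_type (sum_list la) w = mu)"


definition falling :: "'a::comm_ring_1 \<Rightarrow> nat \<Rightarrow> 'a" where
  "falling a k = (\<Prod>r<k. a - of_nat r)"

definition rising2 :: "'a::comm_ring_1 \<Rightarrow> nat \<Rightarrow> 'a" where
  "rising2 a k = (\<Prod>r<k. a + 2 * of_nat r)"

fun double_fact :: "nat \<Rightarrow> nat" where
  "double_fact 0 = 1"
| "double_fact (Suc 0) = 1"
| "double_fact (Suc (Suc n)) = Suc (Suc n) * double_fact n"

text \<open>The normalized character; the partition \<open>\<pi>\<close> is given as the multiset of its parts.\<close>

definition Ch :: "nat multiset \<Rightarrow> nat list \<Rightarrow> complex" where
  "Ch mu la =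
     (let k = sum_mset mu; n = sum_list la in
      if k \<le> n
      then falling (of_nat n) k * character_at la (mu + replicate_mset (n - k) 1)
             / of_nat (specht_dim la)
      else 0)"

definition rect :: "nat \<Rightarrow> nat \<Rightarrow> nat list" where
  "rect p q = replicate p q"

text \<open>
  Elements of \<open>\<rat>[p, q]\<close> are encoded as polynomials in \<open>p\<close> whose coefficients are polynomials in \<open>q\<close>.
\<close>

definition eval2 :: "rat poly poly \<Rightarrow> complex \<Rightarrow> complex \<Rightarrow> complex" where
  "eval2 P p q = poly (map_poly (\<lambda>c. poly (map_poly of_rat c) q) P) p"

definition Ch_rect_poly :: "nat multiset \<Rightarrow> rat poly poly" where
  "Ch_rect_poly mu =
     (THE P. \<forall>p q :: nat. p > 0 \<longrightarrow> q > 0 \<longrightarrow> eval2 P (of_nat p) (of_nat q) = Ch mu (rect p q))"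

definition Ch_rect :: "nat multiset \<Rightarrow> complex \<Rightarrow> complex \<Rightarrow> complex" where
  "Ch_rect mu p q = eval2 (Ch_rect_poly mu) p q"

definition Cat :: "nat \<Rightarrow> complex" where
  "Cat m = fact (2 * m) / (fact m * fact (m + 1))"

definition f_coeff :: "nat \<Rightarrow> nat \<Rightarrow> complex" where
  "f_coeff k j =
     (if k = 0 then 1
      else (-1) ^ k * (falling (of_nat j) k * rising2 (2 * of_nat j - 1) k)
             / (fact k * of_nat (double_fact (2 * k - 1))))"

end

theory Submission
  imports Defs "HOL-Computational_Algebra.Formal_Power_Series"
begin

text \<open>
  Let \<open>c\<close> be the Young symmetrizer of \<open>p \<times> q\<close>. Since \<open>c\<^sup>2 = \<alpha> c\<close>, traces on the Specht module are
  sums of values of \<open>c\<close> over conjugates. Hence \<open>Ch\<^sub>k(p \<times> q)\<close> is a signed count of factorizations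
  \<open>s t = z\<close> of a \<open>k\<close>-cycle in the symmetric group on \<open>n = p q\<close> points, together with bijective
  labellings of these points by the boxes for which \<open>s\<close> preserves rows and \<open>t\<close> preserves columns.
  Then \<open>s\<close> and \<open>t\<close> fix what \<open>z\<close> fixes, and labellings of the \<open>k\<close> moved points that are not
  injective cancel in pairs. So \<open>Ch\<^sub>k(p \<times> q)\<close> is the sum of \<open>sgn(t) p\<^bsup>\<kappa>(s)\<^esup> q\<^bsup>\<kappa>(t)\<^esup>\<close> over \<open>s t = z\<close>,
  where \<open>\<kappa>\<close> counts cycles.

  For \<open>k = 2j - 1\<close>, \<open>p = e - d\<close>, \<open>q = e + d\<close> this polynomial is even in \<open>d\<close> and in \<open>e\<close> and has total
  degree at most \<open>2j\<close>. It vanishes for natural \<open>p, q\<close> with \<open>p + q \<le> k\<close>: the indicator function of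
  the \<open>k\<close>-cycles is, up to the factor \<open>- k\<close>, the combination of the exterior power characters
  \<open>g \<mapsto> \<Sum>\<^bsub>g S = S\<^esub> sgn(g|S)\<close> (over \<open>|S| = r\<close>) with coefficients \<open>(-1)\<^sup>r (r - p)\<close>, and a term
  can only survive if \<open>r \<le> p\<close> and \<open>k - r \<le> q\<close>. Bivariate Newton interpolation at the squares of
  half-integers then gives the shape of the right-hand side with unknown coefficients. These are
  read off from \<open>p = 1\<close>, where the polynomial is the falling factorial of \<open>q\<close>, and from \<open>d = e = 0\<close>.
\<close>

section \<open>Traces on Specht modules of rectangular shape\<close>

lemma sum_fun_apply: "(\<Sum>i\<in>A. f i) x = (\<Sum>i\<in>A. f i x)" for f :: "'i \<Rightarrow> 'a \<Rightarrow> 'b::comm_monoid_add"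
  by (induction A rule: infinite_finite_induct) auto

text \<open>The operator with kernel \<open>r\<close> sends every function on \<open>U\<close> into
  \<open>V\<close> and is \<alpha> times the identity on \<open>V\<close>. Its composition with
  \<open>T\<close> therefore has full trace \<alpha> times the trace on \<open>V\<close>, while in
  the coordinates at points of \<open>U\<close> that trace is a sum of kernel values. No division by
  \<alpha> occurs, so its value may stay unknown.\<close>

lemma scaled_trace_on:
  fixes V :: "('a \<Rightarrow> complex) set"
  assumes "finite U"
    and supp: "\<And>f x. f \<in> V \<Longrightarrow> x \<notin> U \<Longrightarrow> f x = 0"
    and r: "\<And>u. u \<in> U \<Longrightarrow> r u \<in> V"
    and eig: "\<And>f. f \<in> V \<Longrightarrow> (\<lambda>x. \<Sum>u\<in>U. f u * r u x) = (\<lambda>x. \<alpha> * f x)"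
    and T: "\<And>f. f \<in> V \<Longrightarrow> f \<circ> \<theta> \<in> V"
  shows "\<alpha> * trace_on V (\<lambda>f. f \<circ> \<theta>) = (\<Sum>u\<in>U. r u (\<theta> u))"
    and "\<alpha> * of_nat (cfun_dim V) = (\<Sum>u\<in>U. r u u)"
proof -
  have "\<exists>B. B \<subseteq> V \<and> \<not> cfun_dependent B \<and> V \<subseteq> cfun_span B"
    using cfun.maximal_independent_subset[of V] by metis
  define B where "B = (SOME B. B \<subseteq> V \<and> \<not> cfun_dependent B \<and> V \<subseteq> cfun_span B)"
  have B: "B \<subseteq> V" "\<not> cfun_dependent B" "V \<subseteq> cfun_span B"
    using someI_ex[OF \<open>\<exists>B. B \<subseteq> V \<and> \<not> cfun_dependent B \<and> V \<subseteq> cfun_span B\<close>] unfolding B_def by auto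
  let ?\<delta> = "\<lambda>u x. if x = u then 1 else (0::complex)"
  \<comment> \<open>The point masses on the finite set \<open>U\<close> span \<open>V\<close>, which
    makes the chosen basis \<open>B\<close> finite.\<close>
  have "V \<subseteq> cfun_span (?\<delta> ` U)"
  proof
    fix f assume f: "f \<in> V"
    have "f = (\<Sum>u\<in>U. (\<lambda>x. f u * ?\<delta> u x))"
    proof
      fix x
      have "(\<Sum>u\<in>U. f u * ?\<delta> u x) = (\<Sum>u\<in>U. if x = u then f u else 0)"
        by (rule sum.cong) auto
      then show "f x = (\<Sum>u\<in>U. (\<lambda>x. f u * ?\<delta> u x)) x"
        using supp[OF f] \<open>finite U\<close> by (simp add: sum_fun_apply)
    qed
    also have "\<dots> \<in> cfun_span (?\<delta> ` U)"
      by (intro cfun.span_sum cfun.span_scale cfun.span_base) auto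
    finally show "f \<in> cfun_span (?\<delta> ` U)" .
  qed
  then have "finite B"
    using cfun.independent_span_bound[of "?\<delta> ` U" B] \<open>finite U\<close> B by auto
  let ?rep = "cfun_representation B"
  \<comment> \<open>Used twice: with \<theta> for the trace, and with \<open>id\<close> for the
    dimension.\<close>
  have key: "(\<Sum>u\<in>U. r u (\<phi> u)) = \<alpha> * (\<Sum>b\<in>B. ?rep (b \<circ> \<phi>) b)"
    if \<phi>: "\<And>f. f \<in> V \<Longrightarrow> f \<circ> \<phi> \<in> V" for \<phi>
  proof -
    have "(\<Sum>u\<in>U. r u (\<phi> u)) = (\<Sum>u\<in>U. \<Sum>b\<in>B. ?rep (r u) b * b (\<phi> u))"
    proof (rule sum.cong[OF refl])
      fix u assume "u \<in> U"
      then have "(\<Sum>b\<in>B. (\<lambda>x. ?rep (r u) b * b x)) = r u"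
        using r B \<open>finite B\<close> by (intro cfun.sum_representation_eq) auto
      from fun_cong[OF this, of "\<phi> u"] show "r u (\<phi> u) = (\<Sum>b\<in>B. ?rep (r u) b * b (\<phi> u))"
        unfolding sum_fun_apply by (rule sym)
    qed
    also have "\<dots> = (\<Sum>b\<in>B. \<Sum>u\<in>U. ?rep (r u) b * b (\<phi> u))"
      by (rule sum.swap)
    also have "\<dots> = (\<Sum>b\<in>B. \<alpha> * ?rep (b \<circ> \<phi>) b)"
    proof (rule sum.cong[OF refl])
      fix b assume "b \<in> B"
      then have b\<phi>: "b \<circ> \<phi> \<in> V" using B \<phi> by auto
      \<comment> \<open>Coordinates with respect to \<open>B\<close> are linear, so the sum moves
        inside \<open>?rep\<close>, where the eigenvalue relation applies.\<close>
      have "(\<Sum>u\<in>U. ?rep (r u) b * b (\<phi> u)) = (\<Sum>u\<in>U. ?rep (\<lambda>x. (b \<circ> \<phi>) u * r u x) b)"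
        using r B by (intro sum.cong refl) (subst cfun.representation_scale, auto)
      also have "\<dots> = ?rep (\<Sum>u\<in>U. (\<lambda>x. (b \<circ> \<phi>) u * r u x)) b"
        using r B by (subst cfun.representation_sum) (auto intro!: cfun.span_scale)
      also have "(\<Sum>u\<in>U. (\<lambda>x. (b \<circ> \<phi>) u * r u x)) = (\<lambda>x. \<alpha> * (b \<circ> \<phi>) x)"
        using eig[OF b\<phi>] by (simp add: fun_eq_iff sum_fun_apply)
      also have "?rep \<dots> b = \<alpha> * ?rep (b \<circ> \<phi>) b"
        using b\<phi> B by (subst cfun.representation_scale) auto
      finally show "(\<Sum>u\<in>U. ?rep (r u) b * b (\<phi> u)) = \<alpha> * ?rep (b \<circ> \<phi>) b" .
    qed
    finally show ?thesis by (simp add: sum_distrib_left)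
  qed
  show "\<alpha> * trace_on V (\<lambda>f. f \<circ> \<theta>) = (\<Sum>u\<in>U. r u (\<theta> u))"
    using key[OF T] unfolding trace_on_def B_def[symmetric] by simp
  have "(\<Sum>b\<in>B. ?rep b b) = of_nat (card B)"
    using B by (simp add: cfun.representation_basis)
  also have "card B = cfun_dim V"
    using B by (intro cfun.basis_card_eq_dim)
  finally show "\<alpha> * of_nat (cfun_dim V) = (\<Sum>u\<in>U. r u u)"
    using key[of id] by simp
qed

section \<open>The symmetric group and convolution in its group algebra\<close>

lemma in_sym_group: "w \<in> sym_group n \<longleftrightarrow> w permutes {..<n}"
  by (simp add: sym_group_def)

lemma finite_sym_group [simp]: "finite (sym_group n)"
  by (simp add: sym_group_def finite_permutations)

lemma sym_group_closed [simp, intro]: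
  "id \<in> sym_group n"
  "u \<in> sym_group n \<Longrightarrow> v \<in> sym_group n \<Longrightarrow> u \<circ> v \<in> sym_group n"
  "u \<in> sym_group n \<Longrightarrow> inv u \<in> sym_group n"
  by (auto simp: in_sym_group permutes_id permutes_compose permutes_inv)

lemma sym_group_inverse_simps:
  assumes "u \<in> sym_group n"
  shows "u \<circ> (inv u \<circ> w) = w" "inv u \<circ> (u \<circ> w) = w" "inv (inv u) = u"
    "u \<circ> inv u = id" "inv u \<circ> u = id" "u (inv u x) = x" "inv u (u x) = x"
  using assms by (auto simp: in_sym_group fun_eq_iff permutes_inverses permutes_inv_inv)

lemma sym_group_inv_comp:
  assumes "u \<in> sym_group n" "v \<in> sym_group n"
  shows "inv (u \<circ> v) = inv v \<circ> inv u"
  using assms by (auto simp: in_sym_group intro!: o_inv_distrib permutes_bij)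

lemma bij_betw_sym_group:
  assumes "u \<in> sym_group n"
  shows "bij_betw (\<lambda>v. u \<circ> v) (sym_group n) (sym_group n)"
    and "bij_betw (\<lambda>v. v \<circ> u) (sym_group n) (sym_group n)"
    and "bij_betw (\<lambda>v. u \<circ> v \<circ> inv u) (sym_group n) (sym_group n)"
    and "bij_betw inv (sym_group n) (sym_group n)"
proof -
  note [simp] = sym_group_inverse_simps
  show "bij_betw (\<lambda>v. u \<circ> v) (sym_group n) (sym_group n)"
    by (rule bij_betw_byWitness[where f' = "\<lambda>v. inv u \<circ> v"]) (use assms in auto)
  show "bij_betw (\<lambda>v. v \<circ> u) (sym_group n) (sym_group n)"
    by (rule bij_betw_byWitness[where f' = "\<lambda>v. v \<circ> inv u"]) (use assms in \<open>auto simp: o_assoc[symmetric]\<close>)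
  show "bij_betw (\<lambda>v. u \<circ> v \<circ> inv u) (sym_group n) (sym_group n)"
    by (rule bij_betw_byWitness[where f' = "\<lambda>v. inv u \<circ> v \<circ> u"]) (use assms in \<open>auto simp: o_assoc[symmetric]\<close>)
  show "bij_betw inv (sym_group n) (sym_group n)"
    by (rule bij_betw_byWitness[where f' = inv]) (use assms in auto)
qed

lemma ga_mult_assoc:
  assumes w: "w \<in> sym_group n"
  shows "ga_mult n (ga_mult n f g) h w = ga_mult n f (ga_mult n g h) w"
proof -
  have "ga_mult n (ga_mult n f g) h w
      = (\<Sum>v\<in>sym_group n. \<Sum>u\<in>sym_group n. f v * g (inv v \<circ> u) * h (inv u \<circ> w))"
    unfolding ga_mult_def sum_distrib_right by (rule sum.swap)
  also have "\<dots> = (\<Sum>v\<in>sym_group n. \<Sum>u\<in>sym_group n. f v * (g u * h (inv u \<circ> (inv v \<circ> w))))"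
  proof (rule sum.cong[OF refl])
    fix v assume v: "v \<in> sym_group n"
    show "(\<Sum>u\<in>sym_group n. f v * g (inv v \<circ> u) * h (inv u \<circ> w))
        = (\<Sum>u\<in>sym_group n. f v * (g u * h (inv u \<circ> (inv v \<circ> w))))"
      by (subst sum.reindex_bij_betw[OF bij_betw_sym_group(1)[OF v], symmetric])
        (auto simp: sym_group_inverse_simps(2)[OF v] sym_group_inv_comp[OF v] comp_assoc mult.assoc intro!: sum.cong)
  qed
  also have "\<dots> = ga_mult n f (ga_mult n g h) w"
    by (simp add: ga_mult_def sum_distrib_left)
  finally show ?thesis .
qed

section \<open>Row and column stabilizers of a rectangle\<close>

lemma row_col_rect:
  assumes "m < p * q"
  shows "row_of (rect p q) m = m div q" "col_of (rect p q) m = m mod q"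
proof -
  have "row_of (rect p q) m = m div q \<and> col_of (rect p q) m = m mod q"
    using assms unfolding rect_def
  proof (induction p arbitrary: m)
    case (Suc p)
    have "q > 0" using Suc.prems by (cases q) auto
    then show ?case using Suc.IH[of "m - q"] Suc.prems by (auto simp: le_div_geq le_mod_geq)
  qed auto
  then show "row_of (rect p q) m = m div q" "col_of (rect p q) m = m mod q" by auto
qed

lemma sum_list_rect [simp]: "sum_list (rect p q) = p * q"
  by (simp add: rect_def sum_list_replicate)

lemma sym_group_less: "s \<in> sym_group n \<Longrightarrow> m < n \<Longrightarrow> s m < n"
  using permutes_in_image[of s "{..<n}" m] by (simp add: in_sym_group)

lemma row_stabilizer_rect:
  "s \<in> row_stabilizer (rect p q) \<longleftrightarrow> s \<in> sym_group (p * q) \<and> (\<forall>m<p * q. s m div q = m div q)"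
  by (auto simp: row_stabilizer_def row_col_rect sym_group_less)

lemma col_stabilizer_rect:
  "s \<in> col_stabilizer (rect p q) \<longleftrightarrow> s \<in> sym_group (p * q) \<and> (\<forall>m<p * q. s m mod q = m mod q)"
  by (auto simp: col_stabilizer_def row_col_rect sym_group_less)

lemma sym_group_ge: "s \<in> sym_group n \<Longrightarrow> \<not> m < n \<Longrightarrow> s m = m"
  using permutes_not_in[of s "{..<n}" m] by (simp add: in_sym_group)

lemma sym_group_sign:
  assumes "s \<in> sym_group n" "t \<in> sym_group n"
  shows "sign (s \<circ> t) = sign s * sign t" "sign (inv s) = sign s"
  using assms permutation_permutes[of s] permutation_permutes[of t]
  by (auto simp: in_sym_group intro!: sign_compose sign_inverse)

lemma stabilizer_rect_closed:
  shows "s \<in> row_stabilizer (rect p q) \<Longrightarrow> s' \<in> row_stabilizer (rect p q) \<Longrightarrow> s \<circ> s' \<in> row_stabilizer (rect p q)"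
    and "s \<in> row_stabilizer (rect p q) \<Longrightarrow> inv s \<in> row_stabilizer (rect p q)"
    and "s \<in> col_stabilizer (rect p q) \<Longrightarrow> s' \<in> col_stabilizer (rect p q) \<Longrightarrow> s \<circ> s' \<in> col_stabilizer (rect p q)"
    and "s \<in> col_stabilizer (rect p q) \<Longrightarrow> inv s \<in> col_stabilizer (rect p q)"
    and "id \<in> row_stabilizer (rect p q)" "id \<in> col_stabilizer (rect p q)"
proof -
  show "inv s \<in> row_stabilizer (rect p q)" if s: "s \<in> row_stabilizer (rect p q)" for s
  proof -
    have "inv s m div q = m div q" if "m < p * q" for m
      using s that sym_group_less[of "inv s" "p * q" m] sym_group_inverse_simps(6)[of s "p * q" m]
      by (metis row_stabilizer_rect sym_group_closed(3))
    then show ?thesis using s by (auto simp: row_stabilizer_rect)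
  qed
  show "inv s \<in> col_stabilizer (rect p q)" if s: "s \<in> col_stabilizer (rect p q)" for s
  proof -
    have "inv s m mod q = m mod q" if "m < p * q" for m
      using s that sym_group_less[of "inv s" "p * q" m] sym_group_inverse_simps(6)[of s "p * q" m]
      by (metis col_stabilizer_rect sym_group_closed(3))
    then show ?thesis using s by (auto simp: col_stabilizer_rect)
  qed
qed (auto simp: row_stabilizer_rect col_stabilizer_rect sym_group_less)

lemma row_col_stabilizer_trivial:
  assumes "s \<in> row_stabilizer (rect p q)" "s \<in> col_stabilizer (rect p q)"
  shows "s = id"
proof
  fix m show "s m = id m"
  proof (cases "m < p * q")
    case True
    then show ?thesis using assms unfolding row_stabilizer_rect col_stabilizer_rect
      by (metis div_mult_mod_eq id_apply)
  qed (use assms sym_group_ge in \<open>auto simp: row_stabilizer_rect\<close>)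
qed

text \<open>If no two boxes of a row have preimages in a common column, the boxes can be rearranged
  inside their rows so that each one lands in the column of its preimage. What remains of
  \<open>g\<close> then preserves columns.\<close>

lemma row_col_factorization:
  assumes g: "g \<in> sym_group (p * q)"
    and inj: "\<And>a b. a < p * q \<Longrightarrow> b < p * q \<Longrightarrow> a div q = b div q \<Longrightarrow> inv g a mod q = inv g b mod q \<Longrightarrow> a = b"
  obtains s t where "s \<in> row_stabilizer (rect p q)" "t \<in> col_stabilizer (rect p q)" "g = s \<circ> t"
proof (cases "q = 0")
  \<comment> \<open>Without columns there are no boxes, and the group is trivial.\<close>
  case True
  then have "g = id \<circ> id"
    using g by (simp add: in_sym_group)
  then show ?thesis using that stabilizer_rect_closed(5,6) by metis
next
  case False
  \<comment> \<open>Box \<open>a\<close> keeps its row and moves to the column of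
    \<open>inv g a\<close>; the hypothesis \<open>inj\<close> is exactly the injectivity of this
    map.\<close>
  define \<sigma> where "\<sigma> a = (if a < p * q then a div q * q + inv g a mod q else a)" for a
  have div: "\<sigma> a div q = a div q" and mod: "\<sigma> a mod q = inv g a mod q" if "a < p * q" for a
    using that False by (auto simp: \<sigma>_def)
  have "\<sigma> permutes {..<p * q}"
  proof (rule inj_imp_permutes)
    show "inj_on \<sigma> {..<p * q}"
      using inj div mod by (intro inj_onI) (metis lessThan_iff)
    show "\<sigma> a \<in> {..<p * q}" if "a \<in> {..<p * q}" for a
    proof -
      have "\<sigma> a div q < p"
        using that div by (simp add: less_mult_imp_div_less)
      then show ?thesis using False by (simp add: div_less_iff_less_mult)
    qed
  qed (auto simp: \<sigma>_def)
  then have \<sigma>: "\<sigma> \<in> row_stabilizer (rect p q)"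
    using div by (simp add: row_stabilizer_rect in_sym_group)
  then have \<sigma>': "\<sigma> \<in> sym_group (p * q)"
    by (simp add: row_stabilizer_rect)
  have "\<sigma> \<circ> g \<in> col_stabilizer (rect p q)"
    using \<sigma>' g mod by (auto simp: col_stabilizer_rect sym_group_less sym_group_inverse_simps)
  moreover have "g = inv \<sigma> \<circ> (\<sigma> \<circ> g)"
    by (simp add: sym_group_inverse_simps[OF \<sigma>'])
  ultimately show ?thesis
    using that stabilizer_rect_closed(2)[OF \<sigma>] by metis
qed

section \<open>The Young symmetrizer and the character of a rectangle\<close>

lemma young_symmetrizer_left:
  assumes "s \<in> row_stabilizer (rect p q)"
  shows "young_symmetrizer (rect p q) (s \<circ> g) = young_symmetrizer (rect p q) g"
proof -
  have s: "s \<in> sym_group (p * q)"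
    using assms by (simp add: row_stabilizer_rect)
  show ?thesis unfolding young_symmetrizer_def
    by (rule sum.reindex_bij_witness[of _ "\<lambda>(a, b). (s \<circ> a, b)" "\<lambda>(a, b). (inv s \<circ> a, b)"])
      (use assms s in \<open>auto simp: sym_group_inverse_simps stabilizer_rect_closed comp_assoc\<close>)
qed

lemma young_symmetrizer_right:
  assumes "t \<in> col_stabilizer (rect p q)"
  shows "young_symmetrizer (rect p q) (g \<circ> t) = of_int (sign t) * young_symmetrizer (rect p q) g"
proof -
  have t: "t \<in> sym_group (p * q)"
    using assms by (simp add: col_stabilizer_rect)
  have *: "b \<in> sym_group (p * q)" if "b \<in> col_stabilizer (rect p q)" for b
    using that by (simp add: col_stabilizer_rect)
  have **: "a \<circ> (b \<circ> inv t) = g" if "a \<circ> b = g \<circ> t" for a b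
    using that sym_group_inverse_simps(4)[OF t] by (metis comp_assoc comp_id)
  show ?thesis unfolding young_symmetrizer_def sum_distrib_left
    by (rule sum.reindex_bij_witness[of _ "\<lambda>(a, b). (a, b \<circ> t)" "\<lambda>(a, b). (a, b \<circ> inv t)"])
      (use assms t in \<open>auto simp: sym_group_inverse_simps[OF t] sym_group_sign[OF _ t] sym_group_sign[OF t]
          sym_group_sign[OF _ sym_group_closed(3)[OF t]] * ** stabilizer_rect_closed comp_assoc
         simp flip: of_int_mult\<close>)
qed

text \<open>If \<open>s \<circ> t = id\<close>, then \<open>t\<close> lies in both stabilizers,
  whose intersection is trivial; only the pair of identities contributes.\<close>

lemma young_symmetrizer_id [simp]: "young_symmetrizer (rect p q) id = 1"
proof -
  have "s = id \<and> t = id"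
    if "s \<in> row_stabilizer (rect p q)" "t \<in> col_stabilizer (rect p q)" "s \<circ> t = id" for s t
  proof -
    have "s \<in> sym_group (p * q)" using that by (simp add: row_stabilizer_rect)
    then have "t = inv s"
      using that(3) sym_group_inverse_simps(2)[of s "p * q" t] by simp
    then have "t \<in> row_stabilizer (rect p q)"
      using that stabilizer_rect_closed by metis
    then have "t = id" using that(2) row_col_stabilizer_trivial by blast
    then show ?thesis using that(3) by simp
  qed
  then have "{(s, t). s \<in> row_stabilizer (rect p q) \<and> t \<in> col_stabilizer (rect p q) \<and> s \<circ> t = id}
      = {(id, id)}"
    using stabilizer_rect_closed(5,6) by auto
  then show ?thesis by (simp add: young_symmetrizer_def)
qed

lemma young_symmetrizer_support:
  assumes "g \<notin> sym_group (p * q)"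
  shows "young_symmetrizer (rect p q) g = 0"
proof -
  have "{(s, t). s \<in> row_stabilizer (rect p q) \<and> t \<in> col_stabilizer (rect p q) \<and> s \<circ> t = g} = {}"
    using assms by (auto simp: row_stabilizer_rect col_stabilizer_rect)
  then show ?thesis unfolding young_symmetrizer_def by (simp only: sum.empty)
qed

text \<open>Von Neumann's argument: either \<open>g\<close> is a product of a row and a column
  permutation, and equivariance determines the value from the one at \<open>id\<close>, or some
  transposition acts on \<open>g\<close> both from the row side and from the column side, which
  forces the value to equal its own negative.\<close>

lemma bi_equivariant_eq_young_symmetrizer:
  fixes z :: "(nat \<Rightarrow> nat) \<Rightarrow> complex"
  assumes left: "\<And>s g. s \<in> row_stabilizer (rect p q) \<Longrightarrow> g \<in> sym_group (p * q) \<Longrightarrow> z (s \<circ> g) = z g"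
    and right: "\<And>t g. t \<in> col_stabilizer (rect p q) \<Longrightarrow> g \<in> sym_group (p * q) \<Longrightarrow> z (g \<circ> t) = of_int (sign t) * z g"
    and g: "g \<in> sym_group (p * q)"
  shows "z g = z id * young_symmetrizer (rect p q) g"
proof (cases "\<exists>a b. a < p * q \<and> b < p * q \<and> a div q = b div q \<and> inv g a mod q = inv g b mod q \<and> a \<noteq> b")
  case False
  then obtain s t where st: "s \<in> row_stabilizer (rect p q)" "t \<in> col_stabilizer (rect p q)" "g = s \<circ> t"
    using row_col_factorization[OF g] by metis
  then have t: "t \<in> sym_group (p * q)" by (simp add: col_stabilizer_rect)
  have "z g = of_int (sign t) * z id"
    using left[OF st(1) t] right[OF st(2), of id] st(3) by simp
  moreover have "young_symmetrizer (rect p q) g = of_int (sign t)"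
    using young_symmetrizer_left[OF st(1), of t] young_symmetrizer_right[OF st(2), of id] st(3) by simp
  ultimately show ?thesis by simp
next
  case True
  then obtain a b where ab: "a < p * q" "b < p * q" "a div q = b div q"
    "inv g a mod q = inv g b mod q" "a \<noteq> b" by blast
  \<comment> \<open>Two boxes of one row whose preimages share a column: \<tau> swaps the boxes,
    \<open>\<tau>'\<close> swaps the preimages, and both act on \<open>g\<close> in the same
    way.\<close>
  define \<tau> \<tau>' where "\<tau> = transpose a b" and "\<tau>' = transpose (inv g a) (inv g b)"
  have "inv g \<in> sym_group (p * q)" using g by simp
  then have lt: "inv g a < p * q" "inv g b < p * q" using ab sym_group_less by blast+
  have "inv g a \<noteq> inv g b" using ab(5) g by (metis sym_group_inverse_simps(6))
  then have sgn: "sign \<tau>' = -1" by (simp add: \<tau>'_def sign_swap_id)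
  have \<tau>: "\<tau> \<in> row_stabilizer (rect p q)" "\<tau>' \<in> col_stabilizer (rect p q)"
    using ab lt by (auto simp: row_stabilizer_rect col_stabilizer_rect \<tau>_def \<tau>'_def in_sym_group
        permutes_swap_id transpose_def)
  have "bij g" using g by (auto simp: in_sym_group permutes_bij)
  then have eq: "\<tau> \<circ> g = g \<circ> \<tau>'"
    unfolding \<tau>_def \<tau>'_def by (rule transpose_comp_eq)
  have "z g = - z g"
    using left[OF \<tau>(1) g] right[OF \<tau>(2) g] sgn eq by simp
  moreover have "young_symmetrizer (rect p q) g = - young_symmetrizer (rect p q) g"
    using young_symmetrizer_left[OF \<tau>(1), of g] young_symmetrizer_right[OF \<tau>(2), of g] sgn eq by simp
  ultimately show ?thesis by simp
qed

text \<open>The square inherits left invariance from its first factor and right antisymmetry from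
  its second, so it is a multiple of the symmetrizer.\<close>

lemma young_symmetrizer_square:
  assumes "g \<in> sym_group (p * q)"
  shows "ga_mult (p * q) (young_symmetrizer (rect p q)) (young_symmetrizer (rect p q)) g
    = ga_mult (p * q) (young_symmetrizer (rect p q)) (young_symmetrizer (rect p q)) id
        * young_symmetrizer (rect p q) g"
proof (rule bi_equivariant_eq_young_symmetrizer[OF _ _ assms])
  let ?c = "young_symmetrizer (rect p q)" and ?n = "p * q"
  show "ga_mult ?n ?c ?c (s \<circ> g) = ga_mult ?n ?c ?c g"
    if s: "s \<in> row_stabilizer (rect p q)" and g: "g \<in> sym_group ?n" for s g
  proof -
    have s': "s \<in> sym_group ?n" using s by (simp add: row_stabilizer_rect)
    have "ga_mult ?n ?c ?c (s \<circ> g) = (\<Sum>u\<in>sym_group ?n. ?c (s \<circ> u) * ?c (inv (s \<circ> u) \<circ> (s \<circ> g)))"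
      unfolding ga_mult_def
      by (subst sum.reindex_bij_betw[OF bij_betw_sym_group(1)[OF s'], symmetric]) simp
    also have "\<dots> = ga_mult ?n ?c ?c g"
      unfolding ga_mult_def
      by (rule sum.cong) (auto simp: young_symmetrizer_left[OF s] sym_group_inv_comp[OF s']
          comp_assoc sym_group_inverse_simps[OF s'])
    finally show ?thesis .
  qed
  show "ga_mult ?n ?c ?c (g \<circ> t) = of_int (sign t) * ga_mult ?n ?c ?c g"
    if t: "t \<in> col_stabilizer (rect p q)" for t g
    unfolding ga_mult_def sum_distrib_left
    by (rule sum.cong) (auto simp: young_symmetrizer_right[OF t] simp flip: comp_assoc)
qed

text \<open>Right multiplication by the symmetrizer \<open>?c\<close> is the kernel operator to
  which \<open>scaled_trace_on\<close> is applied: it maps the group algebra onto the Specht module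
  and is \<alpha> times the identity there because \<open>?c\<close> squares to \<alpha>
  \<open>?c\<close>. The action of \<open>w\<close> is composition with \<open>inv w\<close>, hence
  the inverse in the conjugates.\<close>

lemma specht_character_rect:
  assumes w: "w \<in> sym_group (p * q)"
  obtains \<alpha> where
    "\<alpha> * specht_character (rect p q) w
       = (\<Sum>u\<in>sym_group (p * q). young_symmetrizer (rect p q) (inv u \<circ> inv w \<circ> u))"
    "\<alpha> * of_nat (specht_dim (rect p q)) = fact (p * q)"
proof -
  let ?c = "young_symmetrizer (rect p q)" and ?n = "p * q"
  let ?S = "sym_group ?n" and ?V = "specht_module (rect p q)"
  define r :: "(nat \<Rightarrow> nat) \<Rightarrow> (nat \<Rightarrow> nat) \<Rightarrow> complex" where "r u x = ?c (inv u \<circ> x)" for u x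
  define \<alpha> where "\<alpha> = ga_mult ?n ?c ?c id"
  have r_eq: "(\<Sum>u\<in>?S. f u * r u x) = ga_mult ?n f ?c x" for f x
    by (simp add: r_def ga_mult_def)
  have supp: "ga_mult ?n h ?c x = 0" if "x \<notin> ?S" for h x
  proof -
    have "inv u \<circ> x \<notin> ?S" if u: "u \<in> ?S" for u
      using \<open>x \<notin> ?S\<close> u sym_group_inverse_simps(1)[OF u, of x] sym_group_closed(2)[OF u] by metis
    then show ?thesis by (simp add: ga_mult_def young_symmetrizer_support)
  qed
  have V: "?V = (\<lambda>f. ga_mult ?n f ?c) ` group_algebra ?n"
    by (simp add: specht_module_def)
  have 1: "f x = 0" if "f \<in> ?V" "x \<notin> ?S" for f x
    using that supp by (auto simp: V)
  have 2: "r u \<in> ?V" if "u \<in> ?S" for u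
  proof -
    \<comment> \<open>The translate \<open>r u\<close> is the product of the group element
      \<open>u\<close> with \<open>?c\<close>, so it lies in the left ideal.\<close>
    have "r u = ga_mult ?n (\<lambda>v. if v = u then 1 else 0) ?c"
    proof
      fix x
      have "(\<Sum>v\<in>?S. (if v = u then 1 else 0) * ?c (inv v \<circ> x)) = (\<Sum>v\<in>?S. if v = u then ?c (inv v \<circ> x) else 0)"
        by (rule sum.cong) auto
      then show "r u x = ga_mult ?n (\<lambda>v. if v = u then 1 else 0) ?c x"
        using that by (simp add: r_def ga_mult_def)
    qed
    moreover have "(\<lambda>v. if v = u then 1 else 0) \<in> group_algebra ?n"
      using that by (auto simp: group_algebra_def)
    ultimately show ?thesis by (auto simp: V)
  qed
  have 3: "(\<lambda>x. \<Sum>u\<in>?S. f u * r u x) = (\<lambda>x. \<alpha> * f x)" if "f \<in> ?V" for f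
  proof
    fix x
    obtain h where h: "f = ga_mult ?n h ?c" using \<open>f \<in> ?V\<close> by (auto simp: V)
    show "(\<Sum>u\<in>?S. f u * r u x) = \<alpha> * f x"
    proof (cases "x \<in> ?S")
      case True
      have "(\<Sum>u\<in>?S. f u * r u x) = ga_mult ?n h (ga_mult ?n ?c ?c) x"
        unfolding r_eq h by (rule ga_mult_assoc[OF True])
      also have "\<dots> = (\<Sum>u\<in>?S. h u * (\<alpha> * ?c (inv u \<circ> x)))"
        unfolding ga_mult_def[of _ h] \<alpha>_def using True
        by (intro sum.cong refl) (subst young_symmetrizer_square, auto)
      finally show ?thesis
        by (simp add: h ga_mult_def sum_distrib_left algebra_simps)
    qed (simp add: r_eq supp 1[OF that])
  qed
  have 4: "f \<circ> (\<lambda>u. inv w \<circ> u) \<in> ?V" if "f \<in> ?V" for f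
  proof -
    obtain h where h: "f = ga_mult ?n h ?c" "h \<in> group_algebra ?n" using \<open>f \<in> ?V\<close> by (auto simp: V)
    have "f \<circ> (\<lambda>u. inv w \<circ> u) = ga_mult ?n (h \<circ> (\<lambda>u. inv w \<circ> u)) ?c"
    proof
      fix x
      have "ga_mult ?n (h \<circ> (\<lambda>u. inv w \<circ> u)) ?c x
          = (\<Sum>u\<in>?S. h (inv w \<circ> (w \<circ> u)) * ?c (inv (w \<circ> u) \<circ> x))"
        unfolding ga_mult_def
        by (subst sum.reindex_bij_betw[OF bij_betw_sym_group(1)[OF w], symmetric]) simp
      also have "\<dots> = ga_mult ?n h ?c (inv w \<circ> x)"
        unfolding ga_mult_def
        by (rule sum.cong) (auto simp: sym_group_inverse_simps[OF w] sym_group_inv_comp[OF w] comp_assoc)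
      finally show "(f \<circ> (\<lambda>u. inv w \<circ> u)) x = ga_mult ?n (h \<circ> (\<lambda>u. inv w \<circ> u)) ?c x"
        by (simp add: h(1))
    qed
    moreover have "inv w \<circ> x \<notin> ?S" if "x \<notin> ?S" for x
      using that w by (metis sym_group_closed(2) sym_group_inverse_simps(1))
    then have "h \<circ> (\<lambda>u. inv w \<circ> u) \<in> group_algebra ?n"
      using h(2) by (auto simp: group_algebra_def)
    ultimately show ?thesis by (auto simp: V)
  qed
  have act: "ga_act w = (\<lambda>f. f \<circ> (\<lambda>u. inv w \<circ> u))"
    by (simp add: ga_act_def fun_eq_iff)
  have tr: "\<alpha> * trace_on ?V (\<lambda>f. f \<circ> (\<lambda>u. inv w \<circ> u)) = (\<Sum>u\<in>?S. r u (inv w \<circ> u))"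
    "\<alpha> * of_nat (cfun_dim ?V) = (\<Sum>u\<in>?S. r u u)"
    by (rule scaled_trace_on[of ?S ?V r \<alpha> "\<lambda>u. inv w \<circ> u"],
        rule finite_sym_group, erule (1) 1, erule 2, erule 3, erule 4)+
  show ?thesis
  proof
    show "\<alpha> * specht_character (rect p q) w = (\<Sum>u\<in>?S. ?c (inv u \<circ> inv w \<circ> u))"
      using tr(1) by (simp add: specht_character_def act r_def comp_assoc)
    have "\<alpha> * of_nat (specht_dim (rect p q)) = (\<Sum>u\<in>?S. r u u)"
      unfolding specht_dim_def by (rule tr(2))
    \<comment> \<open>Each diagonal value of the kernel is the coefficient of \<open>?c\<close> at
      the identity.\<close>
    also have "\<dots> = (\<Sum>u\<in>?S. 1)"
      by (rule sum.cong) (auto simp: r_def sym_group_inverse_simps)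
    also have "\<dots> = fact ?n"
      using card_permutations[of "{..<?n}" ?n] by (simp add: sym_group_def)
    finally show "\<alpha> * of_nat (specht_dim (rect p q)) = fact ?n" .
  qed
qed

section \<open>Cycles and colourings\<close>

text \<open>The orbits are those of \<open>t\<close> itself, so \<open>K\<close> may also be an
  invariant subset of the set that \<open>t\<close> permutes. Fixed points count as cycles.\<close>

definition num_cycles :: "'a set \<Rightarrow> ('a \<Rightarrow> 'a) \<Rightarrow> nat" where
  "num_cycles K t = card (orbit t ` K)"

definition fixed_colourings :: "'a set \<Rightarrow> 'b set \<Rightarrow> ('a \<Rightarrow> 'a) \<Rightarrow> ('a \<Rightarrow> 'b) set" where
  "fixed_colourings K Y t = {y \<in> K \<rightarrow>\<^sub>E Y. \<forall>x\<in>K. y (t x) = y x}"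

lemma permutes_self_in_orbit:
  assumes "finite K" "t permutes K"
  shows "x \<in> orbit t x"
  using assms permutation_permutes permutation_self_in_orbit by metis

lemma permutes_orbit_step:
  assumes "finite K" "t permutes K"
  shows "orbit t (t x) = orbit t x"
  using assms permutation_permutes permutation_orbit_step by metis

text \<open>An invariant colouring is constant on cycles, hence is the same thing as a colouring of
  the set of orbits. This turns powers with exponent \<open>num_cycles\<close> into counts, to which
  sign-reversing involutions can be applied.\<close>

lemma card_fixed_colourings:
  assumes K: "finite K" "t permutes K"
  shows "card (fixed_colourings K Y t) = card Y ^ num_cycles K t"
proof -
  let ?F = "\<lambda>G. \<lambda>x\<in>K. G (orbit t x)"
  have tK: "t x \<in> K" if "x \<in> K" for x
    using that permutes_in_image[OF K(2)] by simp
  have "bij_betw ?F (orbit t ` K \<rightarrow>\<^sub>E Y) (fixed_colourings K Y t)"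
    unfolding bij_betw_def
  proof
    show "inj_on ?F (orbit t ` K \<rightarrow>\<^sub>E Y)"
    proof (rule inj_onI)
      fix G H assume *: "G \<in> orbit t ` K \<rightarrow>\<^sub>E Y" "H \<in> orbit t ` K \<rightarrow>\<^sub>E Y" "?F G = ?F H"
      show "G = H"
      proof (rule PiE_ext[OF *(1,2)])
        fix A assume "A \<in> orbit t ` K"
        then show "G A = H A" using fun_cong[OF *(3)] by (metis (mono_tags, lifting) imageE restrict_apply')
      qed
    qed
    show "?F ` (orbit t ` K \<rightarrow>\<^sub>E Y) = fixed_colourings K Y t"
    proof
      show "?F ` (orbit t ` K \<rightarrow>\<^sub>E Y) \<subseteq> fixed_colourings K Y t"
        using tK by (auto simp: fixed_colourings_def permutes_orbit_step[OF K])
      show "fixed_colourings K Y t \<subseteq> ?F ` (orbit t ` K \<rightarrow>\<^sub>E Y)"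
      proof
        fix y assume y: "y \<in> fixed_colourings K Y t"
        have const: "z \<in> K \<and> y z = y x" if "z \<in> orbit t x" "x \<in> K" for z x
          using that by induction (use y tK in \<open>auto simp: fixed_colourings_def\<close>)
        \<comment> \<open>The colour of an orbit is read off at an arbitrary representative;
          \<open>const\<close> makes the choice harmless.\<close>
        let ?G = "\<lambda>A\<in>orbit t ` K. y (SOME z. z \<in> A)"
        have some: "(SOME z. z \<in> orbit t x) \<in> orbit t x" for x
          using permutes_self_in_orbit[OF K] by (rule someI)
        have "y = ?F ?G"
        proof
          fix x show "y x = ?F ?G x"
            using const[OF some, of x] y by (auto simp: fixed_colourings_def)
        qed
        moreover have "?G \<in> orbit t ` K \<rightarrow>\<^sub>E Y"
          using const[OF some] y by (auto simp: fixed_colourings_def)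
        ultimately show "y \<in> ?F ` (orbit t ` K \<rightarrow>\<^sub>E Y)" by (rule image_eqI)
      qed
    qed
  qed
  from bij_betw_same_card[OF this] show ?thesis
    using K by (simp add: card_funcsetE num_cycles_def)
qed

section \<open>Cycle counts and signs\<close>

lemma num_cycles_pos:
  assumes "finite K" "K \<noteq> {}"
  shows "num_cycles K t > 0"
  using assms by (simp add: num_cycles_def card_gt_0_iff)

lemma num_cycles_id: "num_cycles K id = card K"
proof -
  have "orbit id ` K = (\<lambda>x. {x}) ` K"
    using orbit_eq_singleton_iff[of id] by (intro image_cong refl) simp
  then show ?thesis by (simp add: num_cycles_def card_image)
qed

lemma num_cycles_cyclic: "cyclic_on z K \<Longrightarrow> num_cycles K z = 1"
proof -
  assume "cyclic_on z K"
  then have "orbit z ` K = {K}" by (auto simp: cyclic_on_alldef)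
  then show ?thesis by (simp add: num_cycles_def)
qed

lemma num_cycles_conj:
  assumes K: "finite K" "t permutes K" "h permutes K"
  shows "num_cycles K (h \<circ> t \<circ> inv h) = num_cycles K t"
proof -
  have "h ` orbit t x = orbit (h \<circ> t \<circ> inv h) (h x)" for x
    by (rule orbit_inverse) (use permutes_self_in_orbit[OF K(1,2)] in \<open>auto simp: permutes_inverses[OF K(3)]\<close>)
  then have "orbit (h \<circ> t \<circ> inv h) ` K = (\<lambda>A. h ` A) ` (orbit t ` K)"
    by (subst permutes_image[OF K(3), symmetric]) (simp only: image_image)
  moreover have "inj_on (\<lambda>A. h ` A) (orbit t ` K)"
    by (rule inj_on_subset[OF _ subset_UNIV]) (use permutes_inj[OF K(3)] in \<open>auto simp: inj_image_eq_iff intro!: injI\<close>)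
  ultimately show ?thesis by (simp add: num_cycles_def card_image)
qed

text \<open>The new permutation fixes \<open>a\<close> and sends its former predecessor to
  \<open>t a\<close>, so it splits \<open>a\<close> off its cycle. Instead of following orbits, the
  proof counts invariant two-colourings: the colour of \<open>a\<close> becomes free, which doubles
  their number.\<close>

lemma num_cycles_transpose:
  assumes K: "finite K" "t permutes K" and a: "t a \<noteq> a"
  shows "num_cycles K (transpose a (t a) \<circ> t) = Suc (num_cycles K t)"
proof -
  define t' where "t' = transpose a (t a) \<circ> t"
  have aK: "a \<in> K" "t a \<in> K"
    using a K permutes_not_in[OF K(2)] permutes_in_image[OF K(2)] by auto
  have t': "t' permutes K"
    unfolding t'_def by (intro permutes_compose K permutes_swap_id aK)
  have tK: "t x \<in> K" if "x \<in> K" for x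
    using that permutes_in_image[OF K(2)] by simp
  have inj: "t x = t y \<longleftrightarrow> x = y" for x y
    using permutes_inj[OF K(2)] by (auto simp: inj_def)
  have t'_eq: "t' x = (if x = a then a else if t x = a then t a else t x)" for x
    using inj by (auto simp: t'_def transpose_def)
  let ?Y = "{0, 1 :: nat}"
  \<comment> \<open>The free colour of \<open>a\<close> is recorded separately; overwriting it by
    the colour of \<open>t a\<close> makes the colouring invariant under \<open>t\<close>.\<close>
  have "bij_betw (\<lambda>y. (y a, y(a := y (t a)))) (fixed_colourings K ?Y t') (?Y \<times> fixed_colourings K ?Y t)"
  proof (rule bij_betw_byWitness[where f' = "\<lambda>(v, y). y(a := v)"])
    show "\<forall>y\<in>fixed_colourings K ?Y t'. (\<lambda>(v, y). y(a := v)) (y a, y(a := y (t a))) = y"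
      by simp
    show "\<forall>vy\<in>?Y \<times> fixed_colourings K ?Y t. (\<lambda>y. (y a, y(a := y (t a)))) ((\<lambda>(v, y). y(a := v)) vy) = vy"
      using a aK by (auto simp: fixed_colourings_def fun_upd_def fun_eq_iff)
    show "(\<lambda>y. (y a, y(a := y (t a)))) ` fixed_colourings K ?Y t' \<subseteq> ?Y \<times> fixed_colourings K ?Y t"
    proof
      fix vy assume "vy \<in> (\<lambda>y. (y a, y(a := y (t a)))) ` fixed_colourings K ?Y t'"
      then obtain y where y: "y \<in> fixed_colourings K ?Y t'" and vy: "vy = (y a, y(a := y (t a)))" by blast
      have yE: "y \<in> K \<rightarrow>\<^sub>E ?Y" and yt: "\<And>x. x \<in> K \<Longrightarrow> y (t' x) = y x"
        using y unfolding fixed_colourings_def by blast+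
      have "(y(a := y (t a))) (t x) = (y(a := y (t a))) x" if "x \<in> K" for x
        using yt[OF that] a by (auto simp: t'_eq split: if_splits)
      moreover have "y(a := y (t a)) \<in> K \<rightarrow>\<^sub>E ?Y"
        using PiE_fun_upd[of "y (t a)" "\<lambda>_. ?Y" a y K] PiE_mem[OF yE aK(2)] yE aK(1)
        by (simp only: insert_absorb)
      ultimately show "vy \<in> ?Y \<times> fixed_colourings K ?Y t"
        using PiE_mem[OF yE aK(1)] unfolding vy fixed_colourings_def by blast
    qed
    show "(\<lambda>(v, y). y(a := v)) ` (?Y \<times> fixed_colourings K ?Y t) \<subseteq> fixed_colourings K ?Y t'"
    proof
      fix y' assume "y' \<in> (\<lambda>(v, y). y(a := v)) ` (?Y \<times> fixed_colourings K ?Y t)"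
      then obtain v y where v: "v \<in> ?Y" and y: "y \<in> fixed_colourings K ?Y t" and y': "y' = y(a := v)" by auto
      have yE: "y \<in> K \<rightarrow>\<^sub>E ?Y" and yt: "\<And>x. x \<in> K \<Longrightarrow> y (t x) = y x"
        using y unfolding fixed_colourings_def by blast+
      have "y' (t' x) = y' x" if "x \<in> K" for x
        using yt[OF that] yt[OF aK(1)] a by (auto simp: t'_eq y')
      moreover have "y' \<in> K \<rightarrow>\<^sub>E ?Y"
        using PiE_fun_upd[of v "\<lambda>_. ?Y" a y K] v yE aK(1) y' by (simp only: insert_absorb)
      ultimately show "y' \<in> fixed_colourings K ?Y t'"
        unfolding fixed_colourings_def by blast
    qed
  qed
  from bij_betw_same_card[OF this] have "(2::nat) ^ num_cycles K t' = 2 ^ Suc (num_cycles K t)"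
    by (simp add: numeral_2_eq_2 card_cartesian_product card_fixed_colourings[OF K(1) t'] card_fixed_colourings[OF K])
  then have "num_cycles K t' = Suc (num_cycles K t)"
    by (subst (asm) power_inject_exp) auto
  then show ?thesis by (simp add: t'_def)
qed

text \<open>Induction on the number of moved points: splitting off one of them reverses the sign and
  adds one cycle, until the identity is reached.\<close>

lemma sign_num_cycles:
  assumes "finite K" "t permutes K"
  shows "sign t = (-1) ^ (card K + num_cycles K t)"
  using assms(2)
proof (induction "card {x\<in>K. t x \<noteq> x}" arbitrary: t rule: less_induct)
  case less
  show ?case
  proof (cases "\<exists>a. t a \<noteq> a")
    case False
    then have "t = id" by auto
    then show ?thesis by (simp add: num_cycles_id flip: mult_2)
  next
    case True
    then obtain a where a: "t a \<noteq> a" by blast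
    define t' where "t' = transpose a (t a) \<circ> t"
    have aK: "a \<in> K" "t a \<in> K"
      using a less.prems permutes_not_in[OF less.prems] permutes_in_image[OF less.prems] by auto
    have t': "t' permutes K"
      unfolding t'_def by (intro permutes_compose less.prems permutes_swap_id aK)
    have inj: "t x = t y \<longleftrightarrow> x = y" for x y
      using permutes_inj[OF less.prems] by (auto simp: inj_def)
    have "{x\<in>K. t' x \<noteq> x} \<subset> {x\<in>K. t x \<noteq> x}"
      using a aK inj by (auto simp: t'_def transpose_def)
    then have "card {x\<in>K. t' x \<noteq> x} < card {x\<in>K. t x \<noteq> x}"
      using assms(1) by (intro psubset_card_mono) auto
    from less.hyps[OF this t'] have "sign t' = (-1) ^ (card K + Suc (num_cycles K t))"
      using num_cycles_transpose[OF assms(1) less.prems a] by (simp add: t'_def)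
    moreover have "sign t' = - sign t"
      unfolding t'_def using a assms(1) less.prems permutation_permutes
      by (subst sign_compose) (auto simp: permutation_swap_id sign_swap_id)
    ultimately show ?thesis by simp
  qed
qed

lemma cyclic_on_closed_subset:
  assumes "cyclic_on z K" "M \<subseteq> K" "M \<noteq> {}" "z ` M \<subseteq> M"
  shows "M = K"
proof -
  obtain x where "x \<in> M" using assms by blast
  have "y \<in> M" if "y \<in> orbit z x" for y
    using that by induction (use \<open>x \<in> M\<close> assms(4) in auto)
  moreover have "orbit z x = K"
    using assms \<open>x \<in> M\<close> by (auto simp: cyclic_on_alldef)
  ultimately show ?thesis using assms(2) by blast
qed

text \<open>
  Each element of \<open>K\<close> is an edge joining its \<open>s\<close>-cycle to its \<open>t\<close>-cycle; the graph is connected,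
  and it is grown edge by edge.
\<close>

lemma num_cycles_add_le:
  assumes K: "finite K" "s permutes K" "t permutes K" and cyc: "cyclic_on (s \<circ> t) K"
  shows "num_cycles K s + num_cycles K t \<le> card K + 1"
proof -
  \<comment> \<open>Vertices, that is cycles met by \<open>M\<close>, are counted on the left, and
    edges on the right. A single edge satisfies the bound.\<close>
  define P where "P M \<longleftrightarrow> M \<subseteq> K \<and> M \<noteq> {} \<and> card (orbit s ` M) + card (orbit t ` M) \<le> card M + 1" for M
  obtain x where "x \<in> K" using cyc by (auto simp: cyclic_on_def)
  then have "P {x}" by (simp add: P_def)
  moreover have "finite {M. P M}"
    using finite_subset[of "{M. P M}" "Pow K"] K by (auto simp: P_def)
  ultimately obtain M where M: "P M" and max: "\<And>M'. P M' \<Longrightarrow> M \<subseteq> M' \<Longrightarrow> M' = M"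
    using finite_has_maximal[of "{M. P M}"] by auto
  have "finite M" using M K finite_subset by (auto simp: P_def)
  \<comment> \<open>An edge that shares an endpoint with \<open>M\<close> brings at most one new
    vertex, so it could be added to \<open>M\<close> against maximality.\<close>
  have add: False if "y \<in> K" "y \<notin> M" "orbit s y \<in> orbit s ` M \<or> orbit t y \<in> orbit t ` M" for y
  proof -
    have "card (insert (orbit s y) (orbit s ` M)) + card (insert (orbit t y) (orbit t ` M))
        \<le> Suc (card (orbit s ` M) + card (orbit t ` M))"
      using that(3) \<open>finite M\<close> by (auto simp: card_insert_if insert_absorb)
    then have "P (insert y M)"
      using M that(1,2) \<open>finite M\<close> by (simp add: P_def)
    then show False using max[of "insert y M"] that(2) by blast
  qed
  have "s ` M \<subseteq> M" "t ` M \<subseteq> M"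
  proof -
    show "s ` M \<subseteq> M"
    proof
      fix y assume "y \<in> s ` M"
      then obtain x where x: "x \<in> M" "y = s x" by blast
      then have "y \<in> K" using M permutes_in_image[OF K(2)] by (auto simp: P_def)
      moreover have "orbit s y = orbit s x" using x permutes_orbit_step[OF K(1,2)] by simp
      ultimately show "y \<in> M" using add[of y] x(1) by auto
    qed
    show "t ` M \<subseteq> M"
    proof
      fix y assume "y \<in> t ` M"
      then obtain x where x: "x \<in> M" "y = t x" by blast
      then have "y \<in> K" using M permutes_in_image[OF K(3)] by (auto simp: P_def)
      moreover have "orbit t y = orbit t x" using x permutes_orbit_step[OF K(1,3)] by simp
      ultimately show "y \<in> M" using add[of y] x(1) by auto
    qed
  qed
  then have "M = K"
    using M by (intro cyclic_on_closed_subset[OF cyc]) (auto simp: P_def)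
  then show ?thesis using M by (simp add: P_def num_cycles_def)
qed

section \<open>The factorization polynomial\<close>

text \<open>The sum runs over the factorizations \<open>s \<circ> t = z\<close> with
  \<open>s = z \<circ> inv t\<close>. For \<open>t\<close> in \<open>sym_group k\<close> the sign is
  -1 to the power \<open>k\<close> plus the number of cycles of \<open>t\<close>, so this is
  Stanley's formula for rectangles with the powers of \<open>- q\<close> written as a sign times
  powers of \<open>q\<close>.\<close>

definition factorization_sum :: "nat \<Rightarrow> (nat \<Rightarrow> nat) \<Rightarrow> complex \<Rightarrow> complex \<Rightarrow> complex" where
  "factorization_sum k z p q = (\<Sum>t\<in>sym_group k.
     of_int (sign t) * p ^ num_cycles {..<k} (z \<circ> inv t) * q ^ num_cycles {..<k} t)"

lemma num_cycles_sym_group_conj: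
  assumes "t \<in> sym_group k" "h \<in> sym_group k"
  shows "num_cycles {..<k} (h \<circ> t \<circ> inv h) = num_cycles {..<k} t"
  using assms by (simp add: in_sym_group num_cycles_conj)

lemma sign_sym_group_conj:
  assumes "t \<in> sym_group k" "h \<in> sym_group k"
  shows "sign (h \<circ> t \<circ> inv h) = sign t"
  using assms by (simp add: sym_group_sign[of _ k] mult.assoc)

lemma factorization_sum_conj:
  assumes "z \<in> sym_group k" "h \<in> sym_group k"
  shows "factorization_sum k (h \<circ> z \<circ> inv h) p q = factorization_sum k z p q"
proof -
  have "factorization_sum k (h \<circ> z \<circ> inv h) p q = (\<Sum>t\<in>sym_group k. of_int (sign (h \<circ> t \<circ> inv h))
      * p ^ num_cycles {..<k} (h \<circ> z \<circ> inv h \<circ> inv (h \<circ> t \<circ> inv h))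
      * q ^ num_cycles {..<k} (h \<circ> t \<circ> inv h))"
    unfolding factorization_sum_def
    by (rule sum.reindex_bij_betw[OF bij_betw_sym_group(3)[OF assms(2)], symmetric])
  also have "\<dots> = factorization_sum k z p q"
    unfolding factorization_sum_def
  proof (rule sum.cong[OF refl])
    fix t assume t: "t \<in> sym_group k"
    have "h \<circ> z \<circ> inv h \<circ> inv (h \<circ> t \<circ> inv h) = h \<circ> (z \<circ> inv t) \<circ> inv h"
      using assms t by (simp add: sym_group_inv_comp[of _ k] sym_group_inverse_simps[OF assms(2)] comp_assoc)
    then show "of_int (sign (h \<circ> t \<circ> inv h)) * p ^ num_cycles {..<k} (h \<circ> z \<circ> inv h \<circ> inv (h \<circ> t \<circ> inv h))
        * q ^ num_cycles {..<k} (h \<circ> t \<circ> inv h)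
      = of_int (sign t) * p ^ num_cycles {..<k} (z \<circ> inv t) * q ^ num_cycles {..<k} t"
      using assms t by (simp add: num_cycles_sym_group_conj sign_sym_group_conj)
  qed
  finally show ?thesis .
qed

text \<open>The factorization \<open>z = s t\<close> is sent to \<open>z = (s t s\<^sup>-\<^sup>1) s\<close>.\<close>

lemma factorization_sum_swap:
  assumes z: "z \<in> sym_group k"
  shows "factorization_sum k z q p = of_int (sign z) * factorization_sum k z p q"
proof -
  have "bij_betw (\<lambda>t. z \<circ> inv t) (sym_group k) (sym_group k)"
    using bij_betw_trans[OF bij_betw_sym_group(4)[OF z] bij_betw_sym_group(1)[OF z]] by (simp add: comp_def)
  then have "factorization_sum k z q p = (\<Sum>t\<in>sym_group k. of_int (sign (z \<circ> inv t))
      * q ^ num_cycles {..<k} (z \<circ> inv (z \<circ> inv t)) * p ^ num_cycles {..<k} (z \<circ> inv t))"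
    unfolding factorization_sum_def by (rule sum.reindex_bij_betw[symmetric])
  also have "\<dots> = of_int (sign z) * factorization_sum k z p q"
    unfolding factorization_sum_def sum_distrib_left
  proof (rule sum.cong[OF refl])
    fix t assume t: "t \<in> sym_group k"
    have "z \<circ> inv (z \<circ> inv t) = z \<circ> t \<circ> inv z"
      using z t by (simp add: sym_group_inv_comp[of _ k] sym_group_inverse_simps[OF t] comp_assoc)
    then show "of_int (sign (z \<circ> inv t)) * q ^ num_cycles {..<k} (z \<circ> inv (z \<circ> inv t)) * p ^ num_cycles {..<k} (z \<circ> inv t)
      = of_int (sign z) * (of_int (sign t) * p ^ num_cycles {..<k} (z \<circ> inv t) * q ^ num_cycles {..<k} t)"
      using z t by (simp add: num_cycles_sym_group_conj sym_group_sign[of _ k])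
  qed
  finally show ?thesis .
qed

lemma sym_group_sign_num_cycles:
  "t \<in> sym_group k \<Longrightarrow> sign t = (-1) ^ (k + num_cycles {..<k} t)"
  using sign_num_cycles[of "{..<k}" t] by (simp add: in_sym_group)

lemma sign_odd_cycle:
  assumes "z \<in> sym_group k" "cyclic_on z {..<k}" "odd k"
  shows "sign z = 1"
  using assms by (simp add: sym_group_sign_num_cycles num_cycles_cyclic)

text \<open>A cycle of odd length is even, so the two factors have equal signs; their cycle numbers
  then have an even sum and the minus signs cancel.\<close>

lemma factorization_sum_uminus:
  assumes z: "z \<in> sym_group k" "cyclic_on z {..<k}" "odd k"
  shows "factorization_sum k z (- p) (- q) = factorization_sum k z p q"
  unfolding factorization_sum_def
proof (rule sum.cong[OF refl])
  fix t assume t: "t \<in> sym_group k"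
  define a b where "a = num_cycles {..<k} (z \<circ> inv t)" and "b = num_cycles {..<k} t"
  have "sign (z \<circ> inv t) * sign t = 1"
    using z t sign_odd_cycle[OF z] by (simp add: sym_group_sign[of _ k])
  then have "(-1 :: int) ^ (k + a) * (-1) ^ (k + b) = 1"
    using sym_group_sign_num_cycles[of "z \<circ> inv t" k] sym_group_sign_num_cycles[of t k] z t
    by (simp add: a_def b_def)
  then have "even (a + b)"
    by (simp add: minus_one_power_iff split: if_splits)
  moreover have "(- p) ^ a * (- q) ^ b = (-1) ^ (a + b) * (p ^ a * q ^ b)"
    using power_minus[of p a] power_minus[of q b] by (simp add: power_add)
  ultimately have "(- p) ^ a * (- q) ^ b = p ^ a * q ^ b" by simp
  then show "of_int (sign t) * (- p) ^ a * (- q) ^ b = of_int (sign t) * p ^ a * q ^ b"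
    by (simp only: mult.assoc)
qed

lemma factorization_sum_0:
  assumes "k > 0"
  shows "factorization_sum k z 0 q = 0"
proof -
  have *: "0 ^ num_cycles {..<k} s = (0 :: complex)" for s
    using assms by (intro zero_power num_cycles_pos) (auto simp: lessThan_empty_iff)
  show ?thesis unfolding factorization_sum_def * by simp
qed

section \<open>Cancellation in signed sums over colourings\<close>

lemma num_cycles_power_eq_sum:
  assumes "s \<in> sym_group k"
  shows "of_nat m ^ num_cycles {..<k} s
    = (\<Sum>y\<in>{..<k} \<rightarrow>\<^sub>E {..<m}. if \<forall>x<k. y (s x) = y x then 1 else 0 :: complex)"
proof -
  have "(\<Sum>y\<in>{..<k} \<rightarrow>\<^sub>E {..<m}. if \<forall>x<k. y (s x) = y x then 1 else 0 :: complex)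
      = of_nat (card (fixed_colourings {..<k} {..<m} s))"
    unfolding fixed_colourings_def Ball_def lessThan_iff
    by (subst sum.If_cases) (auto simp: finite_PiE Int_def)
  then show ?thesis
    using assms card_fixed_colourings[of "{..<k}" s "{..<m}"] by (simp add: in_sym_group)
qed

text \<open>With fewer colours than points of \<open>S\<close>, every colouring repeats a colour at
  some \<open>a\<close> and \<open>b\<close> in \<open>S\<close>, and \<open>\<beta> a b\<close>
  then matches terms of opposite sign. The map \<beta> is left abstract to cover multiplication by a
  transposition from either side.\<close>

lemma antisymmetric_sum_zero_aux:
  fixes F :: "(nat \<Rightarrow> nat) \<Rightarrow> complex"
  assumes S: "S \<subseteq> {..<k}" "m < card S"
    and \<beta>: "\<And>a b. a \<in> S \<Longrightarrow> b \<in> S \<Longrightarrow> a \<noteq> b \<Longrightarrow> bij_betw (\<beta> a b) (sym_group k) (sym_group k)"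
    and F: "\<And>a b s. a \<in> S \<Longrightarrow> b \<in> S \<Longrightarrow> a \<noteq> b \<Longrightarrow> s \<in> sym_group k \<Longrightarrow> F (\<beta> a b s) = - F s"
    and fixed: "\<And>a b s (y :: nat \<Rightarrow> nat). a \<in> S \<Longrightarrow> b \<in> S \<Longrightarrow> s \<in> sym_group k \<Longrightarrow> y a = y b \<Longrightarrow>
      (\<forall>x<k. y (\<beta> a b s x) = y x) \<longleftrightarrow> (\<forall>x<k. y (s x) = y x)"
  shows "(\<Sum>s\<in>sym_group k. F s * of_nat m ^ num_cycles {..<k} s) = 0"
proof -
  define G where "G y s = (if \<forall>x<k. y (s x) = y x then F s else 0)" for y :: "nat \<Rightarrow> nat" and s
  have "(\<Sum>s\<in>sym_group k. F s * of_nat m ^ num_cycles {..<k} s)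
      = (\<Sum>s\<in>sym_group k. \<Sum>y\<in>{..<k} \<rightarrow>\<^sub>E {..<m}. G y s)"
    by (intro sum.cong refl)
      (simp add: num_cycles_power_eq_sum sum_distrib_left G_def if_distrib[of "\<lambda>c. _ * c"] cong: if_cong)
  also have "\<dots> = (\<Sum>y\<in>{..<k} \<rightarrow>\<^sub>E {..<m}. \<Sum>s\<in>sym_group k. G y s)"
    by (rule sum.swap)
  also have "\<dots> = 0"
  proof (rule sum.neutral, rule ballI)
    fix y assume y: "y \<in> {..<k} \<rightarrow>\<^sub>E {..<m}"
    have "y ` S \<subseteq> {..<m}" using y S by auto
    then have "card (y ` S) < card S"
      using card_mono[of "{..<m}" "y ` S"] S by simp
    then obtain a b where ab: "a \<in> S" "b \<in> S" "a \<noteq> b" "y a = y b"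
      using pigeonhole[of y S] by (auto simp: inj_on_def)
    have "(\<Sum>s\<in>sym_group k. G y s) = (\<Sum>s\<in>sym_group k. G y (\<beta> a b s))"
      by (rule sum.reindex_bij_betw[symmetric, OF \<beta>[OF ab(1-3)]])
    also have "\<dots> = (\<Sum>s\<in>sym_group k. - G y s)"
      by (intro sum.cong refl) (auto simp: G_def F[OF ab(1-3)] fixed[OF ab(1,2) _ ab(4)])
    finally show "(\<Sum>s\<in>sym_group k. G y s) = 0" by (simp add: sum_negf)
  qed
  finally show ?thesis .
qed

lemma transpose_in_sym_group: "a < k \<Longrightarrow> b < k \<Longrightarrow> transpose a b \<in> sym_group k"
  by (simp add: in_sym_group permutes_swap_id)

lemma comp_transpose_eq: "y a = y b \<Longrightarrow> y (transpose a b x) = y x"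
  by (auto simp: transpose_def)

lemma fixed_comp_transpose:
  assumes y: "y a = y b" and ab: "a < k" "b < k"
  shows "(\<forall>x<k. y (s (transpose a b x)) = y x) \<longleftrightarrow> (\<forall>x<k. y (s x) = y x)"
proof -
  have lt: "transpose a b x < k" if "x < k" for x
    using that ab by (auto simp: transpose_def)
  have *: "y (transpose a b x) = y x" for x
    using y by (rule comp_transpose_eq)
  show ?thesis
  proof (intro iffI allI impI)
    fix x assume "\<forall>x<k. y (s (transpose a b x)) = y x" "x < k"
    from this(1)[rule_format, OF lt[OF this(2)]] show "y (s x) = y x" by (simp add: *)
  next
    fix x assume "\<forall>x<k. y (s x) = y x" "x < k"
    from this(1)[rule_format, OF lt[OF this(2)]] show "y (s (transpose a b x)) = y x" by (simp add: *)
  qed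
qed

lemma antisymmetric_left_sum_zero:
  fixes F :: "(nat \<Rightarrow> nat) \<Rightarrow> complex"
  assumes S: "S \<subseteq> {..<k}" "m < card S"
    and F: "\<And>a b s. a \<in> S \<Longrightarrow> b \<in> S \<Longrightarrow> a \<noteq> b \<Longrightarrow> s \<in> sym_group k \<Longrightarrow> F (transpose a b \<circ> s) = - F s"
  shows "(\<Sum>s\<in>sym_group k. F s * of_nat m ^ num_cycles {..<k} s) = 0"
proof (rule antisymmetric_sum_zero_aux[OF S, where \<beta> = "\<lambda>a b s. transpose a b \<circ> s"])
  show "bij_betw (\<lambda>s. transpose a b \<circ> s) (sym_group k) (sym_group k)" if "a \<in> S" "b \<in> S" for a b
    using that S by (intro bij_betw_sym_group transpose_in_sym_group) auto
  show "(\<forall>x<k. y ((transpose a b \<circ> s) x) = y x) \<longleftrightarrow> (\<forall>x<k. y (s x) = y x)"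
    if "y a = y b" for a b s and y :: "nat \<Rightarrow> nat"
    by (simp add: comp_transpose_eq[of y, OF that])
qed (simp add: F)

lemma antisymmetric_right_sum_zero:
  fixes F :: "(nat \<Rightarrow> nat) \<Rightarrow> complex"
  assumes S: "S \<subseteq> {..<k}" "m < card S"
    and F: "\<And>a b s. a \<in> S \<Longrightarrow> b \<in> S \<Longrightarrow> a \<noteq> b \<Longrightarrow> s \<in> sym_group k \<Longrightarrow> F (s \<circ> transpose a b) = - F s"
  shows "(\<Sum>s\<in>sym_group k. F s * of_nat m ^ num_cycles {..<k} s) = 0"
proof (rule antisymmetric_sum_zero_aux[OF S, where \<beta> = "\<lambda>a b s. s \<circ> transpose a b"])
  show "bij_betw (\<lambda>s. s \<circ> transpose a b) (sym_group k) (sym_group k)" if "a \<in> S" "b \<in> S" for a b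
    using that S by (intro bij_betw_sym_group transpose_in_sym_group) auto
  show "(\<forall>x<k. y ((s \<circ> transpose a b) x) = y x) \<longleftrightarrow> (\<forall>x<k. y (s x) = y x)"
    if "a \<in> S" "b \<in> S" "y a = y b" for a b s and y :: "nat \<Rightarrow> nat"
    using fixed_comp_transpose[of y a b k s] that S(1) by (simp add: subset_iff)
qed (simp add: F)

text \<open>After exchanging the sums, a colouring with a repeated colour contributes nothing, by
  multiplying with the transposition of the two points, and an injective one is fixed by the
  identity only. The total is the number of injective colourings.\<close>

lemma signed_cycle_polynomial_nat:
  "(\<Sum>t\<in>sym_group k. of_int (sign t) * of_nat m ^ num_cycles {..<k} t) = falling (of_nat m :: complex) k"
proof -
  define G :: "(nat \<Rightarrow> nat) \<Rightarrow> (nat \<Rightarrow> nat) \<Rightarrow> complex"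
    where "G y t = (if \<forall>x<k. y (t x) = y x then of_int (sign t) else 0)" for y t
  let ?I = "{y \<in> {..<k} \<rightarrow>\<^sub>E {..<m}. inj_on y {..<k}}"
  have "(\<Sum>t\<in>sym_group k. of_int (sign t) * of_nat m ^ num_cycles {..<k} t)
      = (\<Sum>t\<in>sym_group k. \<Sum>y\<in>{..<k} \<rightarrow>\<^sub>E {..<m}. G y t)"
    by (intro sum.cong refl)
      (simp add: num_cycles_power_eq_sum sum_distrib_left G_def if_distrib[of "\<lambda>c. _ * c"] cong: if_cong)
  also have "\<dots> = (\<Sum>y\<in>{..<k} \<rightarrow>\<^sub>E {..<m}. \<Sum>t\<in>sym_group k. G y t)"
    by (rule sum.swap)
  also have "\<dots> = (\<Sum>y\<in>{..<k} \<rightarrow>\<^sub>E {..<m}. if inj_on y {..<k} then 1 else 0)"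
  proof (rule sum.cong[OF refl])
    fix y
    show "(\<Sum>t\<in>sym_group k. G y t) = (if inj_on y {..<k} then 1 else 0)"
    proof (cases "inj_on y {..<k}")
      case True
      have "G y t = (if t = id then 1 else 0)" if t: "t \<in> sym_group k" for t
      proof -
        have "t = id" if "\<forall>x<k. y (t x) = y x"
        proof
          fix x show "t x = id x"
          proof (cases "x < k")
            case x: True
            then have "t x < k" using t sym_group_less by blast
            then show ?thesis using x that inj_onD[OF True, of "t x" x] by simp
          qed (use sym_group_ge[OF t] in auto)
        qed
        then show ?thesis by (auto simp: G_def)
      qed
      then show ?thesis using True by simp
    next
      case False
      then obtain a b where ab: "a < k" "b < k" "a \<noteq> b" "y a = y b"
        by (auto simp: inj_on_def)
      have \<tau>: "transpose a b \<in> sym_group k" using ab transpose_in_sym_group by blast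
      have "(\<Sum>t\<in>sym_group k. G y t) = (\<Sum>t\<in>sym_group k. G y (transpose a b \<circ> t))"
        by (rule sum.reindex_bij_betw[symmetric, OF bij_betw_sym_group(1)[OF \<tau>]])
      also have "\<dots> = (\<Sum>t\<in>sym_group k. - G y t)"
        by (intro sum.cong refl)
          (simp add: G_def comp_transpose_eq[of y, OF ab(4)] sym_group_sign[OF \<tau>] sign_swap_id ab(3))
      finally show ?thesis using False by (simp add: sum_negf)
    qed
  qed
  also have "\<dots> = of_nat (card ?I)"
    by (subst sum.If_cases) (auto simp: finite_PiE Int_def)
  also have "card ?I = (\<Prod>r\<in>{0..<k}. m - r)"
    by (simp add: card_inj_on_subset_funcset)
  \<comment> \<open>Truncated subtraction agrees with the complex difference when
    \<open>k \<le> m\<close>; otherwise the factor at \<open>r = m\<close> makes both products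
    vanish.\<close>
  also have "of_nat (\<Prod>r\<in>{0..<k}. m - r) = falling (of_nat m :: complex) k"
  proof (cases "k \<le> m")
    case True
    then show ?thesis
      by (auto simp: falling_def of_nat_prod of_nat_diff lessThan_atLeast0 intro!: prod.cong)
  next
    case False
    then have "(\<Prod>r\<in>{0..<k}. m - r) = 0"
      by (intro prod_zero bexI[of _ m]) auto
    moreover have "falling (of_nat m :: complex) k = 0"
      unfolding falling_def using False by (intro prod_zero bexI[of _ m]) auto
    ultimately show ?thesis by simp
  qed
  finally show ?thesis .
qed

section \<open>Conjugacy of cycles of equal length\<close>

lemma cyclic_on_enumeration:
  assumes "cyclic_on w K"
  obtains \<phi> where "bij_betw \<phi> {..<card K} K" "\<And>i. i < card K \<Longrightarrow> w (\<phi> i) = \<phi> (Suc i mod card K)"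
proof -
  obtain x where x: "x \<in> K" "K = orbit w x" using assms by (auto simp: cyclic_on_def)
  then have self: "x \<in> orbit w x" by simp
  \<comment> \<open>The least positive return time of \<open>x\<close>, which is the length of the
    cycle.\<close>
  define m where "m = funpow_dist1 w x x"
  define \<phi> where "\<phi> i = (w ^^ i) x" for i
  have inj: "inj_on \<phi> {..<m}"
    using inj_on_funpow_dist1[OF self] unfolding \<phi>_def m_def lessThan_atLeast0 .
  have im: "\<phi> ` {..<m} = K"
    using orbit_conv_funpow_dist1[OF self] x(2) unfolding \<phi>_def m_def lessThan_atLeast0 by simp
  have m: "card K = m" using card_image[OF inj] im by simp
  have per: "\<phi> m = x" using funpow_dist1_prop[OF self] by (simp add: \<phi>_def m_def)
  show ?thesis
  proof
    show "bij_betw \<phi> {..<card K} K" using inj im m by (simp add: bij_betw_def)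
    show "w (\<phi> i) = \<phi> (Suc i mod card K)" if "i < card K" for i
    proof (cases "Suc i = m")
      case True
      then have "w (\<phi> i) = \<phi> m" by (auto simp: \<phi>_def)
      then show ?thesis using per True m by (simp add: \<phi>_def)
    next
      case False
      then show ?thesis using that m by (simp add: \<phi>_def)
    qed
  qed
qed

lemma cycles_conjugate:
  assumes w: "w \<in> sym_group n" "cyclic_on w K" "K \<subseteq> {..<n}" "\<And>x. x \<notin> K \<Longrightarrow> w x = x"
    and z: "cyclic_on z L" "L \<subseteq> {..<n}" "\<And>x. x \<notin> L \<Longrightarrow> z x = x"
    and card: "card K = card L"
  obtains h where "h \<in> sym_group n" "z = h \<circ> w \<circ> inv h"
proof -
  obtain \<phi> where \<phi>: "bij_betw \<phi> {..<card K} K" "\<And>i. i < card K \<Longrightarrow> w (\<phi> i) = \<phi> (Suc i mod card K)"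
    using cyclic_on_enumeration[OF w(2)] by metis
  obtain \<psi> where \<psi>: "bij_betw \<psi> {..<card K} L" "\<And>i. i < card K \<Longrightarrow> z (\<psi> i) = \<psi> (Suc i mod card K)"
    using cyclic_on_enumeration[OF z(1)] card by metis
  have fin: "finite K" "finite L" using w(3) z(2) finite_subset by blast+
  have "card ({..<n} - K) = card ({..<n} - L)"
    using w(3) z(2) card fin by (simp add: card_Diff_subset)
  then obtain \<beta> where \<beta>: "bij_betw \<beta> ({..<n} - K) ({..<n} - L)"
    using finite_same_card_bij[of "{..<n} - K" "{..<n} - L"] by blast
  define \<gamma> where "\<gamma> = inv_into {..<card K} \<phi>"
  have \<gamma>: "bij_betw \<gamma> K {..<card K}"
    unfolding \<gamma>_def using \<phi>(1) by (rule bij_betw_inv_into)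
  have \<gamma>\<phi>: "\<gamma> (\<phi> i) = i" if "i < card K" for i
    unfolding \<gamma>_def using \<phi>(1) that by (intro bij_betw_inv_into_left) auto
  have \<phi>\<gamma>: "\<phi> (\<gamma> u) = u" "\<gamma> u < card K" if "u \<in> K" for u
    using \<phi>(1) \<gamma> that bij_betw_apply[OF \<gamma> that] unfolding \<gamma>_def by (auto intro!: bij_betw_inv_into_right)
  \<comment> \<open>The two cycles are matched position by position along their enumerations, and
    their complements by any bijection.\<close>
  define h where "h u = (if u \<in> K then \<psi> (\<gamma> u) else if u < n then \<beta> u else u)" for u
  have 1: "bij_betw h K L"
    using bij_betw_trans[OF \<gamma> \<psi>(1)] by (rule iffD1[OF bij_betw_cong, rotated]) (simp add: h_def)
  have 2: "bij_betw h ({..<n} - K) ({..<n} - L)"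
    using \<beta> by (rule iffD1[OF bij_betw_cong, rotated]) (simp add: h_def)
  have "bij_betw h (K \<union> ({..<n} - K)) (L \<union> ({..<n} - L))"
    using 1 2 by (rule bij_betw_combine) auto
  moreover have "K \<union> ({..<n} - K) = {..<n}" "L \<union> ({..<n} - L) = {..<n}" using w(3) z(2) by auto
  ultimately have "h permutes {..<n}"
    using w(3) by (intro bij_imp_permutes) (auto simp: h_def)
  then have h: "h \<in> sym_group n" by (simp add: in_sym_group)
  have "h (w u) = z (h u)" for u
  proof (cases "u \<in> K")
    case True
    define i where "i = \<gamma> u"
    have i: "i < card K" "u = \<phi> i" using \<phi>\<gamma>[OF True] by (auto simp: i_def)
    have i': "Suc i mod card K < card K" using i(1) by (intro mod_less_divisor) auto
    have "w u \<in> K" "\<gamma> (w u) = Suc i mod card K"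
      using \<phi>(2)[OF i(1)] i' bij_betw_apply[OF \<phi>(1)] by (auto simp: i(2) \<gamma>\<phi>)
    then show ?thesis using True \<psi>(2)[OF i(1)] by (simp add: h_def i_def)
  next
    case False
    have "h u \<notin> L"
    proof (cases "u < n")
      case True
      then show ?thesis using False bij_betw_apply[OF 2, of u] by auto
    next
      case u: False
      then show ?thesis using False z(2) by (auto simp: h_def)
    qed
    then show ?thesis using w(4)[OF False] z(3) by simp
  qed
  then have "z = h \<circ> w \<circ> inv h"
    using sym_group_inverse_simps(6)[OF h] by (auto simp: fun_eq_iff)
  then show ?thesis using that h by blast
qed

section \<open>Invariant subsets and exterior power characters\<close>

definition invariant_subsets :: "('a \<Rightarrow> 'a) \<Rightarrow> 'a set \<Rightarrow> 'a set set" where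
  "invariant_subsets g K = {S. S \<subseteq> K \<and> g ` S = S}"

lemma finite_invariant_subsets: "finite K \<Longrightarrow> finite (invariant_subsets g K)"
  by (rule finite_subset[of _ "Pow K"]) (auto simp: invariant_subsets_def)

lemma orbit_in_invariant:
  assumes "g ` S \<subseteq> S" "x \<in> S" "y \<in> orbit g x"
  shows "y \<in> S"
  using assms(3) by induction (use assms in auto)

text \<open>An invariant set contains the orbit \<open>A\<close> or is disjoint from it, so the
  invariant sets come in pairs \<open>S\<close> and \<open>S \<union> A\<close>. The invariant part
  \<open>K\<close> of the permuted set \<open>K0\<close> is kept general so that the splitting
  applies again to \<open>K - A\<close>.\<close>

lemma sum_invariant_subsets_split:
  assumes K0: "finite K0" "g permutes K0" and K: "K \<subseteq> K0" "g ` K = K" "x \<in> K"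
  defines "A \<equiv> orbit g x"
  shows "(\<Sum>S\<in>invariant_subsets g K. \<phi> S) = (\<Sum>S\<in>invariant_subsets g (K - A). \<phi> S + \<phi> (S \<union> A))"
    and "g ` (K - A) = K - A"
proof -
  have inj: "inj g" using K0 permutes_inj by blast
  have fin: "finite K" using K K0 finite_subset by blast
  have A: "A \<subseteq> K" using orbit_in_invariant[of g K x] K by (auto simp: A_def)
  have gA: "g ` A = A"
  proof (rule card_subset_eq)
    show "finite A" using A fin finite_subset by blast
    show "g ` A \<subseteq> A" by (auto simp: A_def intro: orbit.step)
    show "card (g ` A) = card A" by (rule card_image) (rule inj_on_subset[OF inj subset_UNIV])
  qed
  have diff: "g ` (S - A) = S - A" if "g ` S = S" for S
    using image_set_diff[OF inj, of S A] that gA by simp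
  show "g ` (K - A) = K - A" using diff K by blast
  let ?I = "invariant_subsets g (K - A)"
  have dich: "S \<inter> A = {} \<or> A \<subseteq> S" if S: "g ` S = S" for S
  proof (rule ccontr)
    assume "\<not> (S \<inter> A = {} \<or> A \<subseteq> S)"
    then obtain y a where y: "y \<in> S" "y \<in> A" and a: "a \<in> A" "a \<notin> S" by blast
    have "x \<in> orbit g y"
      using y(2) orbit_swap[OF permutes_self_in_orbit[OF K0]] by (auto simp: A_def)
    then have "a \<in> orbit g y"
      using a(1) orbit_trans by (fastforce simp: A_def)
    then show False using orbit_in_invariant[of g S y a] S y a by auto
  qed
  have eq: "invariant_subsets g K = ?I \<union> (\<lambda>S. S \<union> A) ` ?I"
  proof
    show "invariant_subsets g K \<subseteq> ?I \<union> (\<lambda>S. S \<union> A) ` ?I"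
    proof
      fix S assume "S \<in> invariant_subsets g K"
      then have S: "S \<subseteq> K" "g ` S = S" by (auto simp: invariant_subsets_def)
      from dich[OF S(2)] show "S \<in> ?I \<union> (\<lambda>S. S \<union> A) ` ?I"
      proof
        assume "S \<inter> A = {}"
        then show ?thesis using S by (auto simp: invariant_subsets_def)
      next
        assume "A \<subseteq> S"
        then have "S = (S - A) \<union> A" by blast
        moreover have "S - A \<in> ?I" using diff[OF S(2)] S(1) by (auto simp: invariant_subsets_def)
        ultimately show ?thesis by blast
      qed
    qed
    show "?I \<union> (\<lambda>S. S \<union> A) ` ?I \<subseteq> invariant_subsets g K"
      using A gA by (auto simp: invariant_subsets_def image_Un)
  qed
  have "x \<in> A" unfolding A_def by (rule permutes_self_in_orbit[OF K0])
  then have disj: "?I \<inter> (\<lambda>S. S \<union> A) ` ?I = {}"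
    by (auto simp: invariant_subsets_def)
  have inj': "inj_on (\<lambda>S. S \<union> A) ?I"
    by (auto simp: invariant_subsets_def inj_on_def)
  have "finite ?I" using fin by (intro finite_invariant_subsets) auto
  then show "(\<Sum>S\<in>invariant_subsets g K. \<phi> S) = (\<Sum>S\<in>?I. \<phi> S + \<phi> (S \<union> A))"
    unfolding eq by (subst sum.union_disjoint) (simp_all add: disj sum.reindex[OF inj'] sum.distrib)
qed

lemma num_cycles_union_orbit:
  assumes K0: "finite K0" "g permutes K0" and S: "S \<in> invariant_subsets g (K - orbit g x)" "finite S"
  shows "num_cycles (S \<union> orbit g x) g = Suc (num_cycles S g)"
proof -
  have "orbit g y = orbit g x" if "y \<in> orbit g x" for y
    by (rule orbit_cyclic_eq3[OF cyclic_on_orbit[OF K0(2,1)] that])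
  then have "orbit g ` (S \<union> orbit g x) = insert (orbit g x) (orbit g ` S)"
    using permutes_self_in_orbit[OF K0, of x] by blast
  moreover have "orbit g x \<notin> orbit g ` S"
    using S permutes_self_in_orbit[OF K0] by (auto simp: invariant_subsets_def)
  ultimately show ?thesis using S(2) by (simp add: num_cycles_def)
qed

text \<open>Adding one orbit reverses the sign, so the pairs cancel as soon as there is an
  orbit.\<close>

lemma sum_invariant_subsets:
  assumes K0: "finite K0" "g permutes K0" and K: "K \<subseteq> K0" "g ` K = K"
  shows "(\<Sum>S\<in>invariant_subsets g K. (-1) ^ num_cycles S g) = (if K = {} then 1 else 0 :: complex)"
proof (cases "K = {}")
  case True
  then have "invariant_subsets g K = {{}}" by (auto simp: invariant_subsets_def)
  then show ?thesis using True by (simp add: num_cycles_def)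
next
  case False
  then obtain x where x: "x \<in> K" by blast
  have fin: "finite K" using K K0 finite_subset by blast
  have "(\<Sum>S\<in>invariant_subsets g K. (-1) ^ num_cycles S g)
      = (\<Sum>S\<in>invariant_subsets g (K - orbit g x). (-1) ^ num_cycles S g + (-1) ^ num_cycles (S \<union> orbit g x) g :: complex)"
    by (rule sum_invariant_subsets_split[OF K0 K x])
  also have "\<dots> = 0"
  proof (rule sum.neutral, rule ballI)
    fix S assume S: "S \<in> invariant_subsets g (K - orbit g x)"
    then have "finite S" using fin finite_subset by (auto simp: invariant_subsets_def)
    then show "(-1) ^ num_cycles S g + (-1) ^ num_cycles (S \<union> orbit g x) g = (0::complex)"
      by (simp add: num_cycles_union_orbit[OF K0 S])
  qed
  finally show ?thesis using False by simp
qed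

text \<open>In each pair \<open>S\<close>, \<open>S \<union> A\<close> the weights differ by
  \<open>card A\<close>, whatever \<open>c\<close> is. What is left is an alternating sum over the
  invariant subsets of \<open>K - A\<close>, which vanishes unless the orbit \<open>A\<close> is all
  of \<open>K\<close>. This isolates the full cycles.\<close>

lemma weighted_sum_invariant_subsets:
  fixes c :: complex
  assumes K: "finite K" "g permutes K" "K \<noteq> {}"
  shows "(\<Sum>S\<in>invariant_subsets g K. (of_nat (card S) - c) * (-1) ^ num_cycles S g)
    = (if cyclic_on g K then - of_nat (card K) else 0)"
proof -
  obtain x where x: "x \<in> K" using K by blast
  define A where "A = orbit g x"
  have gK: "g ` K = K" using K permutes_image by blast
  have A: "A \<subseteq> K" using permutes_orbit_subset[OF K(2) x] by (simp add: A_def)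
  have finA: "finite A" using A K finite_subset by blast
  have "(\<Sum>S\<in>invariant_subsets g K. (of_nat (card S) - c) * (-1) ^ num_cycles S g)
      = (\<Sum>S\<in>invariant_subsets g (K - A). (of_nat (card S) - c) * (-1) ^ num_cycles S g
          + (of_nat (card (S \<union> A)) - c) * (-1) ^ num_cycles (S \<union> A) g)"
    unfolding A_def by (rule sum_invariant_subsets_split[OF K(1,2) subset_refl gK x])
  also have "\<dots> = (\<Sum>S\<in>invariant_subsets g (K - A). - of_nat (card A) * (-1) ^ num_cycles S g)"
  proof (rule sum.cong[OF refl])
    fix S assume S: "S \<in> invariant_subsets g (K - A)"
    then have fin: "finite S" using K finite_subset by (auto simp: invariant_subsets_def)
    have "card (S \<union> A) = card S + card A"
      using S fin finA by (intro card_Un_disjoint) (auto simp: invariant_subsets_def)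
    moreover have "num_cycles (S \<union> A) g = Suc (num_cycles S g)"
      using num_cycles_union_orbit[OF K(1,2)] S fin by (simp add: A_def)
    ultimately show "(of_nat (card S) - c) * (-1) ^ num_cycles S g
          + (of_nat (card (S \<union> A)) - c) * (-1) ^ num_cycles (S \<union> A) g
        = - of_nat (card A) * (-1) ^ num_cycles S g"
      by (simp add: algebra_simps)
  qed
  also have "\<dots> = - of_nat (card A) * (\<Sum>S\<in>invariant_subsets g (K - A). (-1) ^ num_cycles S g)"
    by (rule sum_distrib_left[symmetric])
  also have "\<dots> = - of_nat (card A) * (if K - A = {} then 1 else 0)"
    using sum_invariant_subsets_split(2)[OF K(1,2) subset_refl gK x]
    by (subst sum_invariant_subsets[OF K(1,2)]) (auto simp: A_def)
  also have "\<dots> = (if cyclic_on g K then - of_nat (card K) else 0)"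
  proof (cases "A = K")
    case True
    then have "cyclic_on g K" using x by (auto simp: cyclic_on_def A_def)
    then show ?thesis using True by simp
  next
    case False
    then have "\<not> cyclic_on g K" using x orbit_cyclic_eq3 by (metis A_def)
    then show ?thesis using False A by auto
  qed
  finally show ?thesis .
qed

text \<open>On \<open>S\<close> the restriction of \<open>g\<close> has the same orbits as
  \<open>g\<close>. The identity translates the signs of the preceding sums into the terms of
  exterior power characters.\<close>

lemma sign_on_invariant:
  assumes "finite S" "g permutes K" "g ` S = S"
  shows "(-1) ^ card S * sign_on S g = (-1) ^ num_cycles S g"
proof -
  have "bij_betw g S S"
    using assms permutes_inj[OF assms(2)] by (auto simp: bij_betw_def intro: inj_on_subset)
  then have "restrict_id g S permutes S" by (rule permutes_restrict_id)
  then have "sign_on S g = (-1) ^ (card S + num_cycles S (restrict_id g S))"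
    unfolding sign_on_def by (rule sign_num_cycles[OF assms(1)])
  moreover have "orbit (restrict_id g S) x = orbit g x" if "x \<in> S" for x
    using that assms(3) by (intro orbit_cong0[of x S]) auto
  then have "num_cycles S (restrict_id g S) = num_cycles S g"
    unfolding num_cycles_def by (auto intro!: arg_cong[of _ _ card] image_cong)
  ultimately show ?thesis by (simp add: power_add flip: mult.assoc power_mult_distrib)
qed


text \<open>
  For \<open>g\<close> ranging over the permutations that preserve \<open>S\<close>, \<open>sign_on S g\<close> is antisymmetric under
  transpositions of \<open>S\<close> and invariant under transpositions of the complement; more than \<open>p\<close> points
  of \<open>S\<close>, or more than \<open>q\<close> points outside it, force a repeated colour.
\<close>

lemma sum_sign_on_factorization_sum:
  assumes S: "S \<subseteq> {..<k}" and card: "card S > p \<or> k - card S > q"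
  shows "(\<Sum>g\<in>sym_group k. (if g ` S = S then of_int (sign_on S g) else 0)
      * factorization_sum k g (of_nat p) (of_nat q)) = 0"
proof -
  define H :: "(nat \<Rightarrow> nat) \<Rightarrow> complex" where "H g = (if g ` S = S then of_int (sign_on S g) else 0)" for g
  have fin: "finite S" using S finite_subset by blast
  define E where "E s t = of_int (sign t) * H (s \<circ> t)
      * of_nat p ^ num_cycles {..<k} s * of_nat q ^ num_cycles {..<k} t" for s t
  have "(\<Sum>g\<in>sym_group k. H g * factorization_sum k g (of_nat p) (of_nat q))
      = (\<Sum>t\<in>sym_group k. \<Sum>g\<in>sym_group k. of_int (sign t) * H g
          * of_nat p ^ num_cycles {..<k} (g \<circ> inv t) * of_nat q ^ num_cycles {..<k} t)"
    unfolding factorization_sum_def sum_distrib_left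
    by (subst sum.swap) (simp add: algebra_simps)
  \<comment> \<open>Substituting \<open>g = s \<circ> t\<close> makes the two factors independent
    summation variables, so either one can be held fixed while the other varies.\<close>
  also have "\<dots> = (\<Sum>t\<in>sym_group k. \<Sum>s\<in>sym_group k. E s t)"
  proof (rule sum.cong[OF refl])
    fix t assume t: "t \<in> sym_group k"
    have *: "s \<circ> t \<circ> inv t = s" for s
      using sym_group_inverse_simps(4)[OF t] by (simp add: comp_assoc)
    show "(\<Sum>g\<in>sym_group k. of_int (sign t) * H g
          * of_nat p ^ num_cycles {..<k} (g \<circ> inv t) * of_nat q ^ num_cycles {..<k} t)
        = (\<Sum>s\<in>sym_group k. E s t)"
      by (subst sum.reindex_bij_betw[OF bij_betw_sym_group(2)[OF t], symmetric]) (simp add: * E_def)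
  qed
  also have "\<dots> = 0"
    using card
  proof
    assume p: "card S > p"
    show ?thesis
    proof (rule sum.neutral, rule ballI)
      fix t assume t: "t \<in> sym_group k"
      have "(\<Sum>s\<in>sym_group k. H (s \<circ> t) * of_nat p ^ num_cycles {..<k} s) = 0"
      proof (rule antisymmetric_left_sum_zero[OF S p])
        fix a b s assume ab: "a \<in> S" "b \<in> S" "a \<noteq> b" and s: "s \<in> sym_group k"
        define g where "g = s \<circ> t"
        have inj: "inj g" using sym_group_closed(2)[OF s t] permutes_inj by (auto simp: g_def in_sym_group)
        have \<tau>: "transpose a b ` S = S" using ab by (simp add: transpose_image_eq)
        have iff: "(transpose a b \<circ> g) ` S = S \<longleftrightarrow> g ` S = S"
          using \<tau> by (metis image_comp inj_image_eq_iff inj_transpose)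
        have sgn: "sign_on S (transpose a b \<circ> g) = - sign_on S g" if "g ` S = S"
        proof -
          have "bij_betw g S S" "bij_betw (transpose a b) S S"
            using that inj \<tau> inj_transpose by (auto simp: bij_betw_def intro: inj_on_subset)
          then have "sign_on S (transpose a b \<circ> g) = sign_on S (transpose a b) * sign_on S g"
            using fin by (intro sign_on_compose)
          then show ?thesis unfolding sign_on_transpose[OF ab] by (simp only: mult_minus1)
        qed
        have "H (transpose a b \<circ> g) = - H g"
        proof (cases "g ` S = S")
          case True
          then show ?thesis unfolding H_def iff using sgn[OF True] by (simp only: simp_thms if_True of_int_minus)
        next
          case False
          then show ?thesis unfolding H_def iff by (simp only: if_False minus_zero)
        qed
        then show "H (transpose a b \<circ> s \<circ> t) = - H (s \<circ> t)" by (simp add: g_def comp_assoc)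
      qed
      then have "of_int (sign t) * of_nat q ^ num_cycles {..<k} t
          * (\<Sum>s\<in>sym_group k. H (s \<circ> t) * of_nat p ^ num_cycles {..<k} s) = 0"
        by simp
      then show "(\<Sum>s\<in>sym_group k. E s t) = 0"
        unfolding sum_distrib_left E_def by (simp add: algebra_simps)
    qed
  next
    \<comment> \<open>Now \<open>s\<close> is fixed. A transposition outside \<open>S\<close>
      applied before \<open>t\<close> changes neither the image of \<open>S\<close> nor the sign on
      \<open>S\<close>, but it reverses \<open>sign t\<close>.\<close>
    assume q: "k - card S > q"
    have S': "{..<k} - S \<subseteq> {..<k}" "q < card ({..<k} - S)"
      using q S fin by (auto simp: card_Diff_subset)
    show ?thesis
    proof (subst sum.swap, rule sum.neutral, rule ballI)
      fix s assume s: "s \<in> sym_group k"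
      have "(\<Sum>t\<in>sym_group k. (of_int (sign t) * H (s \<circ> t)) * of_nat q ^ num_cycles {..<k} t) = 0"
      proof (rule antisymmetric_right_sum_zero[OF S'])
        fix a b t assume ab: "a \<in> {..<k} - S" "b \<in> {..<k} - S" "a \<noteq> b" and t: "t \<in> sym_group k"
        have \<tau>: "transpose a b \<in> sym_group k" using ab transpose_in_sym_group by auto
        have fix_S: "transpose a b x = x" if "x \<in> S" for x
          using that ab by (intro transpose_apply_other) auto
        have "(s \<circ> t \<circ> transpose a b) ` S = (s \<circ> t) ` S"
          using fix_S by (intro image_cong) auto
        moreover have "sign_on S (s \<circ> t \<circ> transpose a b) = sign_on S (s \<circ> t)"
          using fix_S by (intro sign_on_cong) auto
        ultimately have "H (s \<circ> (t \<circ> transpose a b)) = H (s \<circ> t)"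
          by (simp add: H_def comp_assoc)
        moreover have "sign (t \<circ> transpose a b) = - sign t"
          using ab(3) by (simp add: sym_group_sign(1)[OF t \<tau>] sign_swap_id)
        ultimately show "of_int (sign (t \<circ> transpose a b)) * H (s \<circ> (t \<circ> transpose a b))
            = - (of_int (sign t) * H (s \<circ> t))" by simp
      qed
      then have "of_nat p ^ num_cycles {..<k} s
          * (\<Sum>t\<in>sym_group k. (of_int (sign t) * H (s \<circ> t)) * of_nat q ^ num_cycles {..<k} t) = 0"
        by simp
      then show "(\<Sum>t\<in>sym_group k. E s t) = 0"
        unfolding sum_distrib_left E_def by (simp add: algebra_simps)
    qed
  qed
  finally show ?thesis by (simp add: H_def)
qed

text \<open>The sum of \<open>?N g\<close> over all \<open>g\<close>, weighted by the indicator of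
  the full cycles, is a nonzero multiple of the value at \<open>z\<close>. Expanding the indicator
  over subsets \<open>S\<close> instead gives zero term by term.\<close>

lemma factorization_sum_vanishes:
  assumes z: "z \<in> sym_group k" "cyclic_on z {..<k}" and pq: "p + q \<le> k"
  shows "factorization_sum k z (of_nat p) (of_nat q) = 0"
proof -
  let ?N = "\<lambda>g. factorization_sum k g (of_nat p) (of_nat q)"
  have k: "{..<k} \<noteq> {}" using z(2) by (auto simp: cyclic_on_def)
  \<comment> \<open>All full cycles are conjugate, so they share one value.\<close>
  have class_fun: "?N g = ?N z" if g: "g \<in> sym_group k" "cyclic_on g {..<k}" for g
  proof -
    have "z x = x" "g x = x" if "x \<notin> {..<k}" for x
      using that z(1) g(1) sym_group_ge by auto
    then obtain h where "h \<in> sym_group k" "g = h \<circ> z \<circ> inv h"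
      using cycles_conjugate[OF z subset_refl _ g(2) subset_refl _ refl] by metis
    then show ?thesis using factorization_sum_conj[OF z(1)] by simp
  qed
  \<comment> \<open>The free constant in the weights is taken to be \<open>p\<close>, which removes
    the sets of size \<open>p\<close>, the one size that the colouring argument does not exclude
    when \<open>p + q = k\<close>.\<close>
  let ?c = "\<lambda>S. (of_nat (card S) - of_nat p) * (-1) ^ card S :: complex"
  let ?H = "\<lambda>S g. if g ` S = S then of_int (sign_on S g) else 0 :: complex"
  have "(\<Sum>S\<in>Pow {..<k}. ?c S * (\<Sum>g\<in>sym_group k. ?H S g * ?N g)) = 0"
  proof (rule sum.neutral, rule ballI)
    fix S assume S: "S \<in> Pow {..<k}"
    \<comment> \<open>Fewer than \<open>p\<close> points in \<open>S\<close> leave more than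
      \<open>k - p\<close>, hence more than \<open>q\<close>, outside.\<close>
    consider "card S = p" | "card S > p" | "k - card S > q" using pq by linarith
    then show "?c S * (\<Sum>g\<in>sym_group k. ?H S g * ?N g) = 0"
      using S sum_sign_on_factorization_sum[of S k p q] by cases auto
  qed
  also have "(\<Sum>S\<in>Pow {..<k}. ?c S * (\<Sum>g\<in>sym_group k. ?H S g * ?N g))
      = (\<Sum>g\<in>sym_group k. (\<Sum>S\<in>Pow {..<k}. ?c S * ?H S g) * ?N g)"
    unfolding sum_distrib_left sum_distrib_right by (subst sum.swap) (simp add: mult.assoc)
  also have "\<dots> = (\<Sum>g\<in>sym_group k. if cyclic_on g {..<k} then - of_nat k * ?N z else 0)"
  proof (rule sum.cong[OF refl])
    fix g assume g: "g \<in> sym_group k"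
    have "(\<Sum>S\<in>Pow {..<k}. ?c S * ?H S g)
        = (\<Sum>S\<in>invariant_subsets g {..<k}. (of_nat (card S) - of_nat p) * (-1) ^ num_cycles S g)"
    proof (rule sum.mono_neutral_cong_right)
      show "?c S * ?H S g = (of_nat (card S) - of_nat p) * (-1) ^ num_cycles S g"
        if "S \<in> invariant_subsets g {..<k}" for S
      proof -
        have S: "finite S" "g ` S = S"
          using that finite_subset by (auto simp: invariant_subsets_def)
        have "of_int ((-1) ^ card S * sign_on S g) = (of_int ((-1) ^ num_cycles S g) :: complex)"
          using sign_on_invariant[OF S(1) _ S(2)] g by (metis in_sym_group)
        then show ?thesis using S(2) by (simp add: mult.assoc)
      qed
    qed (auto simp: invariant_subsets_def)
    also have "\<dots> = (if cyclic_on g {..<k} then - of_nat k else 0)"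
      using weighted_sum_invariant_subsets[of "{..<k}" g] g k by (simp add: in_sym_group)
    finally show "(\<Sum>S\<in>Pow {..<k}. ?c S * ?H S g) * ?N g
        = (if cyclic_on g {..<k} then - of_nat k * ?N z else 0)"
      using class_fun[OF g] by simp
  qed
  also have "\<dots> = - (of_nat (card {g \<in> sym_group k. cyclic_on g {..<k}}) * of_nat k * ?N z)"
    by (subst sum.If_cases) (simp_all add: Int_def)
  finally have "of_nat (card {g \<in> sym_group k. cyclic_on g {..<k}}) * of_nat k * ?N z = 0" by simp
  moreover have "card {g \<in> sym_group k. cyclic_on g {..<k}} \<noteq> 0"
    using z by (auto simp: card_eq_0_iff)
  ultimately show ?thesis using k by (auto simp: lessThan_empty_iff)
qed

section \<open>Normalized characters of rectangles\<close>

definition std_cycle :: "nat \<Rightarrow> nat \<Rightarrow> nat" where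
  "std_cycle k x = (if x < k then Suc x mod k else x)"

lemma std_cycle_sym_group: "std_cycle k \<in> sym_group k"
proof -
  have "std_cycle k permutes {..<k}"
  proof (rule inj_imp_permutes)
    show "inj_on (std_cycle k) {..<k}"
      by (auto simp: inj_on_def std_cycle_def mod_Suc split: if_splits)
  qed (auto simp: std_cycle_def)
  then show ?thesis by (simp add: in_sym_group)
qed

lemma cyclic_on_std_cycle:
  assumes "k > 0"
  shows "cyclic_on (std_cycle k) {..<k}"
proof (rule cyclic_on_singleI[of 0])
  have perm: "std_cycle k permutes {..<k}"
    using std_cycle_sym_group by (simp add: in_sym_group)
  have "i < k \<Longrightarrow> i \<in> orbit (std_cycle k) 0" for i
  proof (induction i)
    case 0
    show ?case by (rule permutes_self_in_orbit[OF _ perm]) simp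
  next
    case (Suc i)
    then have "std_cycle k i \<in> orbit (std_cycle k) 0" by (intro orbit.step) auto
    moreover have "std_cycle k i = Suc i" using Suc.prems by (simp add: std_cycle_def)
    ultimately show ?case by simp
  qed
  then show "{..<k} = orbit (std_cycle k) 0"
    using permutes_orbit_subset[OF perm] assms by auto
qed (use assms in simp)

lemma sym_group_mono: "k \<le> n \<Longrightarrow> sym_group k \<subseteq> sym_group n"
  by (auto simp: in_sym_group intro: permutes_subset)

lemma cyclic_on_inv:
  assumes "z \<in> sym_group k" "cyclic_on z {..<k}"
  shows "cyclic_on (inv z) {..<k}"
proof -
  have "permutation z" using assms(1) permutation_permutes by (auto simp: in_sym_group)
  then show ?thesis using assms(2) by (simp add: cyclic_on_def orbit_inv_eq)
qed

lemma cycle_type_std_cycle: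
  assumes "0 < k" "k \<le> n"
  shows "cycle_type n (std_cycle k) = {#k#} + replicate_mset (n - k) 1"
proof -
  have 1: "orbit (std_cycle k) i = {i}" if "i \<in> {k..<n}" for i
    unfolding orbit_eq_singleton_iff using that by (simp add: std_cycle_def)
  have 2: "orbit (std_cycle k) i = {..<k}" if "i \<in> {..<k}" for i
    using orbit_cyclic_eq3[OF cyclic_on_std_cycle[OF assms(1)] that] .
  have "orbit (std_cycle k) ` {k..<n} = (\<lambda>i. {i}) ` {k..<n}"
    by (intro image_cong refl) (erule 1)
  moreover have "orbit (std_cycle k) ` {..<k} = (\<lambda>i. {..<k}) ` {..<k}"
    by (intro image_cong refl) (erule 2)
  moreover have "(\<lambda>i. {..<k}) ` {..<k} = {{..<k}}"
    by (rule image_constant[of 0]) (simp add: assms(1))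
  moreover have "{..<n} = {..<k} \<union> {k..<n}" using assms by auto
  ultimately have "orbit (std_cycle k) ` {..<n} = insert {..<k} ((\<lambda>i. {i}) ` {k..<n})"
    by (simp only: image_Un Un_insert_left Un_empty_left)
  moreover have "{..<k} \<notin> (\<lambda>i. {i}) ` {k..<n}"
  proof
    assume "{..<k} \<in> (\<lambda>i. {i}) ` {k..<n}"
    then obtain i where i: "i \<in> {k..<n}" and eq: "{..<k} = {i}" by (rule imageE)
    have "i \<in> {..<k}" unfolding eq by simp
    then show False using i by simp
  qed
  moreover have "mset_set ((\<lambda>i. {i}) ` {k..<n}) = image_mset (\<lambda>i. {i}) (mset_set {k..<n})"
    by (rule image_mset_mset_set[symmetric]) simp
  ultimately show ?thesis
    by (simp add: cycle_type_def image_mset.compositionality comp_def image_mset_const_eq)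
qed

text \<open>Removing one orbit of size \<open>k\<close> leaves only orbits of size 1. This is all
  that is known about the representative picked by choice in \<open>character_at\<close>.\<close>

lemma cycle_type_single_cycle:
  assumes w: "w \<in> sym_group n" and type: "cycle_type n w = {#k#} + replicate_mset (n - k) 1"
  obtains K where "cyclic_on w K" "K \<subseteq> {..<n}" "card K = k" "\<And>x. x \<notin> K \<Longrightarrow> w x = x"
proof -
  let ?O = "orbit w ` {..<n}"
  have perm: "w permutes {..<n}" using w by (simp add: in_sym_group)
  have "k \<in># image_mset card (mset_set ?O)" using type by (simp add: cycle_type_def)
  then obtain K where K: "K \<in> ?O" "card K = k" by auto
  have "mset_set ?O = add_mset K (mset_set (?O - {K}))"
    using K(1) by (simp add: mset_set.remove)
  then have rest: "image_mset card (mset_set (?O - {K})) = replicate_mset (n - k) 1"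
    using type K(2) by (simp add: cycle_type_def)
  have one: "card A = 1" if "A \<in> ?O" "A \<noteq> K" for A
  proof -
    have "card A \<in># image_mset card (mset_set (?O - {K}))" using that by simp
    then show ?thesis unfolding rest by (simp split: if_splits)
  qed
  have cyc: "cyclic_on w K" using K(1) cyclic_on_orbit[OF perm] by auto
  show ?thesis
  proof
    show "cyclic_on w K" by (rule cyc)
    show "K \<subseteq> {..<n}" using K(1) permutes_orbit_subset[OF perm] by auto
    show "card K = k" by fact
    show "w x = x" if "x \<notin> K" for x
    proof (cases "x < n")
      case True
      have self: "x \<in> orbit w x" by (rule permutes_self_in_orbit[OF _ perm]) simp
      then have "card (orbit w x) = 1" using True \<open>x \<notin> K\<close> by (intro one) auto
      then have "orbit w x = {x}" using self by (metis card_1_singletonE singletonD)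
      then show ?thesis by (simp add: orbit_eq_singleton_iff)
    qed (use sym_group_ge[OF w] in auto)
  qed
qed

section \<open>Factorizations compatible with a labelling by boxes\<close>

definition compatible :: "nat \<Rightarrow> nat \<Rightarrow> (nat \<Rightarrow> nat) \<Rightarrow> (nat \<Rightarrow> nat) \<Rightarrow> (nat \<Rightarrow> nat) \<Rightarrow> bool" where
  "compatible k q s t y \<longleftrightarrow> (\<forall>x<k. y (s x) div q = y x div q) \<and> (\<forall>x<k. y (t x) mod q = y x mod q)"

text \<open>A box is a number below \<open>p * q\<close>, with its row given by \<open>div q\<close>
  and its column by \<open>mod q\<close>. The signed factorizations of \<open>z\<close> are counted
  here for one labelling \<open>y\<close>: summing over all labellings yields
  \<open>factorization_sum\<close>, summing over the bijective ones yields characters.\<close>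

definition labelling_sum :: "nat \<Rightarrow> nat \<Rightarrow> (nat \<Rightarrow> nat) \<Rightarrow> (nat \<Rightarrow> nat) \<Rightarrow> complex" where
  "labelling_sum k q z y = (\<Sum>t\<in>sym_group k. if compatible k q (z \<circ> inv t) t y then of_int (sign t) else 0)"

text \<open>Two points with the same box can be exchanged between the factors: replacing
  \<open>s\<close>, \<open>t\<close> by \<open>s \<circ> ?\<tau>\<close>,
  \<open>?\<tau> \<circ> t\<close> keeps the product and the compatibility and reverses the
  sign.\<close>

lemma labelling_sum_not_inj:
  assumes z: "z \<in> sym_group k" and ninj: "\<not> inj_on y {..<k}"
  shows "labelling_sum k q z y = 0"
proof -
  obtain a b where ab: "a < k" "b < k" "a \<noteq> b" "y a = y b"
    using ninj by (auto simp: inj_on_def)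
  let ?\<tau> = "transpose a b"
  have \<tau>: "?\<tau> \<in> sym_group k" using ab transpose_in_sym_group by blast
  have comp: "compatible k q (z \<circ> inv (?\<tau> \<circ> t)) (?\<tau> \<circ> t) y = compatible k q (z \<circ> inv t) t y"
    if t: "t \<in> sym_group k" for t
  proof -
    have "z \<circ> inv (?\<tau> \<circ> t) = z \<circ> inv t \<circ> ?\<tau>"
      using sym_group_inv_comp[OF \<tau> t] by (simp add: comp_assoc)
    then show ?thesis
      using fixed_comp_transpose[of "\<lambda>x. y x div q" a b k "z \<circ> inv t"] ab(1,2)
        comp_transpose_eq[of "\<lambda>x. y x mod q" a b] ab(4)
      by (simp add: compatible_def)
  qed
  have "labelling_sum k q z y = (\<Sum>t\<in>sym_group k.
      if compatible k q (z \<circ> inv (?\<tau> \<circ> t)) (?\<tau> \<circ> t) y then of_int (sign (?\<tau> \<circ> t)) else 0)"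
    unfolding labelling_sum_def
    by (rule sum.reindex_bij_betw[symmetric, OF bij_betw_sym_group(1)[OF \<tau>]])
  also have "\<dots> = (\<Sum>t\<in>sym_group k. - (if compatible k q (z \<circ> inv t) t y then of_int (sign t) else 0))"
    by (intro sum.cong refl) (simp add: comp sym_group_sign[OF \<tau>] sign_swap_id ab(3))
  finally show ?thesis by (simp add: sum_negf labelling_sum_def)
qed

text \<open>The row and the column of a box are independent, so a compatible labelling is a pair of
  a row colouring fixed by \<open>s\<close> and a column colouring fixed by
  \<open>t\<close>.\<close>

lemma card_compatible:
  assumes s: "s \<in> sym_group k" and t: "t \<in> sym_group k"
  shows "card {y \<in> {..<k} \<rightarrow>\<^sub>E {..<p * q}. compatible k q s t y}
    = p ^ num_cycles {..<k} s * q ^ num_cycles {..<k} t"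
proof -
  let ?A = "{y \<in> {..<k} \<rightarrow>\<^sub>E {..<p * q}. compatible k q s t y}"
  let ?R = "fixed_colourings {..<k} {..<p} s" and ?C = "fixed_colourings {..<k} {..<q} t"
  let ?f = "\<lambda>y. (\<lambda>x\<in>{..<k}. y x div q, \<lambda>x\<in>{..<k}. y x mod q)"
  let ?g = "\<lambda>(a, b). \<lambda>x\<in>{..<k}. a x * q + b x"
  note lt = sym_group_less[OF s] sym_group_less[OF t]
  have "bij_betw ?f ?A (?R \<times> ?C)"
  proof (rule bij_betw_byWitness[where f' = ?g])
    show "\<forall>y\<in>?A. ?g (?f y) = y"
    proof
      fix y assume "y \<in> ?A"
      then have ext: "y \<in> extensional {..<k}" by (simp add: PiE_iff)
      show "?g (?f y) = y"
      proof
        fix x show "?g (?f y) x = y x"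
          using extensional_arb[OF ext, of x] by (cases "x < k") simp_all
      qed
    qed
    show "\<forall>ab\<in>?R \<times> ?C. ?f (?g ab) = ab"
    proof
      fix ab assume "ab \<in> ?R \<times> ?C"
      then obtain a b where ab: "ab = (a, b)" "a \<in> {..<k} \<rightarrow>\<^sub>E {..<p}" "b \<in> {..<k} \<rightarrow>\<^sub>E {..<q}"
        by (cases ab) (simp add: fixed_colourings_def)
      have b: "b x < q" if "x < k" for x using PiE_mem[OF ab(3), of x] that by simp
      have "(a x * q + b x) div q = a x \<and> (a x * q + b x) mod q = b x" if "x < k" for x
        using b[OF that] by simp
      moreover have "a x = undefined" "b x = undefined" if "\<not> x < k" for x
        using that PiE_arb[OF ab(2), of x] PiE_arb[OF ab(3), of x] by simp_all
      ultimately have "fst (?f (?g ab)) x = a x" "snd (?f (?g ab)) x = b x" for x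
        by (cases "x < k", simp_all add: ab(1))+
      then show "?f (?g ab) = ab" unfolding ab(1) by (intro prod_eqI ext) simp_all
    qed
    show "?f ` ?A \<subseteq> ?R \<times> ?C"
    proof
      fix ab assume "ab \<in> ?f ` ?A"
      then obtain y where y: "y \<in> {..<k} \<rightarrow>\<^sub>E {..<p * q}" "compatible k q s t y" and ab: "ab = ?f y" by blast
      have "y x div q < p \<and> y x mod q < q" if "x < k" for x
      proof -
        have "y x < p * q" using PiE_mem[OF y(1), of x] that by simp
        moreover from this have "q > 0" by (cases q) auto
        ultimately show ?thesis by (simp add: less_mult_imp_div_less)
      qed
      then show "ab \<in> ?R \<times> ?C"
        using y(2) lt by (simp add: ab fixed_colourings_def compatible_def)
    qed
    show "?g ` (?R \<times> ?C) \<subseteq> ?A"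
    proof
      fix y assume "y \<in> ?g ` (?R \<times> ?C)"
      then obtain a b where a: "a \<in> ?R" and b: "b \<in> ?C" and y: "y = ?g (a, b)" by blast
      have a': "a x < p" "a (s x) = a x" and b': "b x < q" "b (t x) = b x" if "x < k" for x
        using that a b by (simp_all add: fixed_colourings_def PiE_iff)
      have yx: "y x < p * q" "y x div q = a x" "y x mod q = b x" if x: "x < k" for x
      proof -
        have "a x * q + b x < Suc (a x) * q" using b'(1)[OF x] by simp
        also have "\<dots> \<le> p * q" using a'(1)[OF x] by (intro mult_le_mono1) simp
        finally show "y x < p * q" using x by (simp add: y)
        show "y x div q = a x" "y x mod q = b x" using b'(1)[OF x] x by (simp_all add: y)
      qed
      have "compatible k q s t y"
        unfolding compatible_def by (simp add: yx lt a' b')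
      moreover have "y \<in> {..<k} \<rightarrow>\<^sub>E {..<p * q}"
        using yx(1) by (simp add: PiE_iff y)
      ultimately show "y \<in> ?A" by simp
    qed
  qed
  from bij_betw_same_card[OF this] show ?thesis
    using s t by (simp add: card_cartesian_product card_fixed_colourings in_sym_group)
qed

text \<open>Labellings that are not injective contribute nothing, so they may be added before the
  sums are exchanged and the labellings counted.\<close>

lemma sum_inj_labelling_sum:
  assumes z: "z \<in> sym_group k"
  shows "(\<Sum>y\<in>{y \<in> {..<k} \<rightarrow>\<^sub>E {..<p * q}. inj_on y {..<k}}. labelling_sum k q z y)
    = factorization_sum k z (of_nat p) (of_nat q)"
proof -
  let ?Y = "{..<k} \<rightarrow>\<^sub>E {..<p * q}"
  have fin: "finite ?Y" by (simp add: finite_PiE)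
  have "(\<Sum>y\<in>{y \<in> ?Y. inj_on y {..<k}}. labelling_sum k q z y) = (\<Sum>y\<in>?Y. labelling_sum k q z y)"
    by (rule sum.mono_neutral_left) (use fin labelling_sum_not_inj[OF z] in auto)
  also have "\<dots> = (\<Sum>t\<in>sym_group k. \<Sum>y\<in>?Y. if compatible k q (z \<circ> inv t) t y then of_int (sign t) else 0)"
    unfolding labelling_sum_def by (rule sum.swap)
  also have "\<dots> = factorization_sum k z (of_nat p) (of_nat q)"
    unfolding factorization_sum_def
  proof (rule sum.cong[OF refl])
    fix t assume t: "t \<in> sym_group k"
    have "(\<Sum>y\<in>?Y. if compatible k q (z \<circ> inv t) t y then of_int (sign t) else (0::complex))
        = of_int (sign t) * of_nat (card {y \<in> ?Y. compatible k q (z \<circ> inv t) t y})"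
      using fin by (subst sum.If_cases) (simp_all add: Int_def mult.commute)
    also have "card {y \<in> ?Y. compatible k q (z \<circ> inv t) t y}
        = p ^ num_cycles {..<k} (z \<circ> inv t) * q ^ num_cycles {..<k} t"
      using z t by (intro card_compatible) auto
    finally show "(\<Sum>y\<in>?Y. if compatible k q (z \<circ> inv t) t y then of_int (sign t) else (0::complex))
        = of_int (sign t) * of_nat p ^ num_cycles {..<k} (z \<circ> inv t) * of_nat q ^ num_cycles {..<k} t"
      by (simp only: of_nat_mult of_nat_power mult.assoc)
  qed
  finally show ?thesis .
qed

text \<open>Reading \<open>u\<close> as a labelling of the points by boxes and conjugating by it
  turns row and column permutations into compatible factors of \<open>z\<close>. The point is that
  such factors cannot move anything that \<open>z\<close> fixes.\<close>

lemma young_symmetrizer_conj_eq_labelling_sum: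
  assumes k: "k \<le> p * q" and z: "z \<in> sym_group k" and u: "u \<in> sym_group (p * q)"
  shows "young_symmetrizer (rect p q) (u \<circ> z \<circ> inv u) = labelling_sum k q z u"
proof -
  let ?n = "p * q"
  have mono: "t \<in> sym_group ?n" if "t \<in> sym_group k" for t
    using that sym_group_mono[OF k] by blast
  have zn: "z \<in> sym_group ?n" by (rule mono[OF z])
  note uinv = sym_group_inverse_simps[OF u]
  define T where "T = {t \<in> sym_group k. compatible k q (z \<circ> inv t) t u}"
  define P where "P = {(s, t). s \<in> row_stabilizer (rect p q) \<and> t \<in> col_stabilizer (rect p q) \<and> s \<circ> t = u \<circ> z \<circ> inv u}"
  define to where "to t = (u \<circ> (z \<circ> inv t) \<circ> inv u, u \<circ> t \<circ> inv u)" for t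
  define from' where "from' = (\<lambda>(s :: nat \<Rightarrow> nat, t). inv u \<circ> t \<circ> u)"
  have fixed: "u (s x) div q = u x div q" "u (t x) mod q = u x mod q"
    if "compatible k q s t u" "s \<in> sym_group k" "t \<in> sym_group k" for s t x
    using that sym_group_ge[of s k x] sym_group_ge[of t k x] by (cases "x < k"; simp add: compatible_def)+
  have "(\<Sum>(s, t)\<in>P. of_int (sign t) :: complex) = (\<Sum>t\<in>T. of_int (sign t))"
  proof (rule sum.reindex_bij_witness[where i = to and j = from'])
    fix st assume "st \<in> P"
    then obtain s t where st: "st = (s, t)" and s: "s \<in> sym_group ?n" "\<And>m. m < ?n \<Longrightarrow> s m div q = m div q"
      and t: "t \<in> sym_group ?n" "\<And>m. m < ?n \<Longrightarrow> t m mod q = m mod q"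
      and eq: "s \<circ> t = u \<circ> z \<circ> inv u"
      by (auto simp: P_def row_stabilizer_rect col_stabilizer_rect)
    define t' s' where "t' = inv u \<circ> t \<circ> u" and "s' = inv u \<circ> s \<circ> u"
    have ut': "u (t' x) = t (u x)" and us': "u (s' x) = s (u x)" for x
      by (simp_all add: t'_def s'_def uinv)
    have t'n: "t' \<in> sym_group ?n" and s'n: "s' \<in> sym_group ?n"
      using s(1) t(1) u by (auto simp: t'_def s'_def)
    have st': "s' (t' x) = z x" for x
    proof -
      have "u (s' (t' x)) = u (z x)"
        using fun_cong[OF eq, of "u x"] by (simp add: us' ut' uinv)
      then show ?thesis by (metis uinv(7))
    qed
    have row: "u (s' x) div q = u x div q" and col: "u (t' x) mod q = u x mod q" if "x < ?n" for x
      using that s(2) t(2) sym_group_less[OF u] by (simp_all add: us' ut')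
    \<comment> \<open>Here \<open>s'\<close> takes \<open>t' x\<close> back to \<open>x\<close>, so
      both have labels in one row, while \<open>t'\<close> keeps the label of \<open>x\<close> in
      its column; a box is determined by its row and column.\<close>
    have "t' x = x" if x: "x \<in> {..<?n} - {..<k}" for x
    proof -
      have "s' (t' x) = x" using st' sym_group_ge[OF z, of x] x by simp
      then have "u (t' x) div q = u x div q"
        using row[of "t' x"] sym_group_less[OF t'n, of x] x by simp
      moreover have "u (t' x) mod q = u x mod q" using col x by simp
      ultimately have "u (t' x) = u x" by (metis div_mult_mod_eq)
      then show ?thesis by (metis uinv(7))
    qed
    then have t'k: "t' \<in> sym_group k"
      using t'n permutes_superset[of t' "{..<?n}" "{..<k}"] by (simp add: in_sym_group)
    have s'_eq: "z \<circ> inv t' = s'"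
    proof -
      have "z = s' \<circ> t'" using st' by auto
      then show ?thesis using sym_group_inverse_simps(4)[OF t'n] by (simp add: comp_assoc)
    qed
    have "compatible k q (z \<circ> inv t') t' u"
      unfolding s'_eq compatible_def using row col k by simp
    then show "from' st \<in> T"
      unfolding T_def from'_def st prod.case t'_def[symmetric] using t'k by blast
    show "to (from' st) = st"
    proof -
      have "u \<circ> s' \<circ> inv u = s" "u \<circ> t' \<circ> inv u = t"
        using us' ut' uinv(6) by (auto simp: fun_eq_iff)
      then show ?thesis by (simp add: to_def from'_def st t'_def[symmetric] s'_eq)
    qed
    have "sign (inv u \<circ> t \<circ> inv (inv u)) = sign t"
      using sign_sym_group_conj[OF t(1) sym_group_closed(3)[OF u]] .
    then show "(of_int (sign (from' st)) :: complex) = (case st of (s, t) \<Rightarrow> of_int (sign t))"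
      by (simp add: from'_def st uinv)
  next
    fix t assume "t \<in> T"
    then have t: "t \<in> sym_group k" and comp: "compatible k q (z \<circ> inv t) t u" by (auto simp: T_def)
    note tn = mono[OF t]
    have s: "z \<circ> inv t \<in> sym_group k" using z t by simp
    show "from' (to t) = t"
      by (simp add: from'_def to_def comp_assoc uinv)
    have "(u \<circ> (z \<circ> inv t) \<circ> inv u) m div q = m div q" "(u \<circ> t \<circ> inv u) m mod q = m mod q" for m
      using fixed[OF comp s t, of "inv u m"] by (simp_all add: uinv)
    moreover have "u \<circ> (z \<circ> inv t) \<circ> inv u \<in> sym_group ?n" "u \<circ> t \<circ> inv u \<in> sym_group ?n"
      using u mono[OF s] tn by auto
    moreover have "(u \<circ> (z \<circ> inv t) \<circ> inv u) \<circ> (u \<circ> t \<circ> inv u) = u \<circ> z \<circ> inv u"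
      using uinv(7) sym_group_inverse_simps(7)[OF tn] by (auto simp: fun_eq_iff)
    ultimately show "to t \<in> P"
      by (simp add: P_def to_def row_stabilizer_rect col_stabilizer_rect)
  qed
  also have "\<dots> = labelling_sum k q z u"
    unfolding labelling_sum_def T_def by (subst sum.inter_filter) simp_all
  finally show ?thesis by (simp add: young_symmetrizer_def P_def)
qed

lemma card_extensions:
  assumes k: "k \<le> n" and y: "y \<in> {..<k} \<rightarrow>\<^sub>E {..<n}" "inj_on y {..<k}"
  shows "card {u \<in> sym_group n. restrict u {..<k} = y} = fact (n - k)"
proof -
  have ylt: "y x < n" if "x < k" for x using PiE_mem[OF y(1), of x] that by simp
  have "y ` {..<k} \<subseteq> {..<n}" using ylt by auto
  then have "card ({..<n} - y ` {..<k}) = card {k..<n}"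
    using card_image[OF y(2)] by (simp add: card_Diff_subset)
  then obtain \<beta> where \<beta>: "bij_betw \<beta> {k..<n} ({..<n} - y ` {..<k})"
    using finite_same_card_bij[of "{k..<n}" "{..<n} - y ` {..<k}"] by auto
  \<comment> \<open>One fixed extension of \<open>y\<close>; the others arise from it by first
    permuting the points from \<open>k\<close> on.\<close>
  define u0 where "u0 x = (if x < k then y x else if x < n then \<beta> x else x)" for x
  have 1: "bij_betw u0 {..<k} (y ` {..<k})"
    using inj_on_imp_bij_betw[OF y(2)] by (rule iffD1[OF bij_betw_cong, rotated]) (simp add: u0_def)
  have 2: "bij_betw u0 {k..<n} ({..<n} - y ` {..<k})"
    using \<beta> by (rule iffD1[OF bij_betw_cong, rotated]) (simp add: u0_def)
  have "bij_betw u0 ({..<k} \<union> {k..<n}) (y ` {..<k} \<union> ({..<n} - y ` {..<k}))"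
    using 1 2 by (rule bij_betw_combine) blast
  moreover have "{..<k} \<union> {k..<n} = {..<n}" using k by auto
  moreover have "y ` {..<k} \<union> ({..<n} - y ` {..<k}) = {..<n}" using \<open>y ` {..<k} \<subseteq> {..<n}\<close> by blast
  ultimately have "u0 permutes {..<n}"
    using k by (intro bij_imp_permutes) (simp_all add: u0_def)
  then have u0: "u0 \<in> sym_group n" by (simp add: in_sym_group)
  note inv0 = sym_group_inverse_simps[OF u0]
  let ?U = "{u \<in> sym_group n. restrict u {..<k} = y}"
  have U: "u \<in> ?U \<longleftrightarrow> u \<in> sym_group n \<and> (\<forall>x<k. u x = y x)" for u
  proof -
    have "restrict u {..<k} = y" if "\<forall>x<k. u x = y x"
      using that y(1) by (intro PiE_ext[of _ "{..<k}" "\<lambda>_. {..<n}"]) (auto simp: ylt)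
    moreover have "u x = y x" if "restrict u {..<k} = y" "x < k" for x
      using that by (metis lessThan_iff restrict_apply')
    ultimately show ?thesis by blast
  qed
  have "bij_betw (\<lambda>v. u0 \<circ> v) {v. v permutes {k..<n}} ?U"
  proof (rule bij_betw_byWitness[where f' = "\<lambda>u. inv u0 \<circ> u"])
    show "(\<lambda>v. u0 \<circ> v) ` {v. v permutes {k..<n}} \<subseteq> ?U"
    proof
      fix u assume "u \<in> (\<lambda>v. u0 \<circ> v) ` {v. v permutes {k..<n}}"
      then obtain v where v: "v permutes {k..<n}" and u: "u = u0 \<circ> v" by auto
      have "v \<in> sym_group n"
        unfolding in_sym_group by (rule permutes_subset[OF v]) auto
      moreover have "v x = x" if "x < k" for x
        using that permutes_not_in[OF v, of x] by simp
      ultimately show "u \<in> ?U" unfolding U u using u0 by (simp add: u0_def)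
    qed
    show "(\<lambda>u. inv u0 \<circ> u) ` ?U \<subseteq> {v. v permutes {k..<n}}"
    proof
      fix v assume "v \<in> (\<lambda>u. inv u0 \<circ> u) ` ?U"
      then obtain u where u: "u \<in> sym_group n" "\<And>x. x < k \<Longrightarrow> u x = y x" and v: "v = inv u0 \<circ> u"
        using U by blast
      have "v permutes {..<n}" using u(1) u0 v sym_group_closed by (metis in_sym_group)
      moreover have "v x = x" if "x \<in> {..<n} - {k..<n}" for x
      proof -
        have "x < k" using that by auto
        then have "u x = u0 x" using u(2) by (simp add: u0_def)
        then show ?thesis by (simp add: v inv0)
      qed
      ultimately have "v permutes {k..<n}" by (rule permutes_superset)
      then show "v \<in> {v. v permutes {k..<n}}" by simp
    qed
  qed (simp_all add: inv0)
  from bij_betw_same_card[OF this] show ?thesis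
    using card_permutations[of "{k..<n}" "n - k"] by simp
qed

text \<open>The summand depends only on the labels of the first \<open>k\<close> points, so the
  permutations are grouped by their restrictions, and all groups have the same size.\<close>

lemma sum_labelling_sum:
  assumes k: "k \<le> p * q" and z: "z \<in> sym_group k"
  shows "(\<Sum>u\<in>sym_group (p * q). labelling_sum k q z u)
    = fact (p * q - k) * factorization_sum k z (of_nat p) (of_nat q)"
proof -
  let ?n = "p * q"
  let ?I = "{y \<in> {..<k} \<rightarrow>\<^sub>E {..<?n}. inj_on y {..<k}}"
  let ?r = "\<lambda>u. restrict u {..<k}"
  have restr: "labelling_sum k q z (?r u) = labelling_sum k q z u" for u
  proof -
    have "compatible k q (z \<circ> inv t) t (?r u) = compatible k q (z \<circ> inv t) t u" if "t \<in> sym_group k" for t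
      using that z sym_group_less[of t k] sym_group_less[of "z \<circ> inv t" k] by (auto simp: compatible_def)
    then show ?thesis unfolding labelling_sum_def by (intro sum.cong) auto
  qed
  have sub: "?r ` sym_group ?n \<subseteq> ?I"
  proof
    fix y assume "y \<in> ?r ` sym_group ?n"
    then obtain u where u: "u \<in> sym_group ?n" and y: "y = ?r u" by blast
    have "u x < ?n" if "x < k" for x using sym_group_less[OF u] that k by simp
    moreover have "inj u" using u permutes_inj by (auto simp: in_sym_group)
    then have "inj_on u {..<k}" by (rule inj_on_subset) simp
    ultimately show "y \<in> ?I" by (simp add: y)
  qed
  have "(\<Sum>u\<in>sym_group ?n. labelling_sum k q z u) = (\<Sum>y\<in>?I. \<Sum>u\<in>{u \<in> sym_group ?n. ?r u = y}. labelling_sum k q z u)"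
    by (rule sum.group[symmetric]) (use sub in \<open>simp_all add: finite_PiE\<close>)
  also have "\<dots> = (\<Sum>y\<in>?I. fact (?n - k) * labelling_sum k q z y)"
  proof (rule sum.cong[OF refl])
    fix y assume y: "y \<in> ?I"
    have "(\<Sum>u\<in>{u \<in> sym_group ?n. ?r u = y}. labelling_sum k q z u)
        = (\<Sum>u\<in>{u \<in> sym_group ?n. ?r u = y}. labelling_sum k q z y)"
      using restr by (intro sum.cong refl) auto
    then show "(\<Sum>u\<in>{u \<in> sym_group ?n. ?r u = y}. labelling_sum k q z u) = fact (?n - k) * labelling_sum k q z y"
      using card_extensions[OF k, of y] y by simp
  qed
  also have "\<dots> = fact (?n - k) * factorization_sum k z (of_nat p) (of_nat q)"
    by (simp add: sum_distrib_left[symmetric] sum_inj_labelling_sum[OF z])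
  finally show ?thesis .
qed

lemma falling_of_nat_fact:
  "k \<le> n \<Longrightarrow> falling (of_nat n :: complex) k * fact (n - k) = fact n"
proof (induction k)
  case (Suc k)
  have "n - k = Suc (n - Suc k)" using Suc.prems by simp
  then have "(fact (n - k) :: complex) = (of_nat n - of_nat k) * fact (n - Suc k)"
    using Suc.prems by (simp add: of_nat_diff)
  then show ?case using Suc by (simp add: falling_def mult.assoc)
qed (simp add: falling_def)

text \<open>The unknown scalar \<alpha> occurs both in the trace and in the dimension and cancels in
  the quotient. The inverse of the standard cycle comes from the inverse in the action on the group
  algebra.\<close>

lemma Ch_rect_eq_factorization_sum:
  assumes k: "k > 0"
  shows "Ch {#k#} (rect p q) = factorization_sum k (inv (std_cycle k)) (of_nat p) (of_nat q)"
proof (cases "k \<le> p * q")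
  \<comment> \<open>With fewer boxes than points there is no injective labelling, which matches the
    value 0 in the definition of \<open>Ch\<close>.\<close>
  case False
  have empty: "{y \<in> {..<k} \<rightarrow>\<^sub>E {..<p * q}. inj_on y {..<k}} = {}"
    using False card_inj[of _ "{..<k}" "{..<p * q}"] by (auto simp: PiE_iff)
  have "factorization_sum k (inv (std_cycle k)) (of_nat p) (of_nat q) = 0"
    using sum_inj_labelling_sum[of "inv (std_cycle k)" k q p] std_cycle_sym_group unfolding empty by simp
  then show ?thesis using False by (simp add: Ch_def)
next
  case True
  let ?n = "p * q" and ?\<zeta> = "std_cycle k" and ?c = "young_symmetrizer (rect p q)"
  have \<zeta>k: "?\<zeta> \<in> sym_group k" by (rule std_cycle_sym_group)
  then have \<zeta>: "?\<zeta> \<in> sym_group ?n" using sym_group_mono[OF True] by blast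
  let ?\<mu> = "{#k#} + replicate_mset (?n - k) 1"
  define w where "w = (SOME w. w \<in> sym_group ?n \<and> cycle_type ?n w = ?\<mu>)"
  have w: "w \<in> sym_group ?n" "cycle_type ?n w = ?\<mu>"
    using someI[of "\<lambda>w. w \<in> sym_group ?n \<and> cycle_type ?n w = ?\<mu>" ?\<zeta>] \<zeta> cycle_type_std_cycle[OF k True]
    unfolding w_def by blast+
  obtain K where K: "cyclic_on w K" "K \<subseteq> {..<?n}" "card K = k" "\<And>x. x \<notin> K \<Longrightarrow> w x = x"
    using cycle_type_single_cycle[OF w] by metis
  have \<zeta>_fix: "?\<zeta> x = x" if "x \<notin> {..<k}" for x using that by (simp add: std_cycle_def)
  obtain h where h: "h \<in> sym_group ?n" "w = h \<circ> ?\<zeta> \<circ> inv h"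
    using cycles_conjugate[OF \<zeta> cyclic_on_std_cycle[OF k] _ \<zeta>_fix K(1,2,4)] True K(3) by auto
  have inv_w: "inv w = h \<circ> inv ?\<zeta> \<circ> inv h"
    using h \<zeta> by (simp add: sym_group_inv_comp[of _ ?n] sym_group_inverse_simps[OF h(1)] comp_assoc)
  obtain \<alpha> where \<alpha>: "\<alpha> * specht_character (rect p q) w = (\<Sum>u\<in>sym_group ?n. ?c (inv u \<circ> inv w \<circ> u))"
    "\<alpha> * of_nat (specht_dim (rect p q)) = fact ?n"
    by (rule specht_character_rect[OF w(1)])
  \<comment> \<open>This substitution absorbs the conjugator \<open>h\<close> and turns the inner
    conjugation around, so that \<open>u\<close> becomes the labelling.\<close>
  have "bij_betw (\<lambda>u. h \<circ> inv u) (sym_group ?n) (sym_group ?n)"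
    using bij_betw_trans[OF bij_betw_sym_group(4)[OF h(1)] bij_betw_sym_group(1)[OF h(1)]] by (simp add: comp_def)
  then have "(\<Sum>u\<in>sym_group ?n. ?c (inv u \<circ> inv w \<circ> u))
      = (\<Sum>u\<in>sym_group ?n. ?c (inv (h \<circ> inv u) \<circ> inv w \<circ> (h \<circ> inv u)))"
    by (rule sum.reindex_bij_betw[symmetric])
  also have "\<dots> = (\<Sum>u\<in>sym_group ?n. labelling_sum k q (inv ?\<zeta>) u)"
  proof (rule sum.cong[OF refl])
    fix u assume u: "u \<in> sym_group ?n"
    have "inv (h \<circ> inv u) \<circ> inv w \<circ> (h \<circ> inv u) = u \<circ> inv ?\<zeta> \<circ> inv u"
      using h(1) u by (simp add: inv_w sym_group_inv_comp[of _ ?n] sym_group_inverse_simps[of _ ?n] comp_assoc)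
    then show "?c (inv (h \<circ> inv u) \<circ> inv w \<circ> (h \<circ> inv u)) = labelling_sum k q (inv ?\<zeta>) u"
      using young_symmetrizer_conj_eq_labelling_sum[OF True _ u, of "inv ?\<zeta>"] \<zeta>k by simp
  qed
  also have "\<dots> = fact (?n - k) * factorization_sum k (inv ?\<zeta>) (of_nat p) (of_nat q)"
    using sum_labelling_sum[OF True] \<zeta>k by simp
  finally have \<alpha>1: "\<alpha> * specht_character (rect p q) w
      = fact (?n - k) * factorization_sum k (inv ?\<zeta>) (of_nat p) (of_nat q)"
    using \<alpha>(1) by simp
  have nz: "\<alpha> \<noteq> 0" using \<alpha>(2) by (metis fact_nonzero mult_zero_left)
  have "Ch {#k#} (rect p q) = falling (of_nat ?n) k * specht_character (rect p q) w / of_nat (specht_dim (rect p q))"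
    using True by (simp add: Ch_def character_at_def w_def Let_def)
  also have "\<dots> = falling (of_nat ?n) k * (\<alpha> * specht_character (rect p q) w) / (\<alpha> * of_nat (specht_dim (rect p q)))"
    using nz by simp
  also have "\<dots> = (falling (of_nat ?n) k * fact (?n - k)) / fact ?n * factorization_sum k (inv ?\<zeta>) (of_nat p) (of_nat q)"
    unfolding \<alpha>1 \<alpha>(2) by simp
  also have "\<dots> = factorization_sum k (inv ?\<zeta>) (of_nat p) (of_nat q)"
    unfolding falling_of_nat_fact[OF True] by simp
  finally show ?thesis .
qed

section \<open>Polynomials in two variables\<close>

lemma map_poly_additive:
  assumes "f 0 = 0" "\<And>a b. f (a + b) = f a + f b"
  shows "map_poly f (P + Q) = map_poly f P + map_poly f Q"
  by (rule poly_eqI) (simp add: coeff_map_poly assms)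

lemma eval2_add: "eval2 (P + Q) p q = eval2 P p q + eval2 Q p q"
proof -
  let ?H = "\<lambda>c :: rat poly. poly (map_poly of_rat c) q"
  have "?H (a + b) = ?H a + ?H b" for a b
    by (subst map_poly_additive) (simp_all add: of_rat_add)
  then show ?thesis
    unfolding eval2_def by (subst map_poly_additive) simp_all
qed

lemma eval2_sum: "eval2 (\<Sum>i\<in>I. P i) p q = (\<Sum>i\<in>I. eval2 (P i) p q)"
  by (induction I rule: infinite_finite_induct) (simp_all add: eval2_add, simp_all add: eval2_def)

lemma eval2_diff: "eval2 (P - Q) p q = eval2 P p q - eval2 Q p q"
  using eval2_add[of "P - Q" Q p q] by simp

lemma eval2_monom: "eval2 (monom (monom c b) a) p q = of_rat c * p ^ a * q ^ b"
  by (simp add: eval2_def map_poly_monom poly_monom algebra_simps)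

lemma poly_eq_0_of_pos_nat_roots:
  fixes P :: "complex poly"
  assumes "\<And>n :: nat. n > 0 \<Longrightarrow> poly P (of_nat n) = 0"
  shows "P = 0"
proof (rule ccontr)
  assume "P \<noteq> 0"
  then have "finite {x. poly P x = 0}" by (rule poly_roots_finite)
  moreover have "of_nat ` {0<..} \<subseteq> {x. poly P x = 0}" using assms by auto
  ultimately have "finite (of_nat ` {0::nat<..} :: complex set)" by (rule finite_subset[rotated])
  then have "finite {0::nat<..}" by (rule finite_imageD) (simp add: inj_on_def)
  then show False using infinite_Ioi by blast
qed

text \<open>For a fixed positive integer \<open>q\<close> the difference is a polynomial in
  \<open>p\<close> with infinitely many roots; hence each coefficient vanishes at all positive
  integers \<open>q\<close> and is zero as well. This determines the polynomial in the description
  \<open>Ch_rect_poly\<close>.\<close>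

lemma eval2_unique:
  assumes "\<And>p q :: nat. p > 0 \<Longrightarrow> q > 0 \<Longrightarrow> eval2 P (of_nat p) (of_nat q) = eval2 Q (of_nat p) (of_nat q)"
  shows "P = Q"
proof -
  define R where "R = P - Q"
  have R: "eval2 R (of_nat p) (of_nat q) = 0" if "p > 0" "q > 0" for p q :: nat
    using assms[OF that] by (simp add: R_def eval2_diff)
  have "coeff R i = 0" for i
  proof -
    have "poly (map_poly of_rat (coeff R i)) (of_nat q :: complex) = 0" if "q > 0" for q :: nat
    proof -
      have "map_poly (\<lambda>c. poly (map_poly of_rat c) (of_nat q :: complex)) R = 0"
        by (rule poly_eq_0_of_pos_nat_roots) (use R that in \<open>simp add: eval2_def\<close>)
      then have "coeff (map_poly (\<lambda>c. poly (map_poly of_rat c) (of_nat q :: complex)) R) i = 0" by simp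
      then show ?thesis by (simp add: coeff_map_poly)
    qed
    then have "map_poly of_rat (coeff R i) = (0 :: complex poly)" by (rule poly_eq_0_of_pos_nat_roots)
    then show ?thesis by (simp add: map_poly_eq_0_iff)
  qed
  then have "R = 0" by (intro poly_eqI) simp
  then show ?thesis by (simp add: R_def)
qed

lemma Ch_rect_polynomial:
  assumes "\<And>p q :: nat. Ch \<mu> (rect p q) = factorization_sum k z (of_nat p) (of_nat q)"
  shows "Ch_rect \<mu> p q = factorization_sum k z p q"
proof -
  define P :: "rat poly poly" where "P = (\<Sum>t\<in>sym_group k.
    monom (monom (of_int (sign t)) (num_cycles {..<k} t)) (num_cycles {..<k} (z \<circ> inv t)))"
  have P: "eval2 P p q = factorization_sum k z p q" for p q
    by (simp add: P_def eval2_sum eval2_monom factorization_sum_def)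
  have "Ch_rect_poly \<mu> = P"
    unfolding Ch_rect_poly_def by (rule the_equality) (auto intro: eval2_unique simp: assms P)
  then show ?thesis by (simp add: Ch_rect_def P)
qed

text \<open>At \<open>p = 1\<close> the first factor leaves no trace and only the signed cycle
  polynomial in \<open>q\<close> remains; its known values at positive integers determine it at
  every complex number.\<close>

lemma factorization_sum_1:
  "factorization_sum k z 1 q = falling q k"
proof -
  define P :: "complex poly" where
    "P = (\<Sum>t\<in>sym_group k. monom (of_int (sign t)) (num_cycles {..<k} t)) - (\<Prod>r<k. [:- of_nat r, 1:])"
  have P: "poly P q = factorization_sum k z 1 q - falling q k" for q
    by (simp add: P_def poly_sum poly_prod poly_monom factorization_sum_def falling_def)
  have "P = 0"
    by (rule poly_eq_0_of_pos_nat_roots)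
      (simp add: P factorization_sum_def signed_cycle_polynomial_nat)
  then show ?thesis using P[of q] by simp
qed

section \<open>Newton interpolation with zeros on a triangle\<close>

lemma poly_eq_smult_prod_roots:
  fixes P :: "'a :: field poly"
  assumes S: "finite S" "degree P \<le> card S" "\<And>s. s \<in> S \<Longrightarrow> poly P s = 0"
  obtains c where "P = smult c (\<Prod>s\<in>S. [:- s, 1:])"
proof -
  let ?M = "\<Prod>s\<in>S. [:- s, 1:]"
  have degM: "degree ?M = card S" by (subst degree_prod_sum_eq) auto
  have leadM: "coeff ?M (card S) = 1"
    using lead_coeff_prod[of "\<lambda>s. [:- s, 1:]" S] degM by simp
  define c where "c = coeff P (card S)"
  define Q where "Q = P - smult c ?M"
  have "Q = 0"
  proof (rule ccontr)
    assume "Q \<noteq> 0"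
    have "degree Q \<le> card S"
      unfolding Q_def using S(2) degM by (intro degree_diff_le) (auto intro: order.trans[OF degree_smult_le])
    moreover have "coeff Q (card S) = 0" by (simp add: Q_def c_def leadM)
    ultimately have "degree Q < card S"
      using \<open>Q \<noteq> 0\<close> by (metis leading_coeff_0_iff le_neq_implies_less)
    moreover have "S \<subseteq> {x. poly Q x = 0}"
      using S by (auto simp: Q_def poly_prod prod_zero_iff)
    then have "card S \<le> card {x. poly Q x = 0}"
      using poly_roots_finite[OF \<open>Q \<noteq> 0\<close>] by (rule card_mono[rotated])
    then have "card S \<le> degree Q" using card_poly_roots_bound[OF \<open>Q \<noteq> 0\<close>] by simp
    ultimately show False by simp
  qed
  then show ?thesis using that by (simp add: Q_def)
qed

text \<open>The polynomial functions of total degree at most \<open>j\<close> in \<open>D\<close>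
  and \<open>E\<close>, expanded in the Newton basis for the nodes \<open>x\<close> in the variable
  \<open>D\<close> only; the dependence on \<open>E\<close> stays in the coefficient
  polynomials.\<close>

definition newton_form :: "(nat \<Rightarrow> complex) \<Rightarrow> nat \<Rightarrow> (complex \<Rightarrow> complex \<Rightarrow> complex) \<Rightarrow> bool" where
  "newton_form x j G \<longleftrightarrow> (\<exists>g :: nat \<Rightarrow> complex poly. (\<forall>a\<le>j. degree (g a) \<le> j - a) \<and>
     (\<forall>D E. G D E = (\<Sum>a\<le>j. (\<Prod>r<a. D - x r) * poly (g a) E)))"

lemma newton_form_0: "newton_form x j (\<lambda>D E. 0)"
  unfolding newton_form_def by (rule exI[of _ "\<lambda>a. 0"]) simp

lemma newton_form_add:
  assumes "newton_form x j G" "newton_form x j H"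
  shows "newton_form x j (\<lambda>D E. G D E + H D E)"
proof -
  obtain g h where
    g: "\<forall>a\<le>j. degree (g a) \<le> j - a" "\<forall>D E. G D E = (\<Sum>a\<le>j. (\<Prod>r<a. D - x r) * poly (g a) E)" and
    h: "\<forall>a\<le>j. degree (h a) \<le> j - a" "\<forall>D E. H D E = (\<Sum>a\<le>j. (\<Prod>r<a. D - x r) * poly (h a) E)"
    using assms unfolding newton_form_def by blast
  show ?thesis unfolding newton_form_def
    by (rule exI[of _ "\<lambda>a. g a + h a"]) (simp add: g h degree_add_le sum.distrib algebra_simps)
qed

lemma newton_form_scale:
  assumes "newton_form x j G"
  shows "newton_form x j (\<lambda>D E. c * G D E)"
proof -
  obtain g where
    g: "\<forall>a\<le>j. degree (g a) \<le> j - a" "\<forall>D E. G D E = (\<Sum>a\<le>j. (\<Prod>r<a. D - x r) * poly (g a) E)"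
    using assms unfolding newton_form_def by blast
  show ?thesis unfolding newton_form_def
  proof (intro exI[of _ "\<lambda>a. smult c (g a)"] conjI allI impI)
    show "degree (smult c (g a)) \<le> j - a" if "a \<le> j" for a
      using g(1) that degree_smult_le[of c "g a"] by (meson order.trans)
  qed (simp add: g(2) sum_distrib_left algebra_simps)
qed

lemma newton_form_monomial:
  assumes "a + b \<le> j"
  shows "newton_form x j (\<lambda>D E. D ^ a * E ^ b)"
proof -
  have "\<exists>c. \<forall>D. D ^ a = (\<Sum>i\<le>a. c i * (\<Prod>r<i. D - x r))" for a
  proof (induction a)
    case 0
    show ?case by (rule exI[of _ "\<lambda>_. 1"]) simp
  next
    case (Suc a)
    then obtain c where c: "\<And>D. D ^ a = (\<Sum>i\<le>a. c i * (\<Prod>r<i. D - x r))" by blast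
    \<comment> \<open>Multiplying a Newton basis element by \<open>D\<close> gives the next one plus
      \<open>x i\<close> times the element itself.\<close>
    define c' where "c' i = (case i of 0 \<Rightarrow> 0 | Suc i \<Rightarrow> c i) + (if i \<le> a then x i * c i else 0)" for i
    have "D ^ Suc a = (\<Sum>i\<le>Suc a. c' i * (\<Prod>r<i. D - x r))" for D
    proof -
      let ?N = "\<lambda>i. \<Prod>r<i. D - x r"
      have "D ^ Suc a = (\<Sum>i\<le>a. c i * ?N (Suc i) + x i * c i * ?N i)"
        by (simp add: c[of D] sum_distrib_left algebra_simps)
      also have "\<dots> = (\<Sum>i\<le>a. c i * ?N (Suc i)) + (\<Sum>i\<le>a. x i * c i * ?N i)"
        by (rule sum.distrib)
      also have "(\<Sum>i\<le>a. c i * ?N (Suc i)) = (\<Sum>i\<le>Suc a. (case i of 0 \<Rightarrow> 0 | Suc i \<Rightarrow> c i) * ?N i)"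
        by (subst sum.atMost_Suc_shift) (simp del: prod.lessThan_Suc)
      also have "(\<Sum>i\<le>a. x i * c i * ?N i) = (\<Sum>i\<le>Suc a. (if i \<le> a then x i * c i else 0) * ?N i)"
        by simp
      finally show ?thesis
        unfolding c'_def by (simp only: sum.distrib[symmetric] distrib_right)
    qed
    then show ?case by blast
  qed
  then obtain c where c: "\<And>D. D ^ a = (\<Sum>i\<le>a. c i * (\<Prod>r<i. D - x r))" by blast
  show ?thesis unfolding newton_form_def
  proof (intro exI[of _ "\<lambda>i. monom (if i \<le> a then c i else 0) b"] conjI allI impI)
    show "degree (monom (if i \<le> a then c i else 0) b) \<le> j - i" if "i \<le> j" for i
      using assms degree_monom_le[of "c i" b] by (cases "i \<le> a") auto
    show "D ^ a * E ^ b = (\<Sum>i\<le>j. (\<Prod>r<i. D - x r) * poly (monom (if i \<le> a then c i else 0) b) E)" for D E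
    proof -
      have "(\<Sum>i\<le>j. (\<Prod>r<i. D - x r) * poly (monom (if i \<le> a then c i else 0) b) E)
          = (\<Sum>i\<le>a. (\<Prod>r<i. D - x r) * poly (monom (if i \<le> a then c i else 0) b) E)"
        using assms by (intro sum.mono_neutral_right) auto
      also have "\<dots> = (\<Sum>i\<le>a. c i * (\<Prod>r<i. D - x r)) * E ^ b"
        unfolding sum_distrib_right by (intro sum.cong refl) (simp add: poly_monom)
      finally show ?thesis by (simp add: c[of D])
    qed
  qed
qed

text \<open>Put \<open>D = x a\<close> and \<open>E = x b\<close> with \<open>a \<le> b\<close>. The
  terms of index above \<open>a\<close> vanish through \<open>D\<close>, and those below
  \<open>a\<close> through \<open>E\<close> by induction, so \<open>g a\<close> has the roots
  \<open>x b\<close> for all \<open>b\<close> from \<open>a\<close> to \<open>j - 1\<close>. As its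
  degree is at most \<open>j - a\<close>, it is a multiple of the corresponding product.\<close>

lemma newton_form_triangle_zeros:
  assumes G: "newton_form x j G" and inj: "inj x"
    and zero: "\<And>a b. a \<le> b \<Longrightarrow> b < j \<Longrightarrow> G (x a) (x b) = 0"
  obtains \<alpha> where "\<And>D E. G D E = (\<Sum>a\<le>j. \<alpha> a * (\<Prod>r<a. D - x r) * (\<Prod>r\<in>{a..<j}. E - x r))"
proof -
  obtain g where
    g: "\<And>a. a \<le> j \<Longrightarrow> degree (g a) \<le> j - a" "\<And>D E. G D E = (\<Sum>a\<le>j. (\<Prod>r<a. D - x r) * poly (g a) E)"
    using G unfolding newton_form_def by blast
  have "a \<le> j \<Longrightarrow> \<exists>c. \<forall>E. poly (g a) E = c * (\<Prod>r\<in>{a..<j}. E - x r)" for a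
  proof (induction a rule: less_induct)
    case (less a)
    have roots: "poly (g a) (x b) = 0" if b: "b \<in> {a..<j}" for b
    proof -
      have "0 = (\<Sum>i\<le>j. (\<Prod>r<i. x a - x r) * poly (g i) (x b))"
        using zero[of a b] b g(2) by simp
      also have "\<dots> = (\<Sum>i\<in>{a}. (\<Prod>r<i. x a - x r) * poly (g i) (x b))"
      proof (rule sum.mono_neutral_right)
        show "\<forall>i\<in>{..j} - {a}. (\<Prod>r<i. x a - x r) * poly (g i) (x b) = 0"
        proof
          fix i assume i: "i \<in> {..j} - {a}"
          show "(\<Prod>r<i. x a - x r) * poly (g i) (x b) = 0"
          proof (cases "i < a")
            case True
            then obtain c where "\<forall>E. poly (g i) E = c * (\<Prod>r\<in>{i..<j}. E - x r)"
              using less.IH[of i] i by auto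
            moreover have "(\<Prod>r\<in>{i..<j}. x b - x r) = 0"
              using True b by (intro prod_zero) auto
            ultimately show ?thesis by simp
          next
            case False
            then have "(\<Prod>r<i. x a - x r) = 0" using i by (intro prod_zero) auto
            then show ?thesis by simp
          qed
        qed
      qed (use less.prems in auto)
      finally have "(\<Prod>r<a. x a - x r) * poly (g a) (x b) = 0" by simp
      moreover have "(\<Prod>r<a. x a - x r) \<noteq> 0"
        using inj by (auto simp: prod_zero_iff dest: injD)
      ultimately show ?thesis by simp
    qed
    have inj': "inj_on x {a..<j}" using inj by (rule inj_on_subset) simp
    have deg: "degree (g a) \<le> card (x ` {a..<j})"
      using card_image[OF inj'] g(1)[OF less.prems] by simp
    have "poly (g a) s = 0" if "s \<in> x ` {a..<j}" for s using that roots by blast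
    from poly_eq_smult_prod_roots[OF _ deg this]
    obtain c where "g a = smult c (\<Prod>s\<in>x ` {a..<j}. [:- s, 1:])" by blast
    then have "poly (g a) E = c * (\<Prod>r\<in>{a..<j}. E - x r)" for E
      by (simp add: poly_prod prod.reindex[OF inj'])
    then show ?case by blast
  qed
  then obtain \<alpha> where \<alpha>: "\<And>a E. a \<le> j \<Longrightarrow> poly (g a) E = \<alpha> a * (\<Prod>r\<in>{a..<j}. E - x r)"
    by metis
  show ?thesis
    by (rule that[of \<alpha>]) (simp add: g(2) \<alpha> mult_ac)
qed

section \<open>Polynomials even in both variables\<close>

definition symmetrize :: "(complex \<Rightarrow> complex \<Rightarrow> complex) \<Rightarrow> complex \<Rightarrow> complex \<Rightarrow> complex" where
  "symmetrize F d e = (F d e + F (- d) e + F d (- e) + F (- d) (- e)) / 4"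

text \<open>Single terms of the factorization polynomial need not be even in \<open>d\<close> and
  \<open>e\<close>; only the whole sum is. Requiring the form of the symmetrization gives a property
  that is linear and can be checked term by term.\<close>

definition even_newton_form :: "(nat \<Rightarrow> complex) \<Rightarrow> nat \<Rightarrow> (complex \<Rightarrow> complex \<Rightarrow> complex) \<Rightarrow> bool" where
  "even_newton_form x j F \<longleftrightarrow> (\<exists>G. newton_form x j G \<and> (\<forall>d e. symmetrize F d e = G (d\<^sup>2) (e\<^sup>2)))"

lemma even_newton_form_scale:
  assumes "even_newton_form x j F"
  shows "even_newton_form x j (\<lambda>d e. c * F d e)"
proof -
  obtain G where G: "newton_form x j G" "\<And>d e. symmetrize F d e = G (d\<^sup>2) (e\<^sup>2)"
    using assms unfolding even_newton_form_def by blast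
  have "symmetrize (\<lambda>d e. c * F d e) d e = c * G (d\<^sup>2) (e\<^sup>2)" for d e
    by (simp add: G(2)[symmetric] symmetrize_def distrib_left)
  then show ?thesis using newton_form_scale[OF G(1)] unfolding even_newton_form_def by blast
qed

lemma even_newton_form_add:
  assumes "even_newton_form x j F" "even_newton_form x j F'"
  shows "even_newton_form x j (\<lambda>d e. F d e + F' d e)"
proof -
  obtain G G' where G: "newton_form x j G" "\<And>d e. symmetrize F d e = G (d\<^sup>2) (e\<^sup>2)"
    and G': "newton_form x j G'" "\<And>d e. symmetrize F' d e = G' (d\<^sup>2) (e\<^sup>2)"
    using assms unfolding even_newton_form_def by blast
  have "symmetrize (\<lambda>d e. F d e + F' d e) d e = G (d\<^sup>2) (e\<^sup>2) + G' (d\<^sup>2) (e\<^sup>2)" for d e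
    by (simp add: G(2)[symmetric] G'(2)[symmetric] symmetrize_def field_simps)
  then show ?thesis using newton_form_add[OF G(1) G'(1)] unfolding even_newton_form_def by blast
qed

lemma even_newton_form_sum:
  assumes "\<And>i. i \<in> I \<Longrightarrow> even_newton_form x j (F i)"
  shows "even_newton_form x j (\<lambda>d e. \<Sum>i\<in>I. F i d e)"
  using assms
proof (induction I rule: infinite_finite_induct)
  case (insert i I)
  then show ?case by (simp add: even_newton_form_add)
qed (auto simp: even_newton_form_def symmetrize_def intro!: exI[of _ "\<lambda>_ _. 0"] newton_form_0)

lemma even_newton_form_monomial:
  assumes "m + n \<le> 2 * j"
  shows "even_newton_form x j (\<lambda>d e. d ^ m * e ^ n)"
proof (cases "even m \<and> even n")
  case True
  then obtain a b where ab: "m = 2 * a" "n = 2 * b" by (auto elim!: evenE)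
  have "symmetrize (\<lambda>d e. d ^ m * e ^ n) d e = (d\<^sup>2) ^ a * (e\<^sup>2) ^ b" for d e
    by (simp add: symmetrize_def ab power_mult)
  moreover have "newton_form x j (\<lambda>D E. D ^ a * E ^ b)"
    using assms ab by (intro newton_form_monomial) simp
  ultimately show ?thesis unfolding even_newton_form_def by blast
next
  case False
  then have "symmetrize (\<lambda>d e. d ^ m * e ^ n) d e = 0" for d e
    by (cases "even m"; cases "even n") (simp_all add: symmetrize_def)
  then show ?thesis unfolding even_newton_form_def using newton_form_0 by blast
qed

lemma even_newton_form_powers:
  assumes "a + b \<le> 2 * j"
  shows "even_newton_form x j (\<lambda>d e. (e - d) ^ a * (e + d) ^ b)"
proof -
  have "(e - d) ^ a * (e + d) ^ b = (\<Sum>i\<le>a. \<Sum>l\<le>b. (of_nat (a choose i) * (-1) ^ i * of_nat (b choose l))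
      * (d ^ (i + l) * e ^ ((a - i) + (b - l))))" for d e :: complex
  proof -
    have 1: "(e - d) ^ a = (\<Sum>i\<le>a. of_nat (a choose i) * (- d) ^ i * e ^ (a - i))"
      using binomial_ring[of "- d" e a] by simp
    have 2: "(e + d) ^ b = (\<Sum>l\<le>b. of_nat (b choose l) * d ^ l * e ^ (b - l))"
      using binomial_ring[of d e b] by (simp add: add.commute)
    have 3: "(- d) ^ i = (-1) ^ i * d ^ i" for i by (rule power_minus)
    show ?thesis
      unfolding 1 2 3 sum_product power_add by (intro sum.cong refl) (simp only: mult_ac)
  qed
  moreover have "even_newton_form x j (\<lambda>d e. \<Sum>i\<le>a. \<Sum>l\<le>b. (of_nat (a choose i) * (-1) ^ i * of_nat (b choose l))
      * (d ^ (i + l) * e ^ ((a - i) + (b - l))))"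
    using assms by (intro even_newton_form_sum even_newton_form_scale even_newton_form_monomial) simp
  ultimately show ?thesis by simp
qed

text \<open>The degree bound is the inequality for the cycle numbers of two permutations whose
  product is a full cycle.\<close>

lemma factorization_sum_even_newton_form:
  assumes z: "z \<in> sym_group k" "cyclic_on z {..<k}" and k: "k + 1 \<le> 2 * j"
  shows "even_newton_form x j (\<lambda>d e. factorization_sum k z (e - d) (e + d))"
  unfolding factorization_sum_def mult.assoc
proof (intro even_newton_form_sum even_newton_form_scale even_newton_form_powers)
  fix t assume t: "t \<in> sym_group k"
  have "z \<circ> inv t \<circ> t = z"
    using sym_group_inverse_simps(5)[OF t] by (simp add: comp_assoc)
  moreover have "z \<circ> inv t \<in> sym_group k" using z t by simp
  ultimately have "num_cycles {..<k} (z \<circ> inv t) + num_cycles {..<k} t \<le> k + 1"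
    using num_cycles_add_le[of "{..<k}" "z \<circ> inv t" t] z t by (simp add: in_sym_group)
  then show "num_cycles {..<k} (z \<circ> inv t) + num_cycles {..<k} t \<le> 2 * j" using k by simp
qed

lemma factorization_sum_expansion:
  assumes z: "z \<in> sym_group (2 * j - 1)" "cyclic_on z {..<2 * j - 1}" and j: "j > 0"
  obtains \<alpha> where "\<And>d e. factorization_sum (2 * j - 1) z (e - d) (e + d)
    = (\<Sum>a\<le>j. \<alpha> a * (\<Prod>r<a. d\<^sup>2 - (of_nat r + 1/2)\<^sup>2) * (\<Prod>r\<in>{a..<j}. e\<^sup>2 - (of_nat r + 1/2)\<^sup>2))"
proof -
  let ?k = "2 * j - 1" and ?x = "\<lambda>r :: nat. (of_nat r + 1/2 :: complex)\<^sup>2"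
  let ?F = "\<lambda>d e. factorization_sum ?k z (e - d) (e + d)"
  have odd: "odd ?k" using j by simp
  have swap: "factorization_sum ?k z p q = factorization_sum ?k z q p" for p q
    using factorization_sum_swap[OF z(1)] sign_odd_cycle[OF z odd] by simp
  \<comment> \<open>Negating \<open>d\<close> exchanges the two side lengths.\<close>
  have 1: "?F (- d) e = ?F d e" for d e
    using swap[of "e + d" "e - d"] by simp
  \<comment> \<open>Negating \<open>e\<close> exchanges the side lengths and negates both.\<close>
  have 2: "?F d (- e) = ?F d e" for d e
  proof -
    have "- e - d = - (e + d)" "- e + d = - (e - d)" by simp_all
    then show ?thesis by (simp only: factorization_sum_uminus[OF z odd] swap[of "e + d" "e - d"])
  qed
  obtain G where G: "newton_form ?x j G" "\<And>d e. symmetrize ?F d e = G (d\<^sup>2) (e\<^sup>2)"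
    using factorization_sum_even_newton_form[OF z, of j ?x] j unfolding even_newton_form_def by auto
  have FG: "?F d e = G (d\<^sup>2) (e\<^sup>2)" for d e
    unfolding G(2)[symmetric] symmetrize_def by (simp only: 1 2) simp
  have "inj ?x"
  proof (rule injI)
    fix r s :: nat assume "?x r = ?x s"
    \<comment> \<open>The natural number \<open>r * (r + 1)\<close> is strictly increasing in
      \<open>r\<close>, which separates the nodes.\<close>
    moreover have "?x r = of_nat (r * (r + 1)) + 1/4" for r
      by (simp add: power2_eq_square field_simps)
    ultimately have "of_nat (r * (r + 1)) = (of_nat (s * (s + 1)) :: complex)"
      by (simp only: add_right_cancel)
    then have eq: "r * (r + 1) = s * (s + 1)" by (simp only: of_nat_eq_iff)
    show "r = s"
    proof (rule ccontr)
      assume "r \<noteq> s"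
      then consider "r < s" | "s < r" by linarith
      then show False using eq mult_strict_mono[of r s "r + 1" "s + 1"] mult_strict_mono[of s r "s + 1" "r + 1"]
        by cases auto
    qed
  qed
  \<comment> \<open>At the half-integers \<open>a + 1/2\<close> and \<open>b + 1/2\<close> the side
    lengths are \<open>b - a\<close> and \<open>a + b + 1\<close>, natural numbers with sum
    \<open>2 * b + 1\<close>, which is at most \<open>2 * j - 1\<close>.\<close>
  moreover have "G (?x a) (?x b) = 0" if ab: "a \<le> b" "b < j" for a b
  proof -
    have "G (?x a) (?x b) = ?F (of_nat a + 1/2) (of_nat b + 1/2)" by (rule FG[symmetric])
    also have "\<dots> = factorization_sum ?k z (of_nat (b - a)) (of_nat (a + b + 1))"
      using ab by (simp add: of_nat_diff algebra_simps)
    also have "\<dots> = 0" using ab by (intro factorization_sum_vanishes[OF z]) auto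
    finally show ?thesis .
  qed
  ultimately obtain \<alpha> where \<alpha>: "\<And>D E. G D E = (\<Sum>a\<le>j. \<alpha> a * (\<Prod>r<a. D - ?x r) * (\<Prod>r\<in>{a..<j}. E - ?x r))"
    using newton_form_triangle_zeros[OF G(1)] by blast
  show ?thesis by (rule that[of \<alpha>]) (simp only: FG \<alpha>)
qed

section \<open>Factorial forms of the coefficients\<close>

lemma prod_shift_fact: "(\<Prod>r<n. of_nat c + of_nat r + 1) * fact c = (fact (c + n) :: complex)"
proof (induction n)
  case (Suc n)
  have "(\<Prod>r<Suc n. of_nat c + of_nat r + 1) * fact c
      = ((\<Prod>r<n. of_nat c + of_nat r + 1) * fact c) * (of_nat c + of_nat n + 1 :: complex)"
    by (simp add: mult_ac)
  also have "\<dots> = fact (c + Suc n)" unfolding Suc.IH by (simp add: algebra_simps)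
  finally show ?case .
qed simp

lemma rising2_odd_fact:
  "rising2 (2 * of_nat i + 1) a * 2 ^ a * fact (i + a) * fact (2 * i) = (fact (2 * i + 2 * a) * fact i :: complex)"
proof (induction a)
  case (Suc a)
  have "rising2 (2 * of_nat i + 1) (Suc a) * 2 ^ Suc a * fact (i + Suc a) * fact (2 * i)
      = (rising2 (2 * of_nat i + 1) a * 2 ^ a * fact (i + a) * fact (2 * i))
        * ((2 * of_nat i + 1 + 2 * of_nat a) * 2 * (of_nat i + of_nat a + 1) :: complex)"
    by (simp add: rising2_def algebra_simps)
  also have "\<dots> = fact (2 * i + 2 * a) * fact i * ((2 * of_nat i + 1 + 2 * of_nat a) * 2 * (of_nat i + of_nat a + 1))"
    by (simp only: Suc.IH)
  also have "\<dots> = fact (2 * i + 2 * Suc a) * fact i"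
    by (simp add: algebra_simps)
  finally show ?case .
qed (simp add: rising2_def)

lemma double_fact_odd: "double_fact (2 * Suc a - 1) = (2 * a + 1) * double_fact (2 * a - 1)"
  by (cases a) simp_all

lemma double_fact_fact: "2 ^ a * fact a * of_nat (double_fact (2 * a - 1)) = (fact (2 * a) :: complex)"
proof (induction a)
  case (Suc a)
  have "2 ^ Suc a * fact (Suc a) * of_nat (double_fact (2 * Suc a - 1))
      = (2 ^ a * fact a * of_nat (double_fact (2 * a - 1))) * (2 * (of_nat a + 1) * (2 * of_nat a + 1) :: complex)"
    unfolding double_fact_odd by (simp add: algebra_simps)
  also have "\<dots> = fact (2 * a) * (2 * (of_nat a + 1) * (2 * of_nat a + 1))"
    by (simp only: Suc.IH)
  also have "\<dots> = fact (2 * Suc a)" by (simp add: algebra_simps)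
  finally show ?case .
qed simp

lemma double_fact_pos: "double_fact n > 0"
  by (induction n rule: double_fact.induct) simp_all

text \<open>The separate value at index 0 fits the general formula, since truncated subtraction
  gives \<open>double_fact 0 = 1\<close> there.\<close>

lemma f_coeff_eq:
  "f_coeff a j = (-1) ^ a * (falling (of_nat j) a * rising2 (2 * of_nat j - 1) a)
     / (fact a * of_nat (double_fact (2 * a - 1)))"
  by (simp add: f_coeff_def falling_def rising2_def)

text \<open>Rising and double factorials are rewritten as ratios of factorials, cleared of
  denominators; in this form the coefficients can be compared with values of the falling
  factorial.\<close>

lemma Cat_f_coeff:
  assumes "a \<le> Suc i"
  shows "Cat i * f_coeff a (Suc i) * (fact (2 * a) * fact (Suc i - a) * fact (i + a)) = (-1) ^ a * fact (2 * i + 2 * a)"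
proof -
  let ?F = "falling (of_nat (Suc i)) a :: complex" and ?R = "rising2 (2 * of_nat i + 1) a :: complex"
  let ?d = "of_nat (double_fact (2 * a - 1)) :: complex"
  have F: "?F * fact (Suc i - a) = fact (Suc i)" using falling_of_nat_fact[OF assms] .
  have R: "?R * 2 ^ a * fact (i + a) * fact (2 * i) = fact (2 * i + 2 * a) * fact i" by (rule rising2_odd_fact)
  have d: "?d \<noteq> 0" using double_fact_pos[of "2 * a - 1"] by simp
  have alg: "(A / (B * B')) * (s * (F * R) / (u * v)) * ((t * u * v) * g * h) = s * ((F * g) * (R * t * h * A)) / (B * B')"
    if "u \<noteq> 0" "v \<noteq> 0" for A B B' s F R u v t g h :: complex
    using that by (simp add: mult_ac)
  have "2 * of_nat (Suc i) - 1 = (2 * of_nat i + 1 :: complex)" by simp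
  then have f: "f_coeff a (Suc i) = (-1) ^ a * (?F * ?R) / (fact a * ?d)" by (simp only: f_coeff_eq)
  have "Cat i * f_coeff a (Suc i) * (fact (2 * a) * fact (Suc i - a) * fact (i + a))
      = (fact (2 * i) / (fact i * fact (i + 1))) * ((-1) ^ a * (?F * ?R) / (fact a * ?d))
        * ((2 ^ a * fact a * ?d) * fact (Suc i - a) * fact (i + a))"
    unfolding f Cat_def double_fact_fact by (rule refl)
  also have "\<dots> = (-1) ^ a * ((?F * fact (Suc i - a)) * (?R * 2 ^ a * fact (i + a) * fact (2 * i))) / (fact i * fact (i + 1))"
    by (rule alg) (use d in simp_all)
  also have "\<dots> = (-1) ^ a * (fact (Suc i) * (fact (2 * i + 2 * a) * fact i)) / (fact i * fact (i + 1))"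
    unfolding F R by simp
  also have "\<dots> = (-1) ^ a * fact (2 * i + 2 * a)" by (simp del: fact_Suc)
  finally show ?thesis .
qed

text \<open>Chu-Vandermonde: the powers of 2 cancel and the sum is the hypergeometric series with
  upper parameters \<open>- j\<close>, \<open>j - 1/2\<close> and lower parameter
  \<open>1/2\<close>, at argument 1. Its value contains the Pochhammer symbol of
  \<open>1 - j\<close> with \<open>j\<close> factors, one of which is 0.\<close>

lemma sum_f_coeff:
  assumes "j > 0"
  shows "(\<Sum>a\<le>j. f_coeff a j) = 0"
proof -
  have "f_coeff a j = pochhammer (of_nat j - 1/2) a * pochhammer (- of_nat j) a / (of_nat (fact a) * pochhammer (1/2) a)" for a
  proof -
    have 1: "pochhammer (- of_nat j :: complex) a = (-1) ^ a * falling (of_nat j) a"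
      by (induction a) (simp_all add: falling_def pochhammer_Suc algebra_simps)
    have 2: "rising2 (2 * of_nat j - 1 :: complex) a = 2 ^ a * pochhammer (of_nat j - 1/2) a"
      by (induction a) (simp_all add: rising2_def pochhammer_Suc algebra_simps)
    have 3: "of_nat (double_fact (2 * a - 1)) = 2 ^ a * pochhammer (1/2 :: complex) a"
    proof (induction a)
      case (Suc a)
      show ?case unfolding double_fact_odd of_nat_mult Suc.IH by (simp add: pochhammer_Suc algebra_simps)
    qed simp
    show ?thesis unfolding f_coeff_eq 1 2 3 by simp
  qed
  then have "(\<Sum>a\<le>j. f_coeff a j) = (\<Sum>a\<in>{0..j}. pochhammer (of_nat j - 1/2) a * pochhammer (- of_nat j) a / (of_nat (fact a) * pochhammer (1/2) a))"
    by (simp add: atMost_atLeast0)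
  also have "\<dots> = pochhammer (1/2 - (of_nat j - 1/2)) j / pochhammer (1/2 :: complex) j"
  proof (rule Vandermonde_pochhammer, rule ballI)
    fix i assume "i \<in> {0..<j}"
    show "(1/2 :: complex) \<noteq> - of_nat i"
    proof
      assume "(1/2 :: complex) = - of_nat i"
      then have "Re (1/2) = Re (- of_nat i)" by (rule arg_cong)
      then show False by simp
    qed
  qed
  also have "1/2 - (of_nat j - 1/2) = (- of_nat (j - 1) :: complex)"
    using assms by (simp add: of_nat_diff)
  also have "pochhammer (- of_nat (j - 1) :: complex) j = 0"
    using assms by (intro pochhammer_of_nat_eq_0_lemma) simp
  finally show ?thesis by simp
qed

text \<open>The difference \<open>x s - x r\<close> factors as \<open>s - r\<close> times
  \<open>s + r + 1\<close>, so the products split into two runs of consecutive integers. These are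
  the quantities that appear when the expansion is evaluated at \<open>d\<^sup>2 = x (Suc m)\<close>
  and \<open>e\<^sup>2 = x m\<close>.\<close>

lemma evaluation_products:
  fixes i m :: nat
  defines "x \<equiv> \<lambda>r :: nat. (of_nat r + 1/2 :: complex)\<^sup>2"
  assumes m: "m \<le> i"
  shows "(\<Prod>r<Suc m. x (Suc m) - x r) = fact (2 * Suc m)"
    and "(\<Prod>r\<in>{Suc m..<Suc i}. x m - x r) * fact (2 * m + 1) = (-1) ^ (i - m) * (fact (i - m) * fact (i + m + 1))"
    and "falling (- (2 * of_nat (Suc m))) (2 * i + 1) * fact (2 * m + 1) = - (fact (2 * i + 2 * m + 2) :: complex)"
proof -
  have fall: "(\<Prod>r<n. of_nat n - of_nat r) = (fact n :: complex)" for n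
    using falling_of_nat_fact[of n n] by (simp add: falling_def)
  have "(\<Prod>r<Suc m. x (Suc m) - x r) = (\<Prod>r<Suc m. (of_nat (Suc m) - of_nat r) * (of_nat (Suc m) + of_nat r + 1))"
    by (intro prod.cong refl) (simp add: x_def power2_eq_square field_simps)
  also have "\<dots> = fact (Suc m) * (\<Prod>r<Suc m. of_nat (Suc m) + of_nat r + 1)"
    by (simp only: prod.distrib fall)
  also have "\<dots> = fact (2 * Suc m)"
    using prod_shift_fact[of "Suc m" "Suc m"] by (simp only: mult.commute[of "fact (Suc m)"] mult_2)
  finally show "(\<Prod>r<Suc m. x (Suc m) - x r) = fact (2 * Suc m)" .
  have "(\<Prod>r\<in>{Suc m..<Suc i}. x m - x r) = (\<Prod>r<i - m. x m - x (Suc m + r))"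
    by (rule prod.reindex_bij_witness[of _ "\<lambda>r. Suc m + r" "\<lambda>r. r - Suc m"]) (use m in auto)
  also have "\<dots> = (\<Prod>r<i - m. (-1) * ((of_nat 0 + of_nat r + 1) * (of_nat (2 * m + 1) + of_nat r + 1)))"
    by (intro prod.cong refl) (simp add: x_def power2_eq_square field_simps)
  also have "\<dots> = (-1) ^ (i - m) * ((\<Prod>r<i - m. of_nat 0 + of_nat r + 1) * (\<Prod>r<i - m. of_nat (2 * m + 1) + of_nat r + 1))"
    by (simp only: prod.distrib prod_constant card_lessThan)
  also have "\<dots> * fact (2 * m + 1) = (-1) ^ (i - m) * (fact (i - m) * fact (2 * m + 1 + (i - m)))"
    using prod_shift_fact[of 0 "i - m"] prod_shift_fact[of "2 * m + 1" "i - m"]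
    by (simp only: mult.assoc fact_0 mult_1_right add_0)
  also have "2 * m + 1 + (i - m) = i + m + 1" using m by simp
  finally show "(\<Prod>r\<in>{Suc m..<Suc i}. x m - x r) * fact (2 * m + 1) = (-1) ^ (i - m) * (fact (i - m) * fact (i + m + 1))" .
  have "falling (- (2 * of_nat (Suc m))) (2 * i + 1) = (\<Prod>r<2 * i + 1. (-1) * (of_nat (2 * m + 1) + of_nat r + 1 :: complex))"
    unfolding falling_def by (intro prod.cong refl) (simp add: algebra_simps)
  also have "\<dots> = - (\<Prod>r<2 * i + 1. of_nat (2 * m + 1) + of_nat r + 1)"
    unfolding prod.distrib prod_constant by simp
  also have "\<dots> * fact (2 * m + 1) = - fact (2 * m + 1 + (2 * i + 1))"
    using prod_shift_fact[of "2 * m + 1" "2 * i + 1"] by (simp only: mult_minus_left)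
  also have "2 * m + 1 + (2 * i + 1) = 2 * i + 2 * m + 2" by simp
  finally show "falling (- (2 * of_nat (Suc m))) (2 * i + 1) * fact (2 * m + 1) = - (fact (2 * i + 2 * m + 2) :: complex)" .
qed

section \<open>Determination of the coefficients\<close>

theorem theorem1p4:
  fixes j :: nat and d e :: complex
  assumes "j > 0"
  shows "Ch_rect {#2 * j - 1#} (e - d) (e + d) =
    (-1) ^ (j - 1) * Cat (j - 1) *
      (\<Sum>k=0..j. f_coeff k j *
         (\<Prod>r\<in>{0..<k}. d^2 - (of_nat r + 1/2)^2) *
         (\<Prod>r\<in>{k..<j}. e^2 - (of_nat r + 1/2)^2))"
proof -
  define x where "x r = (of_nat r + 1/2 :: complex)\<^sup>2" for r :: nat
  define z where "z = inv (std_cycle (2 * j - 1))"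
  obtain i where i: "j = Suc i" using assms by (cases j) auto
  have k: "2 * j - 1 > 0" using assms by simp
  have z: "z \<in> sym_group (2 * j - 1)" "cyclic_on z {..<2 * j - 1}"
    unfolding z_def
    by (rule sym_group_closed(3)[OF std_cycle_sym_group],
        rule cyclic_on_inv[OF std_cycle_sym_group cyclic_on_std_cycle[OF k]])
  obtain \<alpha> where \<alpha>: "\<And>d e. factorization_sum (2 * j - 1) z (e - d) (e + d)
      = (\<Sum>a\<le>j. \<alpha> a * (\<Prod>r<a. d\<^sup>2 - x r) * (\<Prod>r\<in>{a..<j}. e\<^sup>2 - x r))"
    using factorization_sum_expansion[OF z assms] unfolding x_def by blast
  \<comment> \<open>The claimed coefficients. They are compared with \<alpha> first at positive
    indices and then at index 0.\<close>
  define \<beta> where "\<beta> a = (-1) ^ i * Cat i * f_coeff a j" for a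
  have \<alpha>\<beta>: "\<alpha> (Suc m) = \<beta> (Suc m)" if m: "m \<le> i" for m
  proof -
    \<comment> \<open>With this choice \<open>p = 1\<close>, so the left side is a falling
      factorial. On the right, \<open>?d\<^sup>2 = x (Suc m)\<close> removes all terms of index
      above \<open>Suc m\<close> and \<open>?e\<^sup>2 = x m\<close> all terms of index at most
      \<open>m\<close>; a single coefficient survives.\<close>
    let ?d = "- (of_nat (Suc m) + 1/2) :: complex" and ?e = "- (of_nat m + 1/2) :: complex"
    have de: "?d\<^sup>2 = x (Suc m)" "?e\<^sup>2 = x m" unfolding x_def by (rule power2_minus)+
    let ?t = "\<lambda>a. \<alpha> a * (\<Prod>r<a. x (Suc m) - x r) * (\<Prod>r\<in>{a..<j}. x m - x r)"
    have "?e - ?d = 1" "?e + ?d = - (2 * of_nat (Suc m))" "2 * j - 1 = 2 * i + 1"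
      by (simp_all add: i)
    then have "falling (- (2 * of_nat (Suc m))) (2 * i + 1) = factorization_sum (2 * j - 1) z (?e - ?d) (?e + ?d)"
      by (simp only: factorization_sum_1)
    also have "\<dots> = (\<Sum>a\<le>j. ?t a)" unfolding \<alpha> de ..
    also have "\<dots> = (\<Sum>a\<in>{Suc m}. ?t a)"
    proof (rule sum.mono_neutral_right)
      show "\<forall>a\<in>{..j} - {Suc m}. ?t a = 0"
      proof
        fix a assume a: "a \<in> {..j} - {Suc m}"
        show "?t a = 0"
        proof (cases "a \<le> m")
          case True
          then have "(\<Prod>r\<in>{a..<j}. x m - x r) = 0" using m by (intro prod_zero) (auto simp: i)
          then show ?thesis by simp
        next
          case False
          then have "(\<Prod>r<a. x (Suc m) - x r) = 0" using a by (intro prod_zero) auto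
          then show ?thesis by simp
        qed
      qed
    qed (use m in \<open>auto simp: i\<close>)
    finally have eq: "falling (- (2 * of_nat (Suc m))) (2 * i + 1)
        = \<alpha> (Suc m) * (\<Prod>r<Suc m. x (Suc m) - x r) * (\<Prod>r\<in>{Suc m..<Suc i}. x m - x r)"
      by (simp only: sum.insert sum.empty i finite.emptyI empty_iff not_False_eq_True add_0_right)
    note P = evaluation_products[OF m, folded x_def]
    \<comment> \<open>The common nonzero factor by which \<alpha> and \<beta> are both multiplied
      for comparison.\<close>
    define C :: complex where "C = fact (2 * Suc m) * (fact (i - m) * fact (i + m + 1))"
    have "C \<noteq> 0" unfolding C_def by (intro no_zero_divisors fact_nonzero)
    have "- fact (2 * i + 2 * m + 2) = falling (- (2 * of_nat (Suc m))) (2 * i + 1) * (fact (2 * m + 1) :: complex)"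
      by (rule P(3)[symmetric])
    also have "\<dots> = \<alpha> (Suc m) * fact (2 * Suc m) * ((\<Prod>r\<in>{Suc m..<Suc i}. x m - x r) * fact (2 * m + 1))"
      unfolding eq P(1) by (simp only: mult.assoc)
    also have "\<dots> = \<alpha> (Suc m) * C * (-1) ^ (i - m)"
      unfolding P(2) C_def by (simp only: mult_ac)
    finally have A: "\<alpha> (Suc m) * C * (-1) ^ (i - m) = - fact (2 * i + 2 * m + 2)" ..
    have "2 * i + 2 * Suc m = 2 * i + 2 * m + 2" "Suc i - Suc m = i - m" "i + Suc m = i + m + 1" by simp_all
    then have cf: "Cat i * f_coeff (Suc m) (Suc i) * C = (-1) ^ Suc m * fact (2 * i + 2 * m + 2)"
      using Cat_f_coeff[OF iffD2[OF Suc_le_mono m]] unfolding C_def by (simp only: mult.assoc)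
    have "\<beta> (Suc m) * C * (-1) ^ (i - m) = (-1) ^ i * (Cat i * f_coeff (Suc m) (Suc i) * C) * (-1) ^ (i - m)"
      by (simp only: \<beta>_def i mult.assoc)
    also have "\<dots> = (-1) ^ i * (-1) ^ Suc m * (-1) ^ (i - m) * fact (2 * i + 2 * m + 2)"
      unfolding cf by (simp only: mult_ac)
    \<comment> \<open>The exponents add up to \<open>2 * i + 1\<close>, because
      \<open>m \<le> i\<close> makes \<open>i - m\<close> a true difference.\<close>
    also have "(-1) ^ i * (-1) ^ Suc m * (-1) ^ (i - m) = (-1 :: complex) ^ (2 * i + 1)"
      using m by (simp flip: power_add)
    finally have "\<beta> (Suc m) * C * (-1) ^ (i - m) = - fact (2 * i + 2 * m + 2)" by simp
    then show ?thesis using A \<open>C \<noteq> 0\<close> by (metis mult_right_cancel power_not_zero zero_neq_neg_one mult_eq_0_iff)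
  qed
  \<comment> \<open>At \<open>d = e = 0\<close> the polynomial vanishes, since every permutation has
    a cycle, and all terms share the same full product over \<open>r < j\<close>. This gives the sum
    of the coefficients, the one relation still needed for index 0.\<close>
  have "0 = (\<Sum>a\<le>j. \<alpha> a * ((\<Prod>r<a. 0\<^sup>2 - x r) * (\<Prod>r\<in>{a..<j}. 0\<^sup>2 - x r)))"
    using \<alpha>[of 0 0] factorization_sum_0[OF k, of z 0] by (simp add: mult.assoc)
  also have "\<dots> = (\<Sum>a\<le>j. \<alpha> a * (\<Prod>r<j. 0\<^sup>2 - x r))"
  proof (rule sum.cong[OF refl])
    fix a assume "a \<in> {..j}"
    then have un: "{..<j} = {..<a} \<union> {a..<j}" by auto
    have "(\<Prod>r<j. 0\<^sup>2 - x r) = (\<Prod>r<a. 0\<^sup>2 - x r) * (\<Prod>r\<in>{a..<j}. 0\<^sup>2 - x r)"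
      by (subst un, rule prod.union_disjoint) auto
    then show "\<alpha> a * ((\<Prod>r<a. 0\<^sup>2 - x r) * (\<Prod>r\<in>{a..<j}. 0\<^sup>2 - x r)) = \<alpha> a * (\<Prod>r<j. 0\<^sup>2 - x r)" by simp
  qed
  also have "\<dots> = (\<Sum>a\<le>j. \<alpha> a) * (\<Prod>r<j. 0\<^sup>2 - x r)" by (simp only: sum_distrib_right)
  finally have "(\<Sum>a\<le>j. \<alpha> a) * (\<Prod>r<j. 0\<^sup>2 - x r) = 0" ..
  \<comment> \<open>The real part of \<open>of_nat r + 1/2\<close> is positive, so the common
    product can be cancelled.\<close>
  moreover have "x r \<noteq> 0" for r
  proof -
    have "Re (of_nat r + 1/2) \<noteq> Re 0" by simp
    then show ?thesis unfolding x_def by (metis power_eq_0_iff)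
  qed
  ultimately have "(\<Sum>a\<le>j. \<alpha> a) = 0" by (simp add: prod_zero_iff)
  moreover have "(\<Sum>a\<le>j. \<beta> a) = 0"
    unfolding \<beta>_def sum_distrib_left[symmetric] sum_f_coeff[OF assms] by simp
  moreover have "(\<Sum>a<j. \<alpha> (Suc a)) = (\<Sum>a<j. \<beta> (Suc a))"
    using \<alpha>\<beta> by (intro sum.cong) (auto simp: i)
  \<comment> \<open>Both families sum to 0 and agree at all positive indices, so they agree at 0
    too.\<close>
  ultimately have "\<alpha> 0 = \<beta> 0"
    unfolding sum.atMost_shift by (metis add_right_cancel)
  then have all: "\<alpha> a = \<beta> a" if "a \<le> j" for a
    using that \<alpha>\<beta> by (cases a) (auto simp: i)
  have "Ch_rect {#2 * j - 1#} (e - d) (e + d) = factorization_sum (2 * j - 1) z (e - d) (e + d)"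
    unfolding z_def by (rule Ch_rect_polynomial) (rule Ch_rect_eq_factorization_sum[OF k])
  also have "\<dots> = (\<Sum>a\<le>j. \<beta> a * (\<Prod>r<a. d\<^sup>2 - x r) * (\<Prod>r\<in>{a..<j}. e\<^sup>2 - x r))"
    unfolding \<alpha> by (intro sum.cong refl) (simp add: all)
  also have "\<dots> = (-1) ^ i * Cat i * (\<Sum>a\<le>j. f_coeff a j * (\<Prod>r<a. d\<^sup>2 - x r) * (\<Prod>r\<in>{a..<j}. e\<^sup>2 - x r))"
    unfolding \<beta>_def sum_distrib_left by (simp only: mult.assoc)
  finally show ?thesis
    by (simp add: i x_def atMost_atLeast0 lessThan_atLeast0)
qed

end
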